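(* Let $H$ be a subgroup of $T(d,\mathbb{R})_+$. The group $G=\mathbb{R}^d\rtimes H$ may be embedded into the symplectic group, namely there exists a group embedding $\phi\colon G\to Sp(d,\mathbb{R})$. Moreover, the restriction to $\mathcal{H}$ of the quasi-regular representation $\pi$ of $G$ is unitarily equivalent to $\mu\circ\phi$ restricted to $\mathcal{H}$, where $\mu$ is the metaplectic representation of $Sp(d,\mathbb{R})$.
   Context: $T(d,\mathbb{R})_+=\{h\in\mathrm{GL}(d,\mathbb{R}): h_{1,1}>0 \text{ and } h_{i,j}=0 \text{ for every } i>j\}$. The group $G=\mathbb{R}^d\rtimes H$ consists of pairs $(x,h)\in\mathbb{R}^d\times H$ with product $(x,h)(y,g)=(x+hy,hg)$. Its quasi-regular representation on $L^2(\mathbb{R}^d)$ is $[\pi(x,h)f](y)=|\det h|^{-1/2}f(h^{-1}(y-x))$. $\mathcal{H}=\{f\in L^2(\mathbb{R}^d):\mathrm{supp}\,\hat f\subseteq\Theta_L\}$, where $\Theta_L=\{\xi\in\mathbb{R}^d:\xi_1\le 0\}$ and $\hat f(\xi)=\int f(x)e^{-2\pi i\langle x,\xi\rangle}\,dx$ is the Fourier transform. $Sp(d,\mathbb{R})$ is the group of $2d\times 2d$ real symplectic matrices. The metaplectic representation $\mu$ (in general defined on $Sp(d,\mathbb{R})$ only up to sign) is realized here in the frequency variable, i.e. it acts on the Fourier transforms $\hat f$ of functions $f\in L^2(\mathbb{R}^d)$. For a symmetric $d\times d$ matrix $\sigma$ and $k\in\mathrm{GL}(d,\mathbb{R})$,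 on the element $g(\sigma,k)=\begin{pmatrix}k&0\\ \sigma k&k^{-T}\end{pmatrix}\in Sp(d,\mathbb{R})$ (with $k^{-T}=(k^{-1})^T$) it is given by $\mu(g(\sigma,k))\hat f(\xi)=|\det k|^{-1/2}e^{\pi i\langle\sigma\xi,\xi\rangle}\hat f(k^{-1}\xi)$. Accordingly, "restricted to $\mathcal{H}$" for $\mu\circ\phi$ refers to the action on $\hat f\in L^2(\Theta_L)$, which is the image of $\mathcal{H}$ under the Fourier transform. *)

theory Defs
  imports "HOL-Analysis.Analysis" "HOL-Algebra.Group"
begin

section \<open>Matrix groups\<close>

text \<open>
  The linear order on the finite index type \<^typ>\<open>'d\<close> plays the role of the order on
  \<open>{1, \<dots>, d}\<close>, so \<open>first\<close> is the index 1.
\<close>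

definition first :: "'d::{finite,wellorder}" where
  "first = (LEAST i. True)"

definition GL :: "(real^'d^'d) monoid" where
  "GL = \<lparr>carrier = {h. invertible h}, mult = (**), one = mat 1\<rparr>"

definition T_plus :: "(real^'d::{finite,wellorder}^'d::_) set" where
  "T_plus = {h. invertible h \<and> h $ first $ first > 0 \<and> (\<forall>i j. j < i \<longrightarrow> h $ i $ j = 0)}"

definition semidirect :: "(real^'d^'d) set \<Rightarrow> ((real^'d) \<times> (real^'d^'d)) monoid" where
  "semidirect H =
     \<lparr>carrier = UNIV \<times> H,
      mult = (\<lambda>(x, h) (y, g). (x + h *v y, h ** g)),
      one = (0, mat 1)\<rparr>"

definition block_matrix ::
    "real^'d^'d \<Rightarrow> real^'d^'d \<Rightarrow> real^'d^'d \<Rightarrow> real^'d^'d \<Rightarrow> real^('d::finite + 'd)^('d::finite + 'd)" where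
  "block_matrix A B C D =
     (\<chi> i j. case (i, j) of
        (Inl a, Inl b) \<Rightarrow> A $ a $ b
      | (Inl a, Inr b) \<Rightarrow> B $ a $ b
      | (Inr a, Inl b) \<Rightarrow> C $ a $ b
      | (Inr a, Inr b) \<Rightarrow> D $ a $ b)"

definition symplectic :: "(real^('d::finite + 'd)^('d::finite + 'd)) set" where
  "symplectic =
     {A. transpose A ** block_matrix 0 (mat 1) (- mat 1) 0 ** A
           = block_matrix 0 (mat 1) (- mat 1) 0}"

definition Sp :: "(real^('d::finite + 'd)^('d::finite + 'd)) monoid" where
  "Sp = \<lparr>carrier = symplectic, mult = (**), one = mat 1\<rparr>"

definition lower_symp :: "real^'d^'d \<Rightarrow> real^'d^'d \<Rightarrow> real^('d::finite + 'd)^('d::finite + 'd)" where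
  "lower_symp \<sigma> k = block_matrix k 0 (\<sigma> ** k) (transpose (matrix_inv k))"


section \<open>Square-integrable functions and unitary equivalence\<close>

text \<open>
  Elements of \<open>L\<^sup>2\<close> are represented by square-integrable Borel functions; all identities in \<open>L\<^sup>2\<close>
  are identities almost everywhere.
\<close>

type_synonym 'd signal = "real^'d \<Rightarrow> complex"

definition L2 :: "'d::finite signal set" where
  "L2 = {f \<in> borel_measurable lborel. integrable lborel (\<lambda>x. (cmod (f x))\<^sup>2)}"

definition L2_norm :: "'d::finite signal \<Rightarrow> real" where
  "L2_norm f = sqrt (LINT x|lborel. (cmod (f x))\<^sup>2)"

definition ae_eq :: "'d::finite signal \<Rightarrow> 'd::finite signal \<Rightarrow> bool" where
  "ae_eq f g \<longleftrightarrow> (AE x in lborel. f x = g x)"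

text \<open>
  Unitary maps between subspaces of \<open>L\<^sup>2\<close>. Compatibility with \<^const>\<open>ae_eq\<close> follows from linearity
  and isometry.
\<close>

definition unitary_map ::
    "'d::finite signal set \<Rightarrow> 'd::finite signal set \<Rightarrow>
     ('d::finite signal \<Rightarrow> 'd::finite signal) \<Rightarrow> bool" where
  "unitary_map V W U \<longleftrightarrow>
     (\<forall>f\<in>V. U f \<in> W) \<and>
     (\<forall>f\<in>V. \<forall>g\<in>V. ae_eq (U (\<lambda>x. f x + g x)) (\<lambda>x. U f x + U g x)) \<and>
     (\<forall>f\<in>V. \<forall>c. ae_eq (U (\<lambda>x. c * f x)) (\<lambda>x. c * U f x)) \<and>
     (\<forall>f\<in>V. L2_norm (U f) = L2_norm f) \<and>
     (\<forall>g\<in>W. \<exists>f\<in>V. ae_eq (U f) g)"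

text \<open>
  \<open>\<rho>\<^sub>1\<close> restricted to \<open>V\<close> is unitarily equivalent to \<open>\<rho>\<^sub>2\<close> restricted to \<open>W\<close>; in particular \<open>V\<close>
  and \<open>W\<close> are invariant subspaces.
\<close>

definition unitarily_equivalent ::
    "'g set \<Rightarrow>
     ('g \<Rightarrow> 'd::finite signal \<Rightarrow> 'd::finite signal) \<Rightarrow> 'd::finite signal set \<Rightarrow>
     ('g \<Rightarrow> 'd::finite signal \<Rightarrow> 'd::finite signal) \<Rightarrow> 'd::finite signal set \<Rightarrow> bool" where
  "unitarily_equivalent G \<rho>\<^sub>1 V \<rho>\<^sub>2 W \<longleftrightarrow>
     (\<forall>g\<in>G. \<forall>f\<in>V. \<rho>\<^sub>1 g f \<in> V) \<and>
     (\<forall>g\<in>G. \<forall>f\<in>W. \<rho>\<^sub>2 g f \<in> W) \<and>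
     (\<exists>U. unitary_map V W U \<and> (\<forall>g\<in>G. \<forall>f\<in>V. ae_eq (U (\<rho>\<^sub>1 g f)) (\<rho>\<^sub>2 g (U f))))"


section \<open>The Fourier transform and the subspace of signals\<close>

definition fourier_integral :: "'d::finite signal \<Rightarrow> 'd::finite signal" where
  "fourier_integral f \<xi> = (LINT x|lborel. f x * exp (- 2 * pi * \<i> * (x \<bullet> \<xi>)))"

text \<open>
  \<open>is_fourier f g\<close>: \<open>g\<close> represents the Fourier-Plancherel transform of \<open>f \<in> L\<^sup>2\<close>, the
  \<open>L\<^sup>2\<close>-continuous extension of the Fourier integral from \<open>L\<^sup>1 \<inter> L\<^sup>2\<close>.
\<close>

definition is_fourier :: "'d::finite signal \<Rightarrow> 'd::finite signal \<Rightarrow> bool" where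
  "is_fourier f g \<longleftrightarrow> f \<in> L2 \<and> g \<in> L2 \<and>
     (\<exists>u. (\<forall>n::nat. u n \<in> L2 \<and> integrable lborel (u n)) \<and>
          (\<lambda>n. L2_norm (\<lambda>x. u n x - f x)) \<longlonglongrightarrow> 0 \<and>
          (\<forall>n. fourier_integral (u n) \<in> L2) \<and>
          (\<lambda>n. L2_norm (\<lambda>\<xi>. fourier_integral (u n) \<xi> - g \<xi>)) \<longlonglongrightarrow> 0)"

definition ess_supp :: "'d::finite signal \<Rightarrow> (real^'d) set" where
  "ess_supp f = - \<Union>{S. open S \<and> (AE x in lborel. x \<in> S \<longrightarrow> f x = 0)}"

definition Theta_L :: "(real^'d::{finite,wellorder}) set" where
  "Theta_L = {\<xi>. \<xi> $ first \<le> 0}"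

definition H_space :: "(real^'d::{finite,wellorder} \<Rightarrow> complex) set" where
  "H_space = {f \<in> L2. \<exists>g. is_fourier f g \<and> ess_supp g \<subseteq> Theta_L}"

definition L2_on :: "(real^'d::finite) set \<Rightarrow> 'd::finite signal set" where
  "L2_on S = {f \<in> L2. AE x in lborel. x \<notin> S \<longrightarrow> f x = 0}"


section \<open>The representations\<close>

definition quasi_regular ::
    "(real^'d) \<times> (real^'d^'d) \<Rightarrow> 'd::finite signal \<Rightarrow> 'd::finite signal" where
  "quasi_regular = (\<lambda>(x, h) f y. of_real (\<bar>det h\<bar> powr (- 1/2)) * f (matrix_inv h *v (y - x)))"

text \<open>
  The Schroedinger representation of the Heisenberg group (modulo its centre), acting on functions
  of the frequency variable; \<open>z = (q, p)\<close>.
\<close>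

definition schroedinger ::
    "real^('d::finite + 'd) \<Rightarrow> 'd::finite signal \<Rightarrow> 'd::finite signal" where
  "schroedinger z F \<xi> =
     (let q = (\<chi> i. z $ Inl i); p = (\<chi> i. z $ Inr i)
      in exp (2 * pi * \<i> * (p \<bullet> \<xi>) - pi * \<i> * (p \<bullet> q)) * F (\<xi> - q))"

text \<open>
  \<open>U\<close> is a metaplectic operator for \<open>A\<close>: it is unitary and intertwines the Schroedinger
  representation with its composition with \<open>A\<close>. This determines \<open>U\<close> up to a phase.
\<close>

definition metaplectic_operator ::
    "real^('d::finite + 'd)^('d::finite + 'd) \<Rightarrow> ('d::finite signal \<Rightarrow> 'd::finite signal) \<Rightarrow> bool" where
  "metaplectic_operator A U \<longleftrightarrow>
     unitary_map L2 L2 U \<and>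
     (\<forall>z. \<forall>F\<in>L2. ae_eq (U (schroedinger z F)) (schroedinger (A *v z) (U F)))"

definition lower_symp_operator ::
    "real^'d^'d \<Rightarrow> real^'d^'d \<Rightarrow> 'd::finite signal \<Rightarrow> 'd::finite signal" where
  "lower_symp_operator \<sigma> k F \<xi> =
     of_real (\<bar>det k\<bar> powr (- 1/2)) * exp (pi * \<i> * ((\<sigma> *v \<xi>) \<bullet> \<xi>)) * F (matrix_inv k *v \<xi>)"

text \<open>
  The metaplectic representation. A metaplectic operator is chosen for each matrix; the choice is
  normalised on the elements \<^const>\<open>lower_symp\<close>, where it is given by an explicit formula. (With the
  factor \<open>\<bar>det k\<bar>\<close> this formula agrees for \<open>det k < 0\<close> with the double-valued
  metaplectic representation only up to the phases \<open>\<plusminus>\<i>\<close>.)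
\<close>

definition metaplectic ::
    "real^('d::finite + 'd)^('d::finite + 'd) \<Rightarrow> 'd::finite signal \<Rightarrow> 'd::finite signal" where
  "metaplectic A =
     (SOME U. metaplectic_operator A U \<and>
        (\<forall>\<sigma> k. transpose \<sigma> = \<sigma> \<and> invertible k \<and> A = lower_symp \<sigma> k
                  \<longrightarrow> U = lower_symp_operator \<sigma> k))"


section \<open>The metaplectic representation on block-triangular matrices\<close>

text \<open>
  The explicit formula does define a metaplectic operator, so the choice made in \<^const>\<open>metaplectic\<close>
  is realised by it (lemma \<open>metaplectic_lower_symp\<close> below).
\<close>

lemma matrix_inv_mult:
  fixes k :: "real^'d^'d"
  assumes "invertible k"
  shows "k ** matrix_inv k = mat 1" "matrix_inv k ** k = mat 1"
  using someI_ex[OF assms[unfolded invertible_def]] unfolding matrix_inv_def by auto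

lemma lower_symp_inject:
  assumes "invertible k" and eq: "lower_symp \<sigma> k = lower_symp \<sigma>' k'"
  shows "k' = k" "\<sigma>' = \<sigma>"
proof -
  show k: "k' = k"
  proof -
    have "k' $ a $ b = k $ a $ b" for a b
      using arg_cong[OF eq, of "\<lambda>M. M $ Inl a $ Inl b"] by (simp add: lower_symp_def block_matrix_def)
    then show ?thesis by (simp add: vec_eq_iff)
  qed
  have "(\<sigma>' ** k') $ a $ b = (\<sigma> ** k) $ a $ b" for a b
    using arg_cong[OF eq, of "\<lambda>M. M $ Inr a $ Inl b"] by (simp add: lower_symp_def block_matrix_def)
  then have "\<sigma>' ** k = \<sigma> ** k" by (simp add: vec_eq_iff k)
  then have "\<sigma>' ** (k ** matrix_inv k) = \<sigma> ** (k ** matrix_inv k)"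
    by (simp add: matrix_mul_assoc)
  then show "\<sigma>' = \<sigma>" by (simp add: matrix_inv_mult[OF assms(1)])
qed

lemma sum_UNIV_Plus: "(\<Sum>j\<in>(UNIV::('d::finite + 'd) set). f j) = (\<Sum>a\<in>UNIV. f (Inl a)) + (\<Sum>a\<in>UNIV. f (Inr a))"
proof -
  have "sum f (range Inl \<union> range Inr) = sum f (range Inl) + sum f (range Inr)"
    by (rule sum.union_disjoint) auto
  then show ?thesis by (simp add: UNIV_sum sum.reindex)
qed

lemma lower_symp_vec:
  "(\<chi> i. (lower_symp \<sigma> k *v z) $ Inl i) = k *v (\<chi> i. z $ Inl i)"
  "(\<chi> i. (lower_symp \<sigma> k *v z) $ Inr i) =
     \<sigma> *v (k *v (\<chi> i. z $ Inl i)) + transpose (matrix_inv k) *v (\<chi> i. z $ Inr i)"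
  unfolding matrix_vector_mul_assoc
  by (simp_all add: lower_symp_def block_matrix_def matrix_vector_mult_def sum_UNIV_Plus vec_eq_iff)

lemma block_matrix_mult:
  "block_matrix A B C D ** block_matrix A' B' C' D' =
     block_matrix (A ** A' + B ** C') (A ** B' + B ** D') (C ** A' + D ** C') (C ** B' + D ** D')"
  by (simp add: vec_eq_iff block_matrix_def matrix_matrix_mult_def sum_UNIV_Plus split: sum.splits)

lemma transpose_block_matrix:
  "transpose (block_matrix A B C D) = block_matrix (transpose A) (transpose C) (transpose B) (transpose D)"
  by (simp add: vec_eq_iff block_matrix_def transpose_def split: sum.splits)

lemma transpose_zero: "transpose (0::real^'n^'m) = 0" by (simp add: vec_eq_iff transpose_def)
lemma matrix_mul_minus: "(A::real^'n^'m) ** (- B) = - (A ** B)" "(- A) ** (B::real^'k^'n) = - (A ** B)"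
  by (simp_all add: vec_eq_iff matrix_matrix_mult_def sum_negf)

lemma lower_symp_in_symplectic:
  assumes "transpose \<sigma> = \<sigma>" "invertible k"
  shows "lower_symp \<sigma> k \<in> symplectic"
proof -
  have *: "transpose k ** transpose (matrix_inv k) = mat 1"
    by (metis matrix_inv_mult(2)[OF assms(2)] matrix_transpose_mul transpose_mat)
  have **: "transpose k ** (\<sigma> ** k) - transpose (\<sigma> ** k) ** k = 0"
    by (simp add: matrix_transpose_mul assms(1) matrix_mul_assoc)
  show ?thesis
    using * ** matrix_inv_mult[OF assms(2)]
    by (simp add: symplectic_def lower_symp_def transpose_block_matrix block_matrix_mult transpose_zero matrix_mul_minus transpose_transpose)
qed


lemma lborel_linear:
  fixes k :: "real^'d::{finite,wellorder}^'d::_"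
  assumes k: "invertible k"
  shows "lborel = density (distr lborel borel (\<lambda>x. matrix_inv k *v x)) (\<lambda>_. ennreal (1 / \<bar>det k\<bar>))"
proof (rule lborel_eqI)
  fix l u :: "real^'d::{finite,wellorder}"
  assume lu: "\<And>b. b \<in> Basis \<Longrightarrow> l \<bullet> b \<le> u \<bullet> b"
  have d: "det k \<noteq> 0" using k by (simp add: invertible_det_nz)
  have meas: "(\<lambda>x. matrix_inv k *v x) \<in> borel_measurable borel"
    by (intro borel_measurable_continuous_onI matrix_vector_mult_linear_continuous_on)
  have inv: "k *v (matrix_inv k *v x) = x" "matrix_inv k *v (k *v x) = x" for x
    by (simp_all add: matrix_vector_mul_assoc matrix_inv_mult[OF k])
  have pre: "(\<lambda>x. matrix_inv k *v x) -` box l u = (\<lambda>x. k *v x) ` box l u"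
    by (auto simp: image_iff inv) (metis inv)
  have b: "(\<lambda>x. matrix_inv k *v x) -` box l u \<in> sets borel"
    using measurable_sets[OF meas, of "box l u"] by simp
  have lm: "(\<lambda>x. k *v x) ` box l u \<in> lmeasurable"
    by (rule measurable_linear_image) (auto)
  have "emeasure (distr lborel borel (\<lambda>x. matrix_inv k *v x)) (box l u) = emeasure lborel ((\<lambda>x. k *v x) ` box l u)"
    by (subst emeasure_distr) (use meas in \<open>auto simp: pre\<close>)
  also have "\<dots> = emeasure lebesgue ((\<lambda>x. k *v x) ` box l u)"
    using b pre by simp
  also have "\<dots> = ennreal (measure lebesgue ((\<lambda>x. k *v x) ` box l u))"
    using lm by (simp add: emeasure_eq_measure2)
  also have "\<dots> = ennreal (\<bar>det k\<bar> * measure lebesgue (box l u))"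
    by (subst measure_linear_image) auto
  finally have e: "emeasure (distr lborel borel (\<lambda>x. matrix_inv k *v x)) (box l u)
      = ennreal (\<bar>det k\<bar> * (\<Prod>b\<in>Basis. (u - l) \<bullet> b))"
    using lu by (simp add: measure_lborel_box_eq)
  show "emeasure (density (distr lborel borel (\<lambda>x. matrix_inv k *v x)) (\<lambda>_. ennreal (1 / \<bar>det k\<bar>))) (box l u)
      = ennreal (\<Prod>b\<in>Basis. (u - l) \<bullet> b)"
    using d lu by (simp add: emeasure_density_const e ennreal_mult[symmetric] prod_nonneg inner_diff_left)
qed simp

lemma
  fixes k :: "real^'d::{finite,wellorder}^'d::_"
  assumes k: "invertible k"
  shows measurable_matrix_inv: "(\<lambda>x. matrix_inv k *v x) \<in> borel_measurable borel"
    and integrable_matrix_inv: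
      "integrable lborel f \<Longrightarrow> integrable lborel (\<lambda>x. f (matrix_inv k *v x) :: real)"
    and integral_matrix_inv:
      "f \<in> borel_measurable borel \<Longrightarrow> (LINT x|lborel. f (matrix_inv k *v x)) = \<bar>det k\<bar> * (LINT x|lborel. f x :: real)"
proof -
  have d: "det k \<noteq> 0" using k by (simp add: invertible_det_nz)
  show m [measurable]: "(\<lambda>x. matrix_inv k *v x) \<in> borel_measurable borel"
    by (intro borel_measurable_continuous_onI matrix_vector_mult_linear_continuous_on)
  show "integrable lborel (\<lambda>x. f (matrix_inv k *v x))" if "integrable lborel f" for f :: "_ \<Rightarrow> real"
  proof -
    have [measurable]: "f \<in> borel_measurable borel" using that by auto
    show ?thesis
    proof -
      have "integrable (density (distr lborel borel (\<lambda>x. matrix_inv k *v x)) (\<lambda>_. ennreal (1 / \<bar>det k\<bar>))) f"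
        using that by (simp only: lborel_linear[OF k, symmetric])
      then have "integrable lborel (\<lambda>x. f (matrix_inv k *v x) / \<bar>det k\<bar>)"
        by (simp add: integrable_density integrable_distr_eq)
      then have "integrable lborel (\<lambda>x. \<bar>det k\<bar> * (f (matrix_inv k *v x) / \<bar>det k\<bar>))"
        by (rule integrable_mult_right)
      then show ?thesis using d by simp
    qed
  qed
  show "(LINT x|lborel. f (matrix_inv k *v x)) = \<bar>det k\<bar> * (LINT x|lborel. f x)"
    if [measurable]: "f \<in> borel_measurable borel" for f :: "_ \<Rightarrow> real"
  proof -
    have "(LINT x|lborel. f x) = (LINT x|density (distr lborel borel (\<lambda>x. matrix_inv k *v x)) (\<lambda>_. ennreal (1 / \<bar>det k\<bar>)). f x)"
      by (simp only: lborel_linear[OF k, symmetric])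
    also have "\<dots> = (LINT x|lborel. f (matrix_inv k *v x)) / \<bar>det k\<bar>"
      by (simp add: integral_density integral_distr)
    finally show ?thesis using d by simp
  qed
qed

lemma lower_symp_operator_L2:
  fixes k :: "real^'d::{finite,wellorder}^'d::_"
  assumes k: "invertible k" and F: "F \<in> L2"
  shows "lower_symp_operator \<sigma> k F \<in> L2" "L2_norm (lower_symp_operator \<sigma> k F) = L2_norm F"
proof -
  have d: "det k \<noteq> 0" using k by (simp add: invertible_det_nz)
  have F' [measurable]: "F \<in> borel_measurable borel" "integrable lborel (\<lambda>x. (cmod (F x))\<^sup>2)"
    using F by (auto simp: L2_def)
  note [measurable] = measurable_matrix_inv[OF k]
  have e: "(cmod (lower_symp_operator \<sigma> k F \<xi>))\<^sup>2 = 1 / \<bar>det k\<bar> * (cmod (F (matrix_inv k *v \<xi>)))\<^sup>2" for \<xi>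
  proof -
    have "(\<bar>det k\<bar> powr (- 1/2))\<^sup>2 = 1 / \<bar>det k\<bar>"
      using d by (simp add: power2_eq_square powr_add[symmetric] powr_minus_divide)
    then show ?thesis
      by (simp add: lower_symp_operator_def norm_mult power_mult_distrib norm_exp_eq_Re)
  qed
  have [measurable]: "(\<lambda>\<xi>. (\<sigma> *v \<xi>) \<bullet> \<xi>) \<in> borel_measurable borel"
    by (intro borel_measurable_continuous_onI continuous_intros matrix_vector_mult_linear_continuous_on)
  have "lower_symp_operator \<sigma> k F \<in> borel_measurable borel"
    unfolding lower_symp_operator_def[abs_def] by measurable
  then show "lower_symp_operator \<sigma> k F \<in> L2"
    by (simp add: L2_def e integrable_matrix_inv[OF k F'(2)])
  show "L2_norm (lower_symp_operator \<sigma> k F) = L2_norm F"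
    using d by (simp add: L2_norm_def e integral_matrix_inv[OF k, of "\<lambda>x. (cmod (F x))\<^sup>2"])
qed

lemma lower_symp_operator_inverse:
  fixes k :: "real^'d::{finite,wellorder}^'d::_"
  assumes k: "invertible k"
  shows "lower_symp_operator \<sigma> k (lower_symp_operator (- (transpose k ** \<sigma> ** k)) (matrix_inv k) F) = F"
proof
  fix \<xi>
  have ik: "invertible (matrix_inv k)" using k matrix_inv_mult[OF k] invertible_def by blast
  have ii: "matrix_inv (matrix_inv k) = k"
    by (metis k ik matrix_inv_mult matrix_mul_assoc matrix_mul_lid matrix_mul_rid)
  have d: "det k \<noteq> 0" using k by (simp add: invertible_det_nz)
  have "det k * det (matrix_inv k) = 1"
    by (metis det_I det_mul matrix_inv_mult(1)[OF k])
  then have 1: "\<bar>det k\<bar> powr (- 1/2) * \<bar>det (matrix_inv k)\<bar> powr (- 1/2) = 1"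
    by (metis abs_ge_zero abs_mult abs_one powr_mult powr_one_eq_one)
  have inv: "k *v (matrix_inv k *v x) = x" for x
    by (simp add: matrix_vector_mul_assoc matrix_inv_mult[OF k])
  have 2: "(transpose k ** \<sigma> ** k *v (matrix_inv k *v \<xi>)) \<bullet> (matrix_inv k *v \<xi>) = (\<sigma> *v \<xi>) \<bullet> \<xi>"
  proof -
    have "(transpose k ** \<sigma> ** k *v (matrix_inv k *v \<xi>)) = transpose k *v (\<sigma> *v \<xi>)"
      by (metis inv matrix_vector_mul_assoc)
    then show ?thesis by (metis dot_lmul_matrix inv vector_transpose_matrix inner_commute transpose_matrix_vector)
  qed
  have n: "(- M *v x) \<bullet> x = - ((M *v x) \<bullet> x)" for M :: "real^'d::{finite,wellorder}^'d::_" and x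
    by (simp add: matrix_vector_mult_def inner_vec_def sum_negf)
  have c: "complex_of_real (\<bar>det k\<bar> powr (- 1/2)) * complex_of_real (\<bar>det (matrix_inv k)\<bar> powr (- 1/2)) = 1"
    by (metis 1 of_real_mult of_real_1)
  show "lower_symp_operator \<sigma> k (lower_symp_operator (- (transpose k ** \<sigma> ** k)) (matrix_inv k) F) \<xi> = F \<xi>"
  proof -
    define t where "t = (\<sigma> *v \<xi>) \<bullet> \<xi>"
    have 3: "exp (pi * \<i> * t) * exp (pi * \<i> * (- t)) = 1"
      by (simp add: exp_add[symmetric])
    have "lower_symp_operator \<sigma> k (lower_symp_operator (- (transpose k ** \<sigma> ** k)) (matrix_inv k) F) \<xi>
       = of_real (\<bar>det k\<bar> powr (- 1/2)) * exp (pi * \<i> * t) *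
          (of_real (\<bar>det (matrix_inv k)\<bar> powr (- 1/2)) * exp (pi * \<i> * (- t)) * F \<xi>)"
      unfolding lower_symp_operator_def n 2 ii inv t_def of_real_minus ..
    also have "\<dots> = (of_real (\<bar>det k\<bar> powr (- 1/2)) * of_real (\<bar>det (matrix_inv k)\<bar> powr (- 1/2))) *
         (exp (pi * \<i> * t) * exp (pi * \<i> * (- t))) * F \<xi>"
      by (simp only: mult_ac)
    finally show ?thesis by (simp only: c 3 mult_1_left)
  qed
qed

lemma exp_swap:
  fixes a b c d D F :: complex
  assumes "a + b = c + d"
  shows "D * exp a * (exp b * F) = exp c * (D * exp d * F)"
proof -
  have "exp a * exp b = exp c * exp d" using assms by (simp only: exp_add[symmetric])
  then have "D * F * (exp a * exp b) = D * F * (exp c * exp d)" by simp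
  then show ?thesis by (simp only: mult_ac)
qed

lemma lower_symp_operator_intertwines:
  assumes k: "invertible k" and s: "transpose \<sigma> = \<sigma>"
  shows "lower_symp_operator \<sigma> k (schroedinger z F) = schroedinger (lower_symp \<sigma> k *v z) (lower_symp_operator \<sigma> k F)"
proof
  fix \<xi>
  define q p where qp: "q = (\<chi> i. z $ Inl i)" "p = (\<chi> i. z $ Inr i)"
  have sym: "(\<sigma> *v x) \<bullet> y = (\<sigma> *v y) \<bullet> x" for x y
    by (metis s dot_lmul_matrix inner_commute transpose_matrix_vector)
  have inv: "matrix_inv k *v (k *v x) = x" for x
    by (simp add: matrix_vector_mul_assoc matrix_inv_mult[OF k])
  have t: "(p v* matrix_inv k) \<bullet> x = p \<bullet> (matrix_inv k *v x)" for x
    by (simp add: dot_lmul_matrix)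
  have a: "matrix_inv k *v (\<xi> - k *v q) = matrix_inv k *v \<xi> - q"
    by (simp add: matrix_vector_mult_diff_distrib inv)
  have e: "pi * \<i> * ((\<sigma> *v \<xi>) \<bullet> \<xi>) + (2 * pi * \<i> * (p \<bullet> (matrix_inv k *v \<xi>)) - pi * \<i> * (p \<bullet> q))
    = 2 * pi * \<i> * ((\<sigma> *v (k *v q) + transpose (matrix_inv k) *v p) \<bullet> \<xi>)
        - pi * \<i> * ((\<sigma> *v (k *v q) + transpose (matrix_inv k) *v p) \<bullet> (k *v q))
      + pi * \<i> * ((\<sigma> *v (\<xi> - k *v q)) \<bullet> (\<xi> - k *v q))"
    using sym[of \<xi> "k *v q"]
    by (simp add: inner_add_left t inv matrix_vector_mult_diff_distrib inner_diff_left inner_diff_right algebra_simps)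
  show "lower_symp_operator \<sigma> k (schroedinger z F) \<xi> = schroedinger (lower_symp \<sigma> k *v z) (lower_symp_operator \<sigma> k F) \<xi>"
    unfolding lower_symp_operator_def schroedinger_def lower_symp_vec qp[symmetric] Let_def a
    by (rule exp_swap[OF e])
qed

lemma metaplectic_operator_lower_symp:
  fixes k :: "real^'d::{finite,wellorder}^'d::_"
  assumes s: "transpose \<sigma> = \<sigma>" and k: "invertible k"
  shows "metaplectic_operator (lower_symp \<sigma> k) (lower_symp_operator \<sigma> k)"
proof -
  have ik: "invertible (matrix_inv k)" using k matrix_inv_mult[OF k] invertible_def by blast
  have "\<exists>f\<in>L2. ae_eq (lower_symp_operator \<sigma> k f) g" if "g \<in> L2" for g
    using lower_symp_operator_inverse[OF k] lower_symp_operator_L2(1)[OF ik that]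
    by (metis (mono_tags, lifting) AE_I2 ae_eq_def)
  moreover have "lower_symp_operator \<sigma> k (\<lambda>x. f x + g x)
      = (\<lambda>x. lower_symp_operator \<sigma> k f x + lower_symp_operator \<sigma> k g x)" for f g
    by (rule ext) (simp only: lower_symp_operator_def distrib_left)
  moreover have "lower_symp_operator \<sigma> k (\<lambda>x. c * f x) = (\<lambda>x. c * lower_symp_operator \<sigma> k f x)" for c f
    by (rule ext) (simp only: lower_symp_operator_def mult_ac)
  ultimately show ?thesis
    unfolding metaplectic_operator_def unitary_map_def
    by (simp add: lower_symp_operator_L2[OF k] lower_symp_operator_intertwines[OF k s] ae_eq_def)
qed

lemma metaplectic_lower_symp:
  fixes k :: "real^'d::{finite,wellorder}^'d::_"
  assumes "transpose \<sigma> = \<sigma>" and "invertible k"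
  shows "metaplectic (lower_symp \<sigma> k) = lower_symp_operator \<sigma> k"
proof -
  have "\<exists>U. metaplectic_operator (lower_symp \<sigma> k) U \<and>
        (\<forall>\<sigma>' k'. transpose \<sigma>' = \<sigma>' \<and> invertible k' \<and> lower_symp \<sigma> k = lower_symp \<sigma>' k'
                  \<longrightarrow> U = lower_symp_operator \<sigma>' k')"
    using metaplectic_operator_lower_symp[OF assms] lower_symp_inject[OF assms(2)] by metis
  from someI_ex[OF this] show ?thesis
    unfolding metaplectic_def using assms by blast
qed

end

theory Submission
  imports Defs "HOL-Probability.Characteristic_Functions"
begin

text \<open>
  On the Fourier side the quasi-regular representation sends \<open>g\<close> to
  \<open>\<bar>det h\<bar>\<^sup>1\<^sup>/\<^sup>2 exp (- 2 \<pi> i \<langle>x, \<xi>\<rangle>) g (h\<^sup>T \<xi>)\<close>: a translation becomes a phase that is linear in the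
  frequency. The metaplectic operator of \<^term>\<open>lower_symp \<sigma> k\<close> also multiplies by a phase and
  composes with a linear map, but its phase \<open>\<pi> \<langle>\<sigma> \<eta>, \<eta>\<rangle>\<close> is quadratic. The two actions
  are matched by the quadratic substitution \<open>\<xi> = \<Psi>(\<eta>) = - (\<eta>\<^sub>1 / 2) \<eta>\<close>.

  First, \<open>- 2 \<langle>x, \<Psi>(\<eta>)\<rangle> = \<eta>\<^sub>1 \<langle>x, \<eta>\<rangle>\<close> is the quadratic form of a symmetric matrix \<open>\<sigma>\<^sub>x\<close> that
  depends linearly on \<open>x\<close>. Secondly, for an upper triangular \<open>h\<close> with \<open>h\<^sub>1\<^sub>1 > 0\<close> the transpose
  \<open>h\<^sup>T\<close> multiplies the first coordinate by \<open>h\<^sub>1\<^sub>1\<close>, so that \<open>h\<^sup>T \<Psi>(\<eta>) = \<Psi>(h\<^sub>1\<^sub>1\<^sup>-\<^sup>1\<^sup>/\<^sup>2 h\<^sup>T \<eta>)\<close>: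
  the substitution turns the linear action of \<open>h\<^sup>T\<close> into another linear action. Thirdly, \<open>\<Psi>\<close> is
  a diffeomorphism of the half space \<open>\<eta>\<^sub>1 < 0\<close> onto itself. It follows that
  \<open>\<phi>(x, h) = g(\<sigma>\<^sub>x, k)\<close> with \<open>k\<^sup>-\<^sup>1 = h\<^sub>1\<^sub>1\<^sup>-\<^sup>1\<^sup>/\<^sup>2 h\<^sup>T\<close> is an injective homomorphism
  (\<open>embedding_mon\<close>) and that composing the Fourier transform with
  \<open>g \<mapsto> \<bar>det \<Psi>'\<bar>\<^sup>1\<^sup>/\<^sup>2 (g \<circ> \<Psi>)\<close> intertwines the two representations (\<open>pullback_dual_action\<close>).
  The half space is where the restriction to \<^const>\<open>H_space\<close> enters: on all of \<open>\<real>\<^sup>d\<close> the map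
  \<open>\<Psi>\<close> is even, with values in \<^const>\<open>Theta_L\<close>.

  That this composition is unitary rests on the change-of-variables formula for \<open>\<Psi>\<close>
  (\<open>Psi_change_of_variables\<close>) and on the Plancherel theorem on \<open>\<real>\<^sup>d\<close>: the relation
  \<^const>\<open>is_fourier\<close> is isometric, single-valued almost everywhere, and onto \<open>L\<^sup>2\<close>. Plancherel's
  theorem is obtained by Gaussian regularisation. By Fubini, inserting a Gaussian factor into the
  inversion integral of \<open>u\<close> produces the average \<open>mollify \<delta> u\<close> of the translates of \<open>u\<close>
  (\<open>integral_fourier_gauss_cis\<close>), and these averages tend to \<open>u\<close> in \<open>L\<^sup>2\<close> because translation is
  continuous there. Surjectivity follows from the same identity, completeness of \<open>L\<^sup>2\<close>, and the
  fact that the graph of \<^const>\<open>is_fourier\<close> is closed.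
\<close>

section \<open>The space \<open>L\<^sup>2\<close> and its completeness\<close>

lemma L2_measurable: "f \<in> L2 \<Longrightarrow> f \<in> borel_measurable borel"
  by (simp add: L2_def)

lemma L2_integrable: "f \<in> L2 \<Longrightarrow> integrable lborel (\<lambda>x. (cmod (f x))\<^sup>2)"
  by (simp add: L2_def)

lemma L2_norm_nonneg: "L2_norm f \<ge> 0"
  by (simp add: L2_norm_def)

lemma L2_norm_squared: "(L2_norm f)\<^sup>2 = (LINT x|lborel. (cmod (f x))\<^sup>2)"
  by (simp add: L2_norm_def)

lemma nn_integral_eq_L2_norm:
  "f \<in> L2 \<Longrightarrow> (\<integral>\<^sup>+x. ennreal ((cmod (f x))\<^sup>2) \<partial>lborel) = ennreal ((L2_norm f)\<^sup>2)"
  by (simp add: L2_norm_squared nn_integral_eq_integral L2_integrable)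

text \<open>
  The nonnegative integral exists for every measurable function, so this is how membership in
  \<^const>\<open>L2\<close> is deduced from limit arguments such as Fatou's lemma and Tonelli's theorem.
\<close>

lemma L2_from_nn_integral:
  fixes f :: "'d::finite signal"
  assumes [measurable]: "f \<in> borel_measurable borel" and "c \<ge> 0"
    and le: "(\<integral>\<^sup>+x. ennreal ((cmod (f x))\<^sup>2) \<partial>lborel) \<le> ennreal (c\<^sup>2)"
  shows "f \<in> L2" "L2_norm f \<le> c"
proof -
  show f: "f \<in> L2"
    unfolding L2_def using le
    by (auto intro!: integrableI_bounded simp: less_top[symmetric] top_unique)
  have "ennreal ((L2_norm f)\<^sup>2) \<le> ennreal (c\<^sup>2)"
    using le by (simp add: nn_integral_eq_L2_norm[OF f])
  then show "L2_norm f \<le> c"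
    using \<open>c \<ge> 0\<close> by (simp add: power2_le_iff_abs_le L2_norm_nonneg)
qed

lemma L2_dominated:
  fixes f g :: "'d::finite signal"
  assumes [measurable]: "f \<in> borel_measurable borel" and g: "g \<in> L2"
    and le: "\<And>x. cmod (f x) \<le> cmod (g x)"
  shows "f \<in> L2" "L2_norm f \<le> L2_norm g"
proof -
  have "(\<integral>\<^sup>+x. ennreal ((cmod (f x))\<^sup>2) \<partial>lborel) \<le> (\<integral>\<^sup>+x. ennreal ((cmod (g x))\<^sup>2) \<partial>lborel)"
    by (intro nn_integral_mono ennreal_leI power_mono le) simp
  then have "(\<integral>\<^sup>+x. ennreal ((cmod (f x))\<^sup>2) \<partial>lborel) \<le> ennreal ((L2_norm g)\<^sup>2)"
    by (simp add: nn_integral_eq_L2_norm[OF g])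
  then show "f \<in> L2" "L2_norm f \<le> L2_norm g"
    using L2_from_nn_integral[of f "L2_norm g"] L2_norm_nonneg[of g] by auto
qed

text \<open>
  The parameter \<open>t\<close> makes the inequality sharp for each ratio of the two norms. Integrating it and
  then optimising \<open>t\<close> gives Minkowski's inequality.
\<close>

lemma norm_add_squared_le:
  fixes a b :: "'a::real_normed_vector"
  assumes "t > 0"
  shows "(norm (a + b))\<^sup>2 \<le> (1 + t) * (norm a)\<^sup>2 + (1 + 1 / t) * (norm b)\<^sup>2"
proof -
  have "(norm (a + b))\<^sup>2 \<le> (norm a + norm b)\<^sup>2"
    by (intro power_mono norm_triangle_ineq) simp
  moreover have "(1 + t) * (norm a)\<^sup>2 + (1 + 1 / t) * (norm b)\<^sup>2 - (norm a + norm b)\<^sup>2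
      = (t * norm a - norm b)\<^sup>2 / t"
    using assms by (simp add: field_simps power2_eq_square)
  moreover have "(t * norm a - norm b)\<^sup>2 / t \<ge> 0"
    using assms by simp
  ultimately show ?thesis by linarith
qed

lemma L2_add:
  fixes f g :: "'d::finite signal"
  assumes f: "f \<in> L2" and g: "g \<in> L2"
  shows "(\<lambda>x. f x + g x) \<in> L2"
proof -
  note [measurable] = L2_measurable[OF f] L2_measurable[OF g]
  have "integrable lborel (\<lambda>x. (cmod (f x + g x))\<^sup>2)"
    by (rule Bochner_Integration.integrable_bound
        [where f="\<lambda>x. (1 + 1) * (cmod (f x))\<^sup>2 + (1 + 1/1) * (cmod (g x))\<^sup>2"])
      (use L2_integrable[OF f] L2_integrable[OF g] norm_add_squared_le[of 1 "f _" "g _"] in auto)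
  then show ?thesis by (simp add: L2_def)
qed

lemma L2_cmult:
  fixes f :: "'d::finite signal"
  assumes f: "f \<in> L2"
  shows "(\<lambda>x. c * f x) \<in> L2"
  using f by (auto simp: L2_def norm_mult power_mult_distrib)

lemma L2_norm_cmult: "L2_norm (\<lambda>x. c * f x) = cmod c * L2_norm f"
  by (simp add: L2_norm_def norm_mult power_mult_distrib real_sqrt_mult)

lemma L2_diff:
  fixes f g :: "'d::finite signal"
  assumes f: "f \<in> L2" and g: "g \<in> L2"
  shows "(\<lambda>x. f x - g x) \<in> L2"
  using L2_add[OF f L2_cmult[OF g, of "-1"]] by simp

lemma L2_norm_triangle:
  fixes f g :: "'d::finite signal"
  assumes f: "f \<in> L2" and g: "g \<in> L2"
  shows "L2_norm (\<lambda>x. f x + g x) \<le> L2_norm f + L2_norm g"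
proof (rule field_le_epsilon)
  fix e :: real assume e: "e > 0"
  define a where "a = L2_norm f + e/2"
  define b where "b = L2_norm g + e/2"
  have ab: "a > 0" "b > 0" using e L2_norm_nonneg[of f] L2_norm_nonneg[of g] by (auto simp: a_def b_def)
  define t where "t = b / a"
  have t: "t > 0" using ab by (simp add: t_def)
  have "(L2_norm (\<lambda>x. f x + g x))\<^sup>2
      \<le> (LINT x|lborel. (1 + t) * (cmod (f x))\<^sup>2 + (1 + 1 / t) * (cmod (g x))\<^sup>2)"
    unfolding L2_norm_squared
    by (rule integral_mono)
      (use L2_integrable[OF f] L2_integrable[OF g] L2_integrable[OF L2_add[OF f g]] norm_add_squared_le[OF t] in auto)
  also have "\<dots> = (1 + t) * (L2_norm f)\<^sup>2 + (1 + 1 / t) * (L2_norm g)\<^sup>2"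
    using L2_integrable[OF f] L2_integrable[OF g] by (simp add: L2_norm_squared)
  also have "\<dots> \<le> (1 + t) * a\<^sup>2 + (1 + 1 / t) * b\<^sup>2"
    using t e L2_norm_nonneg[of f] L2_norm_nonneg[of g]
    by (intro add_mono mult_left_mono power_mono) (auto simp: a_def b_def)
  also have "\<dots> = (a + b)\<^sup>2"
    using ab by (simp add: t_def field_simps power2_eq_square)
  finally have "L2_norm (\<lambda>x. f x + g x) \<le> a + b"
    using ab by (smt (verit) power2_le_imp_le)
  then show "L2_norm (\<lambda>x. f x + g x) \<le> L2_norm f + L2_norm g + e"
    by (simp add: a_def b_def)
qed

lemma L2_norm_diff_commute: "L2_norm (\<lambda>x. f x - g x) = L2_norm (\<lambda>x. g x - f x)"
  by (simp add: L2_norm_def norm_minus_commute)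

lemma L2_norm_diff_triangle:
  fixes f g h :: "'d::finite signal"
  assumes "f \<in> L2" "g \<in> L2" "h \<in> L2"
  shows "L2_norm (\<lambda>x. f x - h x) \<le> L2_norm (\<lambda>x. f x - g x) + L2_norm (\<lambda>x. g x - h x)"
  using L2_norm_triangle[OF L2_diff[OF assms(1,2)] L2_diff[OF assms(2,3)]] by simp

lemma L2_norm_diff_ge:
  fixes f g :: "'d::finite signal"
  assumes f: "f \<in> L2" and g: "g \<in> L2"
  shows "\<bar>L2_norm f - L2_norm g\<bar> \<le> L2_norm (\<lambda>x. f x - g x)"
  using L2_norm_triangle[OF g L2_diff[OF f g]] L2_norm_triangle[OF f L2_diff[OF g f]]
    L2_norm_diff_commute[of f g] by simp

lemma L2_norm_tendsto:
  fixes f :: "'d::finite signal" and u :: "'b \<Rightarrow> 'd signal"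
  assumes "\<And>n. u n \<in> L2" "f \<in> L2" "((\<lambda>n. L2_norm (\<lambda>x. u n x - f x)) \<longlongrightarrow> 0) F"
  shows "((\<lambda>n. L2_norm (u n)) \<longlongrightarrow> L2_norm f) F"
  by (rule LIM_zero_cancel, rule tendsto_rabs_zero_cancel,
      rule tendsto_sandwich[OF _ _ tendsto_const assms(3)])
    (use L2_norm_diff_ge[OF assms(1,2)] in auto)

lemma L2_norm_eq_0_imp_AE:
  fixes f :: "'d::finite signal"
  assumes f: "f \<in> L2" and "L2_norm f = 0"
  shows "AE x in lborel. f x = 0"
  using assms integral_nonneg_eq_0_iff_AE[OF L2_integrable[OF f]] by (simp add: L2_norm_def)

lemma L2_norm_eq_0_if_AE: "AE x in lborel. f x = 0 \<Longrightarrow> L2_norm f = 0"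
  unfolding L2_norm_def by (subst integral_eq_zero_AE) auto

lemma ae_eq_iff_L2_norm:
  fixes f g :: "'d::finite signal"
  assumes "f \<in> L2" "g \<in> L2"
  shows "ae_eq f g \<longleftrightarrow> L2_norm (\<lambda>x. f x - g x) = 0"
  using L2_norm_eq_0_imp_AE[OF L2_diff[OF assms]] L2_norm_eq_0_if_AE[of "\<lambda>x. f x - g x"]
  by (auto simp: ae_eq_def)

text \<open>
  The Riesz-Fischer argument. Along a subsequence whose increments have norm at most
  \<open>(1/2) ^ k\<close>, the sum of the squared increments with weights \<open>2 ^ k\<close> has a finite integral, so
  the increments are summable almost everywhere and the subsequence converges there. Fatou's
  lemma upgrades this to convergence in norm of the whole sequence.
\<close>

theorem L2_complete:
  fixes f :: "nat \<Rightarrow> 'd::finite signal"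
  assumes f: "\<And>n. f n \<in> L2"
    and cauchy: "\<And>e. e > 0 \<Longrightarrow> \<exists>N. \<forall>m\<ge>N. \<forall>n\<ge>N. L2_norm (\<lambda>x. f m x - f n x) < e"
  shows "\<exists>g\<in>L2. (\<lambda>n. L2_norm (\<lambda>x. f n x - g x)) \<longlonglongrightarrow> 0"
proof -
  note [measurable] = L2_measurable[OF f]
  have "\<forall>k. \<exists>N. \<forall>m\<ge>N. \<forall>n\<ge>N. L2_norm (\<lambda>x. f m x - f n x) < (1/2)^k"
    using cauchy by simp
  then obtain N where N: "\<And>k m n. m \<ge> N k \<Longrightarrow> n \<ge> N k \<Longrightarrow> L2_norm (\<lambda>x. f m x - f n x) < (1/2)^k"
    by metis
  \<comment> \<open>summing the \<open>N i\<close> makes the chosen indices monotone and still large enough\<close>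
  define r where "r k = (\<Sum>i\<le>k. N i)" for k
  have rN: "r k \<ge> N k" for k
    unfolding r_def by (rule member_le_sum) auto
  have rS: "r (Suc k) \<ge> N k" for k
    using rN[of k] by (simp add: r_def)
  define d where "d k x = f (r (Suc k)) x - f (r k) x" for k x
  have d: "d k \<in> L2" "L2_norm (d k) \<le> (1/2)^k" for k
    using L2_diff[OF f f, of "r (Suc k)" "r k"] N[OF rS rN, of k] by (auto simp: d_def[abs_def])
  note [measurable] = L2_measurable[OF d(1)]
  have "(\<integral>\<^sup>+x. (\<Sum>k. ennreal (2^k * (cmod (d k x))\<^sup>2)) \<partial>lborel)
      = (\<Sum>k. \<integral>\<^sup>+x. ennreal (2^k * (cmod (d k x))\<^sup>2) \<partial>lborel)"
    by (rule nn_integral_suminf) measurable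
  also have "\<dots> = (\<Sum>k. ennreal (2^k * (L2_norm (d k))\<^sup>2))"
    by (simp add: ennreal_mult nn_integral_cmult nn_integral_eq_L2_norm[OF d(1)])
  also have "\<dots> \<le> (\<Sum>k. ennreal ((1/2)^k))"
  proof (intro suminf_le ennreal_leI)
    fix k :: nat
    have "2^k * (L2_norm (d k))\<^sup>2 \<le> 2^k * ((1/2)^k)\<^sup>2"
      by (intro mult_left_mono power_mono d L2_norm_nonneg) simp
    also have "\<dots> = (1/2)^k"
      by (simp add: power2_eq_square power_mult_distrib[symmetric] mult.assoc[symmetric])
    finally show "2^k * (L2_norm (d k))\<^sup>2 \<le> (1/2)^k" .
  qed auto
  also have "\<dots> = ennreal (\<Sum>k. (1/2)^k)"
    by (rule suminf_ennreal2) (auto simp: summable_geometric)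
  finally have "(\<integral>\<^sup>+x. (\<Sum>k. ennreal (2^k * (cmod (d k x))\<^sup>2)) \<partial>lborel) \<noteq> \<infinity>"
    by (metis ennreal_less_top infinity_ennreal_def leD)
  then have "AE x in lborel. (\<Sum>k. ennreal (2^k * (cmod (d k x))\<^sup>2)) \<noteq> \<infinity>"
    by (intro nn_integral_noteq_infinite) measurable
  then have conv: "AE x in lborel. convergent (\<lambda>k. f (r k) x)"
  proof eventually_elim
    case (elim x)
    then have s: "summable (\<lambda>k. 2^k * (cmod (d k x))\<^sup>2)"
      by (intro summable_suminf_not_top) auto
    have "summable (\<lambda>k. d k x)"
    proof (rule summable_comparison_test')
      show "summable (\<lambda>k. (1/2)^k + 2^k * (cmod (d k x))\<^sup>2)"
        using s by (intro summable_add) auto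
      fix k :: nat
      \<comment> \<open>with weights, square summability dominates summability: \<open>b \<le> w + b\<^sup>2 / w\<close> for \<open>w = (1/2) ^ k\<close>\<close>
      have "2 * (2^k * cmod (d k x)) \<le> 1 + (2^k * cmod (d k x))\<^sup>2"
        using sum_squares_bound[of 1 "2^k * cmod (d k x)"] by simp
      moreover have "2^k * cmod (d k x) \<ge> 0" by simp
      ultimately have "2^k * cmod (d k x) \<le> 1 + (2^k * cmod (d k x))\<^sup>2" by linarith
      then have "2^k * cmod (d k x) \<le> 2^k * ((1/2)^k + 2^k * (cmod (d k x))\<^sup>2)"
        by (simp add: distrib_left power_mult_distrib power2_eq_square mult_ac power_divide)
      then show "norm (d k x) \<le> (1/2)^k + 2^k * (cmod (d k x))\<^sup>2"
        by simp
    qed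
    then have "convergent (\<lambda>k. \<Sum>i<k. d i x)"
      by (simp add: summable_iff_convergent)
    then have "convergent (\<lambda>k. f (r 0) x + (\<Sum>i<k. d i x))"
      by (intro convergent_add convergent_const)
    moreover have "f (r 0) x + (\<Sum>i<k. d i x) = f (r k) x" for k
      by (simp add: d_def sum_lessThan_telescope[of "\<lambda>k. f (r k) x"])
    ultimately show ?case by simp
  qed
  define g where "g x = lim (\<lambda>k. f (r k) x)" for x
  have g[measurable]: "g \<in> borel_measurable borel"
    unfolding g_def by (rule borel_measurable_lim_metric) simp
  have lim: "AE x in lborel. (\<lambda>k. f (r k) x) \<longlonglongrightarrow> g x"
    using conv by eventually_elim (simp add: g_def convergent_LIMSEQ_iff)
  have close: "(\<lambda>x. f n x - g x) \<in> L2 \<and> L2_norm (\<lambda>x. f n x - g x) \<le> (1/2)^K" if "n \<ge> N K" for n K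
  proof -
    have "(\<integral>\<^sup>+x. ennreal ((cmod (f n x - g x))\<^sup>2) \<partial>lborel)
        = (\<integral>\<^sup>+x. liminf (\<lambda>k. ennreal ((cmod (f n x - f (r k) x))\<^sup>2)) \<partial>lborel)"
    proof (rule nn_integral_cong_AE)
      show "AE x in lborel. ennreal ((cmod (f n x - g x))\<^sup>2) = liminf (\<lambda>k. ennreal ((cmod (f n x - f (r k) x))\<^sup>2))"
        using lim
      proof eventually_elim
        case (elim x)
        then have "(\<lambda>k. ennreal ((cmod (f n x - f (r k) x))\<^sup>2)) \<longlonglongrightarrow> ennreal ((cmod (f n x - g x))\<^sup>2)"
          by (intro tendsto_intros)
        then show ?case
          by (rule lim_imp_Liminf[OF sequentially_bot, symmetric])
      qed
    qed
    also have "\<dots> \<le> liminf (\<lambda>k. \<integral>\<^sup>+x. ennreal ((cmod (f n x - f (r k) x))\<^sup>2) \<partial>lborel)"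
      by (rule nn_integral_liminf) measurable
    also have "\<dots> = liminf (\<lambda>k. ennreal ((L2_norm (\<lambda>x. f n x - f (r k) x))\<^sup>2))"
      by (simp add: nn_integral_eq_L2_norm[OF L2_diff[OF f f]])
    also have "\<dots> \<le> limsup (\<lambda>k. ennreal ((L2_norm (\<lambda>x. f n x - f (r k) x))\<^sup>2))"
      by (rule Liminf_le_Limsup) simp
    also have "\<dots> \<le> ennreal (((1/2)^K)\<^sup>2)"
    proof (rule Limsup_bounded, rule eventually_sequentiallyI[of K])
      fix k assume "k \<ge> K"
      have "N K \<le> r K" by (rule rN)
      also have "r K \<le> r k" unfolding r_def by (rule sum_mono2) (use \<open>k \<ge> K\<close> in auto)
      finally show "ennreal ((L2_norm (\<lambda>x. f n x - f (r k) x))\<^sup>2) \<le> ennreal (((1/2)^K)\<^sup>2)"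
        using N[OF that, of "r k"] by (intro ennreal_leI power_mono L2_norm_nonneg) auto
    qed
    finally show ?thesis
      using L2_from_nn_integral[of "\<lambda>x. f n x - g x" "(1/2)^K"] by simp
  qed
  have "(\<lambda>x. f (N 0) x - (f (N 0) x - g x)) \<in> L2"
    by (rule L2_diff[OF f conjunct1[OF close[OF order_refl]]])
  then have "g \<in> L2" by simp
  moreover have "(\<lambda>n. L2_norm (\<lambda>x. f n x - g x)) \<longlonglongrightarrow> 0"
  proof (rule LIMSEQ_I)
    fix e :: real assume "e > 0"
    then obtain K where "(1/2)^K < e" using real_arch_pow_inv[of e "1/2"] by auto
    then show "\<exists>no. \<forall>n\<ge>no. norm (L2_norm (\<lambda>x. f n x - g x) - 0) < e"
    proof (intro exI[of _ "N K"] allI impI)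
      fix n assume "n \<ge> N K"
      then show "norm (L2_norm (\<lambda>x. f n x - g x) - 0) < e"
        using close[of K n] L2_norm_nonneg[of "\<lambda>x. f n x - g x"] \<open>(1/2)^K < e\<close> by simp
    qed
  qed
  ultimately show ?thesis by blast
qed

section \<open>Gaussians and their Fourier transform\<close>

lemma
  fixes f :: "'a::euclidean_space \<Rightarrow> 'b::{banach, second_countable_topology}"
  assumes c: "c \<noteq> 0" and [measurable]: "f \<in> borel_measurable borel"
  shows lborel_integrable_affine_iff: "integrable lborel (\<lambda>x. f (t + c *\<^sub>R x)) \<longleftrightarrow> integrable lborel f"
    and lborel_integral_affine: "(LINT x|lborel. f x) = \<bar>c\<bar> ^ DIM('a) *\<^sub>R (LINT x|lborel. f (t + c *\<^sub>R x))"
proof -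
  have "integrable lborel f \<longleftrightarrow>
      integrable (density (distr lborel borel (\<lambda>x. t + c *\<^sub>R x)) (\<lambda>_. ennreal (\<bar>c\<bar>^DIM('a)))) f"
    using lborel_affine[OF c, of t] by (simp add: ennreal_power)
  also have "\<dots> \<longleftrightarrow> integrable lborel (\<lambda>x. \<bar>c\<bar> ^ DIM('a) *\<^sub>R f (t + c *\<^sub>R x))"
    by (simp add: integrable_density integrable_distr_eq)
  also have "\<dots> \<longleftrightarrow> integrable lborel (\<lambda>x. f (t + c *\<^sub>R x))"
    using c integrable_scaleR_right[of "1 / \<bar>c\<bar> ^ DIM('a)" lborel "\<lambda>x. \<bar>c\<bar> ^ DIM('a) *\<^sub>R f (t + c *\<^sub>R x)"]
      integrable_scaleR_right[of "\<bar>c\<bar> ^ DIM('a)" lborel "\<lambda>x. f (t + c *\<^sub>R x)"] by auto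
  finally show "integrable lborel (\<lambda>x. f (t + c *\<^sub>R x)) \<longleftrightarrow> integrable lborel f" ..
  have "(LINT x|lborel. f x) =
      (LINT x|density (distr lborel borel (\<lambda>x. t + c *\<^sub>R x)) (\<lambda>_. ennreal (\<bar>c\<bar>^DIM('a))). f x)"
    using lborel_affine[OF c, of t] by (simp add: ennreal_power)
  then show "(LINT x|lborel. f x) = \<bar>c\<bar> ^ DIM('a) *\<^sub>R (LINT x|lborel. f (t + c *\<^sub>R x))"
    by (simp add: integral_density integral_distr)
qed

lemma
  fixes f :: "'a::euclidean_space \<Rightarrow> real \<Rightarrow> 'b::{real_normed_field, banach, second_countable_topology}"
  assumes f: "\<And>b. b \<in> Basis \<Longrightarrow> integrable lborel (f b)"
  shows integrable_lborel_prod: "integrable lborel (\<lambda>x. \<Prod>b\<in>Basis. f b (x \<bullet> b))"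
    and integral_lborel_prod: "(LINT x|lborel. (\<Prod>b\<in>Basis. f b (x \<bullet> b))) = (\<Prod>b\<in>Basis. (LINT x|lborel. f b x))"
proof -
  interpret product_sigma_finite "\<lambda>_::'a. lborel :: real measure" ..
  define s where "s g = (\<Sum>b\<in>Basis. g b *\<^sub>R b)" for g :: "'a \<Rightarrow> real"
  have [measurable]: "s \<in> measurable (\<Pi>\<^sub>M b\<in>Basis. lborel) borel" unfolding s_def by measurable
  have [measurable]: "(\<lambda>x. \<Prod>b\<in>Basis. f b (x \<bullet> b)) \<in> borel_measurable borel"
  proof (rule borel_measurable_prod)
    fix b :: 'a assume "b \<in> Basis"
    then have [measurable]: "f b \<in> borel_measurable borel" using f by auto
    show "(\<lambda>x. f b (x \<bullet> b)) \<in> borel_measurable borel" by measurable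
  qed
  have e: "(\<Prod>b\<in>Basis. f b (s g \<bullet> b)) = (\<Prod>b\<in>Basis. f b (g b))" for g
    by (intro prod.cong) (auto simp: s_def)
  have l: "(lborel :: 'a measure) = distr (\<Pi>\<^sub>M b\<in>Basis. lborel) borel s"
    unfolding s_def by (rule lborel_eq)
  show "integrable lborel (\<lambda>x. \<Prod>b\<in>Basis. f b (x \<bullet> b))"
    by (subst l) (simp add: integrable_distr_eq e product_integrable_prod f)
  show "(LINT x|lborel. (\<Prod>b\<in>Basis. f b (x \<bullet> b))) = (\<Prod>b\<in>Basis. (LINT x|lborel. f b x))"
    by (subst l) (simp add: integral_distr e product_integral_prod f)
qed

text \<open>
  This is the characteristic function of the standard normal distribution, rescaled by
  \<open>c = sqrt (2 * pi)\<close> to the normalisation in which the Gaussian is its own Fourier transform.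
\<close>

lemma
  shows integrable_gaussian_real: "integrable lborel (\<lambda>x::real. exp (- pi * x\<^sup>2))"
    and integral_gaussian_cis_real:
      "(LINT x|lborel. of_real (exp (- pi * x\<^sup>2)) * cis (2 * pi * (x * t))) = of_real (exp (- pi * t\<^sup>2))"
proof -
  define c where "c = sqrt (2 * pi)"
  have c: "c \<noteq> 0" "c > 0" "c\<^sup>2 = 2 * pi" by (auto simp: c_def)
  have d: "std_normal_density (c * x) = exp (- pi * x\<^sup>2) / c" for x
    by (simp add: std_normal_density_def power_mult_distrib c c_def[symmetric])
  have "integrable lborel std_normal_density"
    using integrable_std_normal_moment[of 0] by simp
  then have "integrable lborel (\<lambda>x. std_normal_density (0 + c * x))"
    by (rule lborel_integrable_real_affine) (use c in auto)
  then have "integrable lborel (\<lambda>x. c * (exp (- pi * x\<^sup>2) / c))"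
    by (intro integrable_mult_right) (simp add: d)
  then show "integrable lborel (\<lambda>x::real. exp (- pi * x\<^sup>2))"
    using c by simp
  have "of_real (exp (- pi * t\<^sup>2)) = char std_normal_distribution (c * t)"
    by (simp add: char_std_normal_distribution power_mult_distrib c)
  also have "\<dots> = (LINT x|lborel. std_normal_density x *\<^sub>R iexp (c * t * x))"
    by (simp add: char_def integral_density)
  also have "\<dots> = \<bar>c\<bar> *\<^sub>R (LINT x|lborel. std_normal_density (0 + c * x) *\<^sub>R iexp (c * t * (0 + c * x)))"
    by (rule lborel_integral_real_affine[OF c(1)])
  also have "\<dots> = (LINT x|lborel. c *\<^sub>R (std_normal_density (0 + c * x) *\<^sub>R iexp (c * t * (0 + c * x))))"
    using c(2) by (simp only: integral_scaleR_right abs_of_pos)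
  also have "\<dots> = (LINT x|lborel. of_real (exp (- pi * x\<^sup>2)) * cis (2 * pi * (x * t)))"
  proof (intro Bochner_Integration.integral_cong refl)
    fix x
    have e: "c * t * (0 + c * x) = 2 * pi * (x * t)"
      using c(3) by (simp add: power2_eq_square mult_ac)
    show "c *\<^sub>R (std_normal_density (0 + c * x) *\<^sub>R iexp (c * t * (0 + c * x)))
        = of_real (exp (- pi * x\<^sup>2)) * cis (2 * pi * (x * t))"
      unfolding e using c(1) by (simp add: d cis_conv_exp scaleR_conv_of_real)
  qed
  finally show "(LINT x|lborel. of_real (exp (- pi * x\<^sup>2)) * cis (2 * pi * (x * t))) = of_real (exp (- pi * t\<^sup>2))" ..
qed

definition gauss :: "real \<Rightarrow> 'a::euclidean_space \<Rightarrow> real" where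
  "gauss \<delta> x = exp (- pi * \<delta>\<^sup>2 * (x \<bullet> x))"

lemma gauss_measurable [measurable]: "gauss \<delta> \<in> borel_measurable borel"
  unfolding gauss_def[abs_def] by measurable

lemma gauss_bounds: "0 < gauss \<delta> x" "gauss \<delta> x \<le> 1"
  by (auto simp: gauss_def)

lemma gauss_scaleR: "gauss \<delta> (c *\<^sub>R x) = gauss (\<delta> * c) x"
  by (simp add: gauss_def power2_eq_square mult_ac)

lemma prod_cis: "finite A \<Longrightarrow> (\<Prod>b\<in>A. cis (f b)) = cis (\<Sum>b\<in>A. f b)"
  by (induction rule: finite_induct) (auto simp: cis_mult)

text \<open>
  Both the Gaussian and the character split into a product over the coordinates.
\<close>

lemma
  fixes t :: "'a::euclidean_space"
  shows integrable_gauss_1: "integrable lborel (gauss 1 :: 'a \<Rightarrow> real)"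
    and integral_gauss_1_cis:
      "(LINT x|lborel. of_real (gauss 1 x) * cis (2 * pi * (x \<bullet> t))) = of_real (gauss 1 t)"
proof -
  have g: "gauss 1 x = (\<Prod>b\<in>Basis. exp (- pi * (x \<bullet> b)\<^sup>2))" for x :: 'a
    unfolding gauss_def euclidean_inner[of x x]
    by (simp add: exp_sum[symmetric] sum_distrib_left power2_eq_square sum_negf)
  show "integrable lborel (gauss 1 :: 'a \<Rightarrow> real)"
    unfolding g by (rule integrable_lborel_prod) (rule integrable_gaussian_real)
  have w: "of_real (gauss 1 x) * cis (2 * pi * (x \<bullet> t))
      = (\<Prod>b\<in>Basis. of_real (exp (- pi * (x \<bullet> b)\<^sup>2)) * cis (2 * pi * ((x \<bullet> b) * (t \<bullet> b))))" for x
    unfolding g euclidean_inner[of x t] by (simp add: prod.distrib prod_cis sum_distrib_left)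
  have i: "integrable lborel (\<lambda>x. of_real (exp (- pi * x\<^sup>2)) * cis (2 * pi * (x * s)))" for s
    by (rule Bochner_Integration.integrable_bound[OF integrable_gaussian_real])
      (auto simp: norm_mult intro!: borel_measurable_continuous_onI continuous_intros)
  show "(LINT x|lborel. of_real (gauss 1 x) * cis (2 * pi * (x \<bullet> t))) = of_real (gauss 1 t)"
    unfolding w unfolding integral_lborel_prod[OF i] integral_gaussian_cis_real g by simp
qed

lemma integral_gauss_1: "(LINT x|lborel. gauss 1 (x::'a::euclidean_space)) = 1"
proof -
  have "complex_of_real (LINT x|lborel. gauss 1 (x::'a)) = of_real (gauss 1 (0::'a))"
    using integral_gauss_1_cis[of "0::'a"] by simp
  then show ?thesis by (simp add: gauss_def)
qed

lemma
  fixes t :: "'a::euclidean_space"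
  assumes \<delta>: "\<delta> > 0"
  shows integrable_gauss: "integrable lborel (gauss \<delta> :: 'a \<Rightarrow> real)"
    and integral_gauss_cis:
      "(LINT x|lborel. of_real (gauss \<delta> x) * cis (2 * pi * (x \<bullet> t))) = of_real (gauss (1 / \<delta>) t / \<delta> ^ DIM('a))"
proof -
  have \<delta>0: "\<delta> \<noteq> 0" using \<delta> by simp
  show "integrable lborel (gauss \<delta> :: 'a \<Rightarrow> real)"
    using lborel_integrable_affine_iff[OF \<delta>0, of "gauss 1 :: 'a \<Rightarrow> real" 0] integrable_gauss_1
    by (simp add: gauss_scaleR)
  let ?f = "\<lambda>x. of_real (gauss 1 x) * cis (2 * pi * (x \<bullet> ((1 / \<delta>) *\<^sub>R t)))"
  have [measurable]: "(\<lambda>x. cis (2 * pi * (x \<bullet> s))) \<in> borel_measurable borel" for s :: 'a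
    by (intro borel_measurable_continuous_onI continuous_intros)
  have "?f \<in> borel_measurable borel" by measurable
  from lborel_integral_affine[OF \<delta>0 this, of 0] integral_gauss_1_cis[of "(1 / \<delta>) *\<^sub>R t"] \<delta>
  have "complex_of_real (gauss (1 / \<delta>) t) = \<delta> ^ DIM('a) *\<^sub>R (LINT x|lborel. of_real (gauss \<delta> x) * cis (2 * pi * (x \<bullet> t)))"
    by (simp add: gauss_scaleR)
  then show "(LINT x|lborel. of_real (gauss \<delta> x) * cis (2 * pi * (x \<bullet> t))) = of_real (gauss (1 / \<delta>) t / \<delta> ^ DIM('a))"
    using \<delta> by (simp add: scaleR_conv_of_real field_simps)
qed

lemma fourier_integral_cis:
  "fourier_integral f \<xi> = (LINT x|lborel. f x * cis (- (2 * pi * (x \<bullet> \<xi>))))"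
  unfolding fourier_integral_def
  by (intro Bochner_Integration.integral_cong) (auto simp: cis_conv_exp mult_ac)

lemma cis_inner_measurable [measurable (raw)]:
  fixes f g :: "'b \<Rightarrow> 'a::euclidean_space"
  assumes [measurable]: "f \<in> borel_measurable M" "g \<in> borel_measurable M"
  shows "(\<lambda>x. cis (2 * pi * (f x \<bullet> g x))) \<in> borel_measurable M"
    "(\<lambda>x. cis (- (2 * pi * (f x \<bullet> g x)))) \<in> borel_measurable M"
  unfolding cis_conv_exp by measurable

lemma fourier_integral_measurable:
  fixes u :: "'d::finite signal"
  assumes [measurable]: "u \<in> borel_measurable borel"
  shows "fourier_integral u \<in> borel_measurable borel"
proof -
  have "(\<lambda>\<xi>. LINT x|lborel. u x * cis (- (2 * pi * (x \<bullet> \<xi>)))) \<in> borel_measurable lborel"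
    by (rule lborel.borel_measurable_lebesgue_integral) measurable
  then show ?thesis by (simp add: fourier_integral_cis[abs_def])
qed

lemma fourier_integral_bound:
  "cmod (fourier_integral u \<xi>) \<le> (LINT x|lborel. cmod (u x))"
proof -
  have "cmod (fourier_integral u \<xi>) \<le> (LINT x|lborel. cmod (u x * cis (- (2 * pi * (x \<bullet> \<xi>)))))"
    unfolding fourier_integral_cis by (rule integral_norm_bound)
  then show ?thesis by (simp add: norm_mult)
qed

text \<open>
  The average of the translates of \<open>u\<close> with Gaussian weights of width \<open>\<delta>\<close>, that is, the
  convolution of \<open>u\<close> with the approximate identity \<open>\<delta> ^ (- d) * gauss 1 (t / \<delta>)\<close>. With the
  width moved into the argument of \<open>u\<close>, the probability measure does not vary with \<open>\<delta>\<close>.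
\<close>

definition mollify :: "real \<Rightarrow> 'd::finite signal \<Rightarrow> 'd signal" where
  "mollify \<delta> u x = (LINT t|lborel. u (x + \<delta> *\<^sub>R t) * of_real (gauss 1 t))"

text \<open>
  Fubini's theorem in the form in which every exchange of integrals below uses it: the kernel is a
  character, which has modulus 1.
\<close>

lemma integral_swap_bounded_kernel:
  fixes a b :: "real^'d::finite \<Rightarrow> complex"
  assumes a: "integrable lborel a" and b: "integrable lborel b"
    and k [measurable]: "case_prod k \<in> borel_measurable (borel \<Otimes>\<^sub>M borel)"
    and le: "\<And>x y. cmod (k x y) \<le> 1"
  shows "(LINT y|lborel. (LINT x|lborel. a x * (b y * k x y))) = (LINT x|lborel. (LINT y|lborel. a x * (b y * k x y)))"
proof -
  have [measurable]: "a \<in> borel_measurable borel" "b \<in> borel_measurable borel" using a b by auto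
  have [measurable]: "case_prod k \<in> borel_measurable (lborel \<Otimes>\<^sub>M lborel)"
    by measurable
  have int: "integrable lborel (\<lambda>y. b y * k x y)" for x
    by (rule Bochner_Integration.integrable_bound[OF b]) (auto simp: norm_mult intro!: mult_left_le le)
  have "integrable (lborel \<Otimes>\<^sub>M lborel) (\<lambda>(x, y). a x * (b y * k x y))"
  proof (rule lborel_pair.Fubini_integrable)
    show "AE x in lborel. integrable lborel (\<lambda>y. case (x, y) of (x, y) \<Rightarrow> a x * (b y * k x y))"
      using int by simp
    show "integrable lborel (\<lambda>x. LINT y|lborel. norm (case (x, y) of (x, y) \<Rightarrow> a x * (b y * k x y)))"
    proof (rule Bochner_Integration.integrable_bound)
      show "integrable lborel (\<lambda>x. cmod (a x) * (LINT y|lborel. cmod (b y)))"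
        using a by simp
      have "(LINT y|lborel. cmod (b y * k x y)) \<le> (LINT y|lborel. cmod (b y))" for x
        by (rule integral_mono[OF integrable_norm[OF int] integrable_norm[OF b]])
          (auto simp: norm_mult intro!: mult_left_le le)
      then show "AE x in lborel. norm (LINT y|lborel. norm (case (x, y) of (x, y) \<Rightarrow> a x * (b y * k x y)))
          \<le> norm (cmod (a x) * (LINT y|lborel. cmod (b y)))"
        by (auto simp: norm_mult abs_mult intro!: mult_left_mono)
    qed measurable
  qed measurable
  then show ?thesis
    by (rule lborel_pair.Fubini_integral)
qed

text \<open>
  Fourier inversion with a convergence factor. Exchanging the integrals leaves the Fourier transform
  of \<open>gauss \<delta>\<close>, a Gaussian concentrated near \<open>x\<close> at scale \<open>\<delta>\<close>.
\<close>

lemma integral_fourier_gauss_cis: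
  fixes u :: "'d::finite signal"
  assumes u: "integrable lborel u" and \<delta>: "\<delta> > 0"
  shows "(LINT \<xi>|lborel. fourier_integral u \<xi> * of_real (gauss \<delta> \<xi>) * cis (2 * pi * (x \<bullet> \<xi>)))
    = mollify \<delta> u x"
proof -
  have [measurable]: "u \<in> borel_measurable borel" using u by auto
  have "(LINT \<xi>|lborel. fourier_integral u \<xi> * of_real (gauss \<delta> \<xi>) * cis (2 * pi * (x \<bullet> \<xi>)))
      = (LINT \<xi>|lborel. (LINT y|lborel. u y * (of_real (gauss \<delta> \<xi>) * cis (2 * pi * (\<xi> \<bullet> (x - y))))))"
  proof (intro Bochner_Integration.integral_cong refl)
    fix \<xi> :: "real^'d"
    have "(LINT y|lborel. u y * (of_real (gauss \<delta> \<xi>) * cis (2 * pi * (\<xi> \<bullet> (x - y)))))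
        = (LINT y|lborel. (u y * cis (- (2 * pi * (y \<bullet> \<xi>)))) * (of_real (gauss \<delta> \<xi>) * cis (2 * pi * (x \<bullet> \<xi>))))"
      by (intro Bochner_Integration.integral_cong refl)
        (simp add: cis_mult inner_diff_right inner_commute algebra_simps)
    also have "\<dots> = fourier_integral u \<xi> * (of_real (gauss \<delta> \<xi>) * cis (2 * pi * (x \<bullet> \<xi>)))"
      by (simp add: fourier_integral_cis)
    finally show "fourier_integral u \<xi> * of_real (gauss \<delta> \<xi>) * cis (2 * pi * (x \<bullet> \<xi>))
        = (LINT y|lborel. u y * (of_real (gauss \<delta> \<xi>) * cis (2 * pi * (\<xi> \<bullet> (x - y)))))"
      by (simp add: mult.assoc)
  qed
  also have "\<dots> = (LINT y|lborel. (LINT \<xi>|lborel. u y * (of_real (gauss \<delta> \<xi>) * cis (2 * pi * (\<xi> \<bullet> (x - y))))))"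
    by (rule integral_swap_bounded_kernel[OF u integrable_of_real[OF integrable_gauss[OF \<delta>]]]) auto
  also have "\<dots> = (LINT y|lborel. u y * of_real (gauss (1 / \<delta>) (x - y) / \<delta> ^ DIM(real^'d)))"
    unfolding integral_mult_right_zero by (simp only: integral_gauss_cis[OF \<delta>])
  also have "\<dots> = \<bar>\<delta>\<bar> ^ DIM(real^'d) *\<^sub>R (LINT t|lborel. u (x + \<delta> *\<^sub>R t) *
      of_real (gauss (1 / \<delta>) (x - (x + \<delta> *\<^sub>R t)) / \<delta> ^ DIM(real^'d)))"
    by (rule lborel_integral_affine) (use \<delta> in auto)
  also have "\<dots> = (LINT t|lborel. \<bar>\<delta>\<bar> ^ DIM(real^'d) *\<^sub>R (u (x + \<delta> *\<^sub>R t) *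
      of_real (gauss (1 / \<delta>) (x - (x + \<delta> *\<^sub>R t)) / \<delta> ^ DIM(real^'d))))"
    by simp
  also have "\<dots> = mollify \<delta> u x"
    unfolding mollify_def
  proof (intro Bochner_Integration.integral_cong refl)
    fix t :: "real^'d"
    have "gauss (1 / \<delta>) (x - (x + \<delta> *\<^sub>R t)) = gauss (1 / \<delta>) ((- \<delta>) *\<^sub>R t)" by simp
    also have "\<dots> = gauss 1 t" unfolding gauss_scaleR using \<delta> by (simp add: gauss_def)
    finally show "\<bar>\<delta>\<bar> ^ DIM(real^'d) *\<^sub>R (u (x + \<delta> *\<^sub>R t) *
      of_real (gauss (1 / \<delta>) (x - (x + \<delta> *\<^sub>R t)) / \<delta> ^ DIM(real^'d))) = u (x + \<delta> *\<^sub>R t) * of_real (gauss 1 t)"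
      using \<delta> by (simp add: scaleR_conv_of_real)
  qed
  finally show ?thesis .
qed

section \<open>Continuity of translations and Gaussian mollification\<close>

lemma L2_norm_dominated_tendsto_0:
  fixes s :: "nat \<Rightarrow> 'd::finite signal"
  assumes [measurable]: "\<And>n. s n \<in> borel_measurable borel"
    and h: "integrable lborel (\<lambda>x. (h x)\<^sup>2)"
    and le: "\<And>n x. cmod (s n x) \<le> h x"
    and lim: "AE x in lborel. (\<lambda>n. s n x) \<longlonglongrightarrow> 0"
  shows "(\<lambda>n. L2_norm (s n)) \<longlonglongrightarrow> 0"
proof -
  have "(\<lambda>n. LINT x|lborel. (cmod (s n x))\<^sup>2) \<longlonglongrightarrow> (LINT x|(lborel :: (real^'d) measure). (0::real))"
  proof (rule integral_dominated_convergence[where w="\<lambda>x. (h x)\<^sup>2"])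
    show "AE x in lborel. (\<lambda>n. (cmod (s n x))\<^sup>2) \<longlonglongrightarrow> 0"
      using lim by eventually_elim (rule tendsto_eq_intros tendsto_norm_zero | assumption | simp)+
    show "AE x in lborel. norm ((cmod (s n x))\<^sup>2) \<le> (h x)\<^sup>2" for n
      using le by (auto intro!: power_mono)
  qed (use h in auto)
  then show ?thesis
    unfolding L2_norm_def using tendsto_real_sqrt by fastforce
qed

lemma
  fixes u :: "'d::finite signal"
  assumes u: "u \<in> L2"
  shows L2_translate: "(\<lambda>x. u (x + t)) \<in> L2"
    and L2_norm_translate: "L2_norm (\<lambda>x. u (x + t)) = L2_norm u"
proof -
  note [measurable] = L2_measurable[OF u]
  have i: "integrable lborel (\<lambda>x. (cmod (u (t + 1 *\<^sub>R x)))\<^sup>2)"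
    by (subst lborel_integrable_affine_iff[of 1 "\<lambda>x. (cmod (u x))\<^sup>2"]) (use L2_integrable[OF u] in auto)
  then show "(\<lambda>x. u (x + t)) \<in> L2" by (simp add: L2_def add.commute)
  show "L2_norm (\<lambda>x. u (x + t)) = L2_norm u"
    unfolding L2_norm_def using lborel_integral_affine[of 1 "\<lambda>x. (cmod (u x))\<^sup>2" t] by (simp add: add.commute)
qed

lemma integrable_indicator_cball_squared:
  "integrable lborel (\<lambda>x::'a::euclidean_space. (B * indicator (cball 0 R) x)\<^sup>2 :: real)"
proof -
  have "(\<lambda>x::'a. (B * indicator (cball 0 R) x)\<^sup>2) = (\<lambda>x. B\<^sup>2 * indicator (cball 0 R) x)"
    by (auto simp: indicator_def)
  then show ?thesis
    by (simp only:) (intro integrable_mult_right integrable_real_indicator emeasure_lborel_cball_finite, simp)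
qed

lemma L2_if_bounded_support:
  fixes f :: "'d::finite signal"
  assumes [measurable]: "f \<in> borel_measurable borel"
    and le: "\<And>x. cmod (f x) \<le> B * indicator (cball 0 R) x"
  shows "f \<in> L2"
proof -
  have i: "integrable lborel (\<lambda>x. (B * indicator (cball 0 R) x)\<^sup>2 :: real)"
    by (rule integrable_indicator_cball_squared)
  have "integrable lborel (\<lambda>x. (cmod (f x))\<^sup>2)"
    by (rule Bochner_Integration.integrable_bound[OF i]) (auto intro!: power_mono le)
  then show ?thesis by (simp add: L2_def)
qed

definition truncation :: "nat \<Rightarrow> 'd::finite signal \<Rightarrow> 'd signal" where
  "truncation n u x = (if cmod (u x) \<le> real n \<and> norm x \<le> real n then u x else 0)"

text \<open>
  Truncating both the values and the support makes a function integrable as well as square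
  integrable, which is what the Fourier integral requires.
\<close>

lemma L2_truncation:
  fixes u :: "'d::finite signal"
  assumes u: "u \<in> L2"
  shows "truncation n u \<in> borel_measurable borel" "cmod (truncation n u x) \<le> real n * indicator (cball 0 (real n)) x"
    "(\<lambda>n. L2_norm (\<lambda>x. truncation n u x - u x)) \<longlonglongrightarrow> 0"
proof -
  note [measurable] = L2_measurable[OF u]
  show m[measurable]: "truncation n u \<in> borel_measurable borel" for n unfolding truncation_def[abs_def] by measurable
  show "cmod (truncation n u x) \<le> real n * indicator (cball 0 (real n)) x" by (auto simp: truncation_def)
  show "(\<lambda>n. L2_norm (\<lambda>x. truncation n u x - u x)) \<longlonglongrightarrow> 0"
  proof (rule L2_norm_dominated_tendsto_0[OF _ L2_integrable[OF u]])
    show "cmod (truncation n u x - u x) \<le> cmod (u x)" for n x by (auto simp: truncation_def)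
    have "(\<lambda>n. truncation n u x - u x) \<longlonglongrightarrow> 0" for x
    proof (rule tendsto_eventually, rule eventually_sequentiallyI[of "nat \<lceil>max (cmod (u x)) (norm x)\<rceil>"])
      fix n assume "n \<ge> nat \<lceil>max (cmod (u x)) (norm x)\<rceil>"
      then have "max (cmod (u x)) (norm x) \<le> real n" by linarith
      then show "truncation n u x - u x = 0" by (auto simp: truncation_def)
    qed
    then show "AE x in lborel. (\<lambda>n. truncation n u x - u x) \<longlonglongrightarrow> 0" by simp
  qed simp
qed

definition continuous_compactly_supported :: "'d::finite signal \<Rightarrow> bool" where
  "continuous_compactly_supported \<phi> \<longleftrightarrow>
     continuous_on UNIV \<phi> \<and> (\<exists>B R. \<forall>x. cmod (\<phi> x) \<le> B * indicator (cball 0 R) x)"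

lemma continuous_compactly_supported_L2:
  "continuous_compactly_supported \<phi> \<Longrightarrow> \<phi> \<in> L2"
  unfolding continuous_compactly_supported_def
  by (auto intro: L2_if_bounded_support borel_measurable_continuous_onI)

text \<open>
  A measurable function is almost everywhere a limit of continuous functions \<open>g n\<close>. Cutting the
  values of \<open>g n\<close> off at \<open>B\<close> and multiplying by a continuous bump function does not disturb the
  limit, since \<open>v\<close> itself obeys these bounds, and it provides a dominating function.
\<close>

lemma continuous_dense_bounded:
  fixes v :: "'d::finite signal"
  assumes [measurable]: "v \<in> borel_measurable borel"
    and le: "\<And>x. cmod (v x) \<le> B * indicator (cball 0 R) x" and B: "B > 0" and e: "e > 0"
  shows "\<exists>\<phi>. continuous_compactly_supported \<phi> \<and> L2_norm (\<lambda>x. \<phi> x - v x) < e"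
proof -
  have "v \<in> borel_measurable lebesgue"
    by (rule measurable_completion) simp
  then have "v measurable_on UNIV"
    by (simp add: measurable_on_iff_borel_measurable)
  then obtain N g where N: "negligible N" and g: "\<And>n. continuous_on UNIV (g n)"
    and lim: "\<And>x. x \<notin> N \<Longrightarrow> (\<lambda>n. g n x) \<longlonglongrightarrow> v x"
    by (auto simp: measurable_on_def)
  have AE: "AE x in lborel. x \<notin> N"
    using N by (metis AE_completion_iff AE_not_in negligible_iff_null_sets)
  define bump where "bump x = max 0 (min 1 (R + 1 - norm x))" for x :: "real^'d"
  \<comment> \<open>the radial retraction of the complex plane onto the disc of radius \<open>B\<close>\<close>
  define cut where "cut z = of_real (B / max B (cmod z)) * z" for z
  define \<phi> where "\<phi> n x = of_real (bump x) * cut (g n x)" for n x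
  have cut_le: "cmod (cut z) \<le> B" for z
  proof -
    have "cmod (cut z) = B * (cmod z / max B (cmod z))" using B by (simp add: cut_def norm_mult norm_divide)
    also have "\<dots> \<le> B * 1" using B by (intro mult_left_mono) (auto simp: divide_le_eq)
    finally show ?thesis by simp
  qed
  have cut_cont: "continuous_on UNIV cut"
    unfolding cut_def[abs_def] using B by (intro continuous_intros) auto
  have bump_cont: "continuous_on UNIV bump"
    unfolding bump_def[abs_def] by (intro continuous_intros)
  have \<phi>_cont: "continuous_on UNIV (\<phi> n)" for n
    unfolding \<phi>_def[abs_def]
    by (intro continuous_intros bump_cont continuous_on_compose2[OF cut_cont g]) auto
  have \<phi>_le: "cmod (\<phi> n x) \<le> B * indicator (cball 0 (R + 1)) x" for n x
  proof -
    have "cmod (\<phi> n x) = bump x * cmod (cut (g n x))" by (simp add: \<phi>_def norm_mult bump_def)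
    also have "\<dots> \<le> indicator (cball 0 (R + 1)) x * B"
      by (intro mult_mono cut_le) (auto simp: bump_def indicator_def)
    finally show ?thesis by (simp add: mult.commute)
  qed
  have cc: "continuous_compactly_supported (\<phi> n)" for n
    unfolding continuous_compactly_supported_def using \<phi>_cont \<phi>_le by blast
  have v_fix: "of_real (bump x) * cut (v x) = v x" for x
  proof (cases "norm x \<le> R")
    case True
    then have "cmod (v x) \<le> B" using le[of x] by simp
    then show ?thesis using True B by (simp add: bump_def cut_def max_def)
  next
    case False
    then have "v x = 0" using le[of x] by simp
    then show ?thesis by (simp add: cut_def)
  qed
  have "(\<lambda>n. L2_norm (\<lambda>x. \<phi> n x - v x)) \<longlonglongrightarrow> 0"
  proof (rule L2_norm_dominated_tendsto_0[where h="\<lambda>x. 2 * B * indicator (cball 0 (R + 1)) x"])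
    show "(\<lambda>x. \<phi> n x - v x) \<in> borel_measurable borel" for n
      using borel_measurable_continuous_onI[OF \<phi>_cont[of n]] by measurable
    show "integrable lborel (\<lambda>x::real^'d. (2 * B * indicator (cball 0 (R + 1)) x)\<^sup>2)"
      by (rule integrable_indicator_cball_squared)
    show "cmod (\<phi> n x - v x) \<le> 2 * B * indicator (cball 0 (R + 1)) x" for n x
    proof -
      have "B * indicator (cball 0 R) x \<le> B * indicator (cball 0 (R + 1)) x"
        using B by (intro mult_left_mono) (auto simp: indicator_def)
      then show ?thesis
        using norm_triangle_ineq4[of "\<phi> n x" "v x"] \<phi>_le[of n x] le[of x] by linarith
    qed
    show "AE x in lborel. (\<lambda>n. \<phi> n x - v x) \<longlonglongrightarrow> 0"
      using AE
    proof eventually_elim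
      case (elim x)
      have "isCont cut (v x)" using cut_cont by (simp add: continuous_on_eq_continuous_at)
      then have "(\<lambda>n. cut (g n x)) \<longlonglongrightarrow> cut (v x)"
        using lim[OF elim] by (rule isCont_tendsto_compose)
      from tendsto_mult[OF tendsto_const this, of "of_real (bump x)"]
      have "(\<lambda>n. \<phi> n x) \<longlonglongrightarrow> v x"
        by (simp only: \<phi>_def v_fix)
      then show ?case by (rule LIM_zero)
    qed
  qed
  from order_tendstoD(2)[OF this e] obtain n where "L2_norm (\<lambda>x. \<phi> n x - v x) < e"
    by (auto simp: eventually_sequentially)
  with cc show ?thesis by blast
qed

lemma continuous_compactly_supported_dense:
  fixes u :: "'d::finite signal"
  assumes u: "u \<in> L2" and e: "e > 0"
  shows "\<exists>\<phi>. continuous_compactly_supported \<phi> \<and> L2_norm (\<lambda>x. \<phi> x - u x) < e"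
proof -
  note v = L2_truncation[OF u]
  obtain n where n: "L2_norm (\<lambda>x. truncation n u x - u x) < e / 2"
    using order_tendstoD(2)[OF v(3), of "e / 2"] e by (auto simp: eventually_sequentially)
  have le: "cmod (truncation n u x) \<le> (real n + 1) * indicator (cball 0 (real n)) x" for x
    using v(2)[of n x] by (auto simp: indicator_def)
  obtain \<phi> where \<phi>: "continuous_compactly_supported \<phi>" "L2_norm (\<lambda>x. \<phi> x - truncation n u x) < e / 2"
    using continuous_dense_bounded[OF v(1) le, of "e / 2"] e by auto
  have "L2_norm (\<lambda>x. \<phi> x - u x) < e"
    using L2_norm_diff_triangle[OF continuous_compactly_supported_L2[OF \<phi>(1)]
        L2_if_bounded_support[OF v(1) v(2)] u, of n] n \<phi>(2) by linarith
  with \<phi>(1) show ?thesis by blast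
qed

text \<open>
  For a continuous function of compact support this is dominated convergence. The general case
  follows by density, as translations are isometries.
\<close>

theorem L2_translation_continuous:
  fixes u :: "'d::finite signal" and t :: "nat \<Rightarrow> real^'d"
  assumes u: "u \<in> L2" and t: "t \<longlonglongrightarrow> 0"
  shows "(\<lambda>n. L2_norm (\<lambda>x. u (x + t n) - u x)) \<longlonglongrightarrow> 0"
proof (rule LIMSEQ_I)
  fix e :: real assume e: "e > 0"
  then obtain \<phi> where \<phi>: "continuous_compactly_supported \<phi>" "L2_norm (\<lambda>x. \<phi> x - u x) < e / 3"
    using continuous_compactly_supported_dense[OF u, of "e / 3"] by auto
  from \<phi>(1) obtain B R where cont: "continuous_on UNIV \<phi>"
    and le: "\<And>x. cmod (\<phi> x) \<le> B * indicator (cball 0 R) x"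
    by (auto simp: continuous_compactly_supported_def)
  have \<phi>2: "\<phi> \<in> L2" by (rule continuous_compactly_supported_L2[OF \<phi>(1)])
  note [measurable] = L2_measurable[OF \<phi>2]
  obtain K where K: "K > 0" "\<And>n. norm (t n) \<le> K"
    using convergent_imp_bounded[OF t] by (auto simp: bounded_pos)
  have "(\<lambda>n. L2_norm (\<lambda>x. \<phi> (x + t n) - \<phi> x)) \<longlonglongrightarrow> 0"
  proof (rule L2_norm_dominated_tendsto_0[where h="\<lambda>x. 2 * \<bar>B\<bar> * indicator (cball 0 (R + K)) x"])
    show "integrable lborel (\<lambda>x::real^'d. (2 * \<bar>B\<bar> * indicator (cball 0 (R + K)) x)\<^sup>2)"
      by (rule integrable_indicator_cball_squared)
    show "cmod (\<phi> (x + t n) - \<phi> x) \<le> 2 * \<bar>B\<bar> * indicator (cball 0 (R + K)) x" for n x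
    proof -
      have *: "norm x \<le> norm (x + t n) + K"
        using norm_triangle_ineq4[of "x + t n" "t n"] K(2)[of n] by simp
      have "B * indicator (cball 0 R) x \<le> \<bar>B\<bar> * indicator (cball 0 (R + K)) x"
        using K(1) by (intro mult_mono) (auto simp: indicator_def)
      moreover have "B * indicator (cball 0 R) (x + t n) \<le> \<bar>B\<bar> * indicator (cball 0 (R + K)) x"
        using * by (intro mult_mono) (auto simp: indicator_def)
      ultimately show ?thesis
        using norm_triangle_ineq4[of "\<phi> (x + t n)" "\<phi> x"] le[of x] le[of "x + t n"] by linarith
    qed
    have "(\<lambda>n. \<phi> (x + t n) - \<phi> x) \<longlonglongrightarrow> 0" for x
    proof -
      have "isCont \<phi> x" using cont by (simp add: continuous_on_eq_continuous_at)
      moreover have "(\<lambda>n. x + t n) \<longlonglongrightarrow> x" using tendsto_add[OF tendsto_const t, of x] by simp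
      ultimately have "(\<lambda>n. \<phi> (x + t n)) \<longlonglongrightarrow> \<phi> x" by (rule isCont_tendsto_compose)
      then show ?thesis by (rule LIM_zero)
    qed
    then show "AE x in lborel. (\<lambda>n. \<phi> (x + t n) - \<phi> x) \<longlonglongrightarrow> 0" by simp
  qed measurable
  then obtain N where N: "\<And>n. n \<ge> N \<Longrightarrow> L2_norm (\<lambda>x. \<phi> (x + t n) - \<phi> x) < e / 3"
    using order_tendstoD(2)[of _ 0 sequentially "e / 3"] e by (auto simp: eventually_sequentially)
  show "\<exists>no. \<forall>n\<ge>no. norm (L2_norm (\<lambda>x. u (x + t n) - u x) - 0) < e"
  proof (intro exI[of _ N] allI impI)
    fix n assume "n \<ge> N"
    have "L2_norm (\<lambda>x. u (x + t n) - u x)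
        \<le> L2_norm (\<lambda>x. u (x + t n) - \<phi> (x + t n)) + L2_norm (\<lambda>x. \<phi> (x + t n) - u x)"
      by (rule L2_norm_diff_triangle[OF L2_translate[OF u] L2_translate[OF \<phi>2] u])
    also have "L2_norm (\<lambda>x. \<phi> (x + t n) - u x)
        \<le> L2_norm (\<lambda>x. \<phi> (x + t n) - \<phi> x) + L2_norm (\<lambda>x. \<phi> x - u x)"
      by (rule L2_norm_diff_triangle[OF L2_translate[OF \<phi>2] \<phi>2 u])
    also have "L2_norm (\<lambda>x. u (x + t n) - \<phi> (x + t n)) = L2_norm (\<lambda>x. \<phi> x - u x)"
      using L2_norm_translate[OF L2_diff[OF u \<phi>2], of "t n"] L2_norm_diff_commute by metis
    finally show "norm (L2_norm (\<lambda>x. u (x + t n) - u x) - 0) < e"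
      using N[OF \<open>n \<ge> N\<close>] \<phi>(2) L2_norm_nonneg[of "\<lambda>x. u (x + t n) - u x"] by simp
  qed
qed

text \<open>
  The difference is an average of \<open>u (x + \<delta> *\<^sub>R t) - u x\<close> over \<open>t\<close> with respect to a
  probability density, so the Cauchy-Schwarz inequality bounds its square by the average of the
  squares. Tonelli's theorem then brings in the \<open>L\<^sup>2\<close> modulus of continuity of \<open>u\<close>.
\<close>

lemma
  fixes u :: "'d::finite signal"
  assumes u: "integrable lborel u" "u \<in> L2" and \<delta>: "\<delta> \<noteq> 0"
  shows mollify_measurable: "mollify \<delta> u \<in> borel_measurable borel"
    and mollify_diff_nn_integral_le:
      "(\<integral>\<^sup>+x. ennreal ((cmod (mollify \<delta> u x - u x))\<^sup>2) \<partial>lborel)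
        \<le> (\<integral>\<^sup>+t. ennreal (gauss 1 t * (L2_norm (\<lambda>x. u (x + \<delta> *\<^sub>R t) - u x))\<^sup>2) \<partial>lborel)"
proof -
  note [measurable] = L2_measurable[OF u(2)]
  have "(\<lambda>x. LINT t|lborel. u (x + \<delta> *\<^sub>R t) * of_real (gauss 1 t)) \<in> borel_measurable lborel"
    by (rule lborel.borel_measurable_lebesgue_integral) measurable
  then show "mollify \<delta> u \<in> borel_measurable borel"
    by (simp add: mollify_def[abs_def])
  have int: "integrable lborel (\<lambda>t. u (x + \<delta> *\<^sub>R t) * of_real (gauss 1 t))" for x
  proof (rule Bochner_Integration.integrable_bound)
    show "integrable lborel (\<lambda>t. u (x + \<delta> *\<^sub>R t))"
      using lborel_integrable_affine_iff[OF \<delta>, of u x] u by simp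
    show "AE t in lborel. norm (u (x + \<delta> *\<^sub>R t) * of_real (gauss 1 t)) \<le> norm (u (x + \<delta> *\<^sub>R t))"
      by (auto simp: norm_mult abs_of_pos[OF gauss_bounds(1)] gauss_bounds(2) intro!: mult_left_le)
  qed measurable
  have diff_int: "integrable lborel (\<lambda>t. (u (x + \<delta> *\<^sub>R t) - u x) * of_real (gauss 1 t))" for x
    unfolding left_diff_distrib
    by (intro Bochner_Integration.integrable_diff int integrable_mult_right integrable_of_real integrable_gauss_1)
  have nn1: "(\<integral>\<^sup>+t. ennreal (gauss 1 (t::real^'d)) \<partial>lborel) = 1"
    by (subst nn_integral_eq_integral) (auto simp: integrable_gauss_1 integral_gauss_1 gauss_bounds(1) less_imp_le)
  have pointwise: "ennreal ((cmod (mollify \<delta> u x - u x))\<^sup>2)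
      \<le> (\<integral>\<^sup>+t. ennreal (gauss 1 t * (cmod (u (x + \<delta> *\<^sub>R t) - u x))\<^sup>2) \<partial>lborel)" for x
  proof -
    have "mollify \<delta> u x - u x = (LINT t|lborel. u (x + \<delta> *\<^sub>R t) * of_real (gauss 1 t)) - (LINT t|lborel. u x * of_real (gauss 1 (t::real^'d)))"
      using integral_gauss_1[where 'a="real^'d"] by (simp add: mollify_def)
    also have "\<dots> = (LINT t|lborel. u (x + \<delta> *\<^sub>R t) * of_real (gauss 1 t) - u x * of_real (gauss 1 t))"
      by (rule Bochner_Integration.integral_diff[symmetric]) (use int integrable_gauss_1 in auto)
    finally have "mollify \<delta> u x - u x = (LINT t|lborel. (u (x + \<delta> *\<^sub>R t) - u x) * of_real (gauss 1 t))"
      by (simp add: left_diff_distrib)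
    then have "ennreal (cmod (mollify \<delta> u x - u x))
        \<le> (\<integral>\<^sup>+t. ennreal (cmod ((u (x + \<delta> *\<^sub>R t) - u x) * of_real (gauss 1 t))) \<partial>lborel)"
      using integral_norm_bound_ennreal[OF diff_int] by (simp only:)
    \<comment> \<open>the weight is shared between the two factors of the Cauchy-Schwarz inequality\<close>
    also have "\<dots> = (\<integral>\<^sup>+t. ennreal (sqrt (gauss 1 t) * cmod (u (x + \<delta> *\<^sub>R t) - u x)) * ennreal (sqrt (gauss 1 t)) \<partial>lborel)"
      by (intro nn_integral_cong)
        (simp add: norm_mult abs_of_pos[OF gauss_bounds(1)] gauss_bounds(1) less_imp_le ennreal_mult[symmetric] mult_ac
          flip: real_sqrt_mult power2_eq_square)
    finally have "(ennreal (cmod (mollify \<delta> u x - u x)))\<^sup>2 \<le>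
       (\<integral>\<^sup>+t. ennreal (sqrt (gauss 1 t) * cmod (u (x + \<delta> *\<^sub>R t) - u x)) * ennreal (sqrt (gauss 1 t)) \<partial>lborel)\<^sup>2"
      by (intro power_mono) auto
    also have "\<dots> \<le> (\<integral>\<^sup>+t. (ennreal (sqrt (gauss 1 t) * cmod (u (x + \<delta> *\<^sub>R t) - u x)))\<^sup>2 \<partial>lborel)
        * (\<integral>\<^sup>+t. (ennreal (sqrt (gauss 1 (t::real^'d))))\<^sup>2 \<partial>lborel)"
      by (rule Cauchy_Schwarz_nn_integral) measurable
    finally show ?thesis
      by (simp add: ennreal_power power_mult_distrib gauss_bounds(1) less_imp_le nn1)
  qed
  have "(\<integral>\<^sup>+x. ennreal ((cmod (mollify \<delta> u x - u x))\<^sup>2) \<partial>lborel)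
      \<le> (\<integral>\<^sup>+x. (\<integral>\<^sup>+t. ennreal (gauss 1 t * (cmod (u (x + \<delta> *\<^sub>R t) - u x))\<^sup>2) \<partial>lborel) \<partial>lborel)"
    by (intro nn_integral_mono pointwise)
  also have "\<dots> = (\<integral>\<^sup>+t. (\<integral>\<^sup>+x. ennreal (gauss 1 t * (cmod (u (x + \<delta> *\<^sub>R t) - u x))\<^sup>2) \<partial>lborel) \<partial>lborel)"
    by (rule lborel_pair.Fubini') measurable
  also have "\<dots> = (\<integral>\<^sup>+t. ennreal (gauss 1 t * (L2_norm (\<lambda>x. u (x + \<delta> *\<^sub>R t) - u x))\<^sup>2) \<partial>lborel)"
    by (intro nn_integral_cong)
      (simp add: ennreal_mult gauss_bounds(1) less_imp_le nn_integral_cmult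
        nn_integral_eq_L2_norm[OF L2_diff[OF L2_translate[OF u(2)] u(2)]])
  finally show "(\<integral>\<^sup>+x. ennreal ((cmod (mollify \<delta> u x - u x))\<^sup>2) \<partial>lborel)
        \<le> (\<integral>\<^sup>+t. ennreal (gauss 1 t * (L2_norm (\<lambda>x. u (x + \<delta> *\<^sub>R t) - u x))\<^sup>2) \<partial>lborel)" .
qed

theorem mollify_L2_tendsto:
  fixes u :: "'d::finite signal" and \<delta> :: "nat \<Rightarrow> real"
  assumes u: "integrable lborel u" "u \<in> L2" and \<delta>: "\<And>n. \<delta> n \<noteq> 0" "\<delta> \<longlonglongrightarrow> 0"
  shows "mollify (\<delta> n) u \<in> L2" "(\<lambda>n. L2_norm (\<lambda>x. mollify (\<delta> n) u x - u x)) \<longlonglongrightarrow> 0"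
proof -
  note [measurable] = L2_measurable[OF u(2)] mollify_measurable[OF u \<delta>(1)]
  define \<omega> where "\<omega> n t = L2_norm (\<lambda>x. u (x + \<delta> n *\<^sub>R t) - u x)" for n and t :: "real^'d"
  define I where "I n = (LINT t|lborel. gauss 1 t * (\<omega> n t)\<^sup>2)" for n
  have \<omega>_le: "\<omega> n t \<le> 2 * L2_norm u" for n t
    unfolding \<omega>_def
    using L2_norm_triangle[OF L2_translate[OF u(2)] L2_cmult[OF u(2), of "-1"], of "\<delta> n *\<^sub>R t"]
    by (simp add: L2_norm_translate[OF u(2)] L2_norm_cmult[of "-1", simplified])
  have \<omega>_sq: "(\<omega> n t)\<^sup>2 \<le> (2 * L2_norm u)\<^sup>2" "\<omega> n t \<ge> 0" for n t
    using power_mono[OF \<omega>_le[of n t], of 2] by (auto simp: \<omega>_def L2_norm_nonneg)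
  have "(\<lambda>t. LINT x|lborel. (cmod (u (x + \<delta> n *\<^sub>R t) - u x))\<^sup>2) \<in> borel_measurable lborel" for n
    by (rule lborel.borel_measurable_lebesgue_integral) measurable
  then have [measurable]: "\<omega> n \<in> borel_measurable borel" for n
    unfolding \<omega>_def[abs_def] L2_norm_def by measurable
  have bound: "integrable lborel (\<lambda>t::real^'d. gauss 1 t * (2 * L2_norm u)\<^sup>2)"
    by (intro integrable_mult_left integrable_gauss_1)
  have dom: "norm (gauss 1 t * (\<omega> n t)\<^sup>2) \<le> gauss 1 t * (2 * L2_norm u)\<^sup>2" for n t
    using \<omega>_sq by (simp add: abs_mult abs_of_pos[OF gauss_bounds(1)] gauss_bounds(1) mult_left_mono less_imp_le)
  have "I \<longlonglongrightarrow> (LINT t|(lborel :: (real^'d) measure). (0::real))"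
    unfolding I_def
  proof (rule integral_dominated_convergence[OF _ _ bound])
    show "AE t in lborel. (\<lambda>n. gauss 1 t * (\<omega> n t)\<^sup>2) \<longlonglongrightarrow> 0"
    proof (intro AE_I2)
      fix t :: "real^'d"
      have "(\<lambda>n. \<delta> n *\<^sub>R t) \<longlonglongrightarrow> 0"
        using tendsto_scaleR[OF \<delta>(2) tendsto_const[of t]] by simp
      then have "(\<lambda>n. \<omega> n t) \<longlonglongrightarrow> 0"
        unfolding \<omega>_def by (rule L2_translation_continuous[OF u(2)])
      from tendsto_mult[OF tendsto_const tendsto_power[OF this, of 2], of "gauss 1 t"]
      show "(\<lambda>n. gauss 1 t * (\<omega> n t)\<^sup>2) \<longlonglongrightarrow> 0" by simp
    qed
  qed (use dom in auto)
  then have I0: "I \<longlonglongrightarrow> 0" by simp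
  have I_nonneg: "I n \<ge> 0" for n
    unfolding I_def by (intro integral_nonneg_AE AE_I2) (simp add: gauss_bounds(1) less_imp_le)
  have "integrable lborel (\<lambda>t. gauss 1 t * (\<omega> n t)\<^sup>2)" for n
    by (rule Bochner_Integration.integrable_bound[OF bound])
      (use dom[of _ n] in \<open>auto intro: order_trans[OF _ abs_ge_self]\<close>)
  then have "(\<integral>\<^sup>+t. ennreal (gauss 1 t * (\<omega> n t)\<^sup>2) \<partial>lborel) = ennreal (I n)" for n
    unfolding I_def by (intro nn_integral_eq_integral) (auto simp: gauss_bounds(1) less_imp_le)
  then have le: "(\<integral>\<^sup>+x. ennreal ((cmod (mollify (\<delta> n) u x - u x))\<^sup>2) \<partial>lborel) \<le> ennreal ((sqrt (I n))\<^sup>2)" for n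
    using mollify_diff_nn_integral_le[OF u \<delta>(1)[of n]] I_nonneg[of n] by (simp add: \<omega>_def)
  have d: "(\<lambda>x. mollify (\<delta> n) u x - u x) \<in> L2" "L2_norm (\<lambda>x. mollify (\<delta> n) u x - u x) \<le> sqrt (I n)" for n
    using L2_from_nn_integral[OF _ _ le[of n]] I_nonneg[of n] by auto
  show "mollify (\<delta> n) u \<in> L2"
    using L2_add[OF d(1)[of n] u(2)] by simp
  show "(\<lambda>n. L2_norm (\<lambda>x. mollify (\<delta> n) u x - u x)) \<longlonglongrightarrow> 0"
    by (rule tendsto_sandwich[OF _ _ tendsto_const, where h="\<lambda>n. sqrt (I n)"])
      (use d(2) tendsto_real_sqrt[OF I0] in \<open>auto simp: L2_norm_nonneg\<close>)
qed

section \<open>The Plancherel theorem\<close>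

lemma L2_reflect:
  fixes u :: "'d::finite signal"
  assumes u: "u \<in> L2"
  shows "(\<lambda>x. u (- x)) \<in> L2"
proof -
  note [measurable] = L2_measurable[OF u]
  have "integrable lborel (\<lambda>x. (cmod (u (0 + (-1) *\<^sub>R x)))\<^sup>2)"
    by (subst lborel_integrable_affine_iff[of "-1" "\<lambda>x. (cmod (u x))\<^sup>2"]) (use L2_integrable[OF u] in auto)
  then show ?thesis by (simp add: L2_def)
qed

lemma cnj_measurable [measurable (raw)]:
  "f \<in> borel_measurable M \<Longrightarrow> (\<lambda>x. cnj (f x)) \<in> borel_measurable M"
  by (rule borel_measurable_continuous_on[OF continuous_on_cnj[OF continuous_on_id]])

lemma L2_product_integrable:
  fixes f g :: "'d::finite signal"
  assumes f: "f \<in> L2" and g: "g \<in> L2"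
  shows "integrable lborel (\<lambda>x. cnj (f x) * g x)"
proof (rule Bochner_Integration.integrable_bound)
  note [measurable] = L2_measurable[OF f] L2_measurable[OF g]
  show "integrable lborel (\<lambda>x. (cmod (f x))\<^sup>2 + (cmod (g x))\<^sup>2)"
    using L2_integrable[OF f] L2_integrable[OF g] by simp
  have "cmod (f x) * cmod (g x) \<le> (cmod (f x))\<^sup>2 + (cmod (g x))\<^sup>2" for x
    using sum_squares_bound[of "cmod (f x)" "cmod (g x)"] mult_nonneg_nonneg[of "cmod (f x)" "cmod (g x)"]
    by (simp del: mult_nonneg_nonneg)
  then show "AE x in lborel. norm (cnj (f x) * g x) \<le> norm ((cmod (f x))\<^sup>2 + (cmod (g x))\<^sup>2)"
    by (auto simp: norm_mult)
  show "(\<lambda>x. cnj (f x) * g x) \<in> borel_measurable lborel" by measurable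
qed

text \<open>
  Real part of an inner product in terms of norms. Through it, convergence in norm alone yields the
  limit of the inner products in the proof of Plancherel's theorem.
\<close>

lemma L2_polarization:
  fixes f g :: "'d::finite signal"
  assumes f: "f \<in> L2" and g: "g \<in> L2"
  shows "Re (LINT x|lborel. cnj (f x) * g x) = ((L2_norm f)\<^sup>2 + (L2_norm g)\<^sup>2 - (L2_norm (\<lambda>x. g x - f x))\<^sup>2) / 2"
proof -
  have "Re (LINT x|lborel. cnj (f x) * g x) = (LINT x|lborel. Re (cnj (f x) * g x))"
    by (rule integral_Re[symmetric]) (rule L2_product_integrable[OF f g])
  also have "\<dots> = (LINT x|lborel. ((cmod (f x))\<^sup>2 + (cmod (g x))\<^sup>2 - (cmod (g x - f x))\<^sup>2) / 2)"
    unfolding cmod_power2 by (intro Bochner_Integration.integral_cong refl) (simp add: power2_eq_square algebra_simps)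
  also have "\<dots> = ((L2_norm f)\<^sup>2 + (L2_norm g)\<^sup>2 - (L2_norm (\<lambda>x. g x - f x))\<^sup>2) / 2"
    using L2_integrable[OF f] L2_integrable[OF g] L2_integrable[OF L2_diff[OF g f]]
    by (simp add: L2_norm_squared)
  finally show ?thesis .
qed

lemma integrable_bounded_times_gauss:
  fixes u :: "'d::finite signal"
  assumes [measurable]: "u \<in> borel_measurable borel" and le: "\<And>x. cmod (u x) \<le> C" and \<delta>: "\<delta> > 0"
  shows "integrable lborel (\<lambda>x. u x * of_real (gauss \<delta> x))"
proof (rule Bochner_Integration.integrable_bound)
  show "integrable lborel (\<lambda>x::real^'d. C * gauss \<delta> x)"
    by (intro integrable_mult_right integrable_gauss \<delta>)
  show "AE x in lborel. norm (u x * of_real (gauss \<delta> x)) \<le> norm (C * gauss \<delta> x)"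
    using order_trans[OF le abs_ge_self] by (auto simp: norm_mult abs_mult intro!: mult_right_mono)
qed measurable

lemma integral_fourier_gauss:
  fixes u :: "'d::finite signal"
  assumes u: "integrable lborel u" and \<delta>: "\<delta> > 0"
  shows "of_real (LINT \<xi>|lborel. (cmod (fourier_integral u \<xi>))\<^sup>2 * gauss \<delta> \<xi>) = (LINT x|lborel. cnj (u x) * mollify \<delta> u x)"
proof -
  have [measurable]: "u \<in> borel_measurable borel" using u by auto
  note [measurable] = fourier_integral_measurable[of u]
  have int: "integrable lborel (\<lambda>\<xi>. fourier_integral u \<xi> * of_real (gauss \<delta> \<xi>))"
    by (rule integrable_bounded_times_gauss[OF _ fourier_integral_bound \<delta>]) simp
  have "of_real (LINT \<xi>|lborel. (cmod (fourier_integral u \<xi>))\<^sup>2 * gauss \<delta> \<xi>)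
      = (LINT \<xi>|lborel. of_real ((cmod (fourier_integral u \<xi>))\<^sup>2 * gauss \<delta> \<xi>) :: complex)"
    by (rule integral_complex_of_real[symmetric])
  also have "\<dots> = (LINT \<xi>|lborel. (LINT x|lborel. cnj (u x) * (fourier_integral u \<xi> * of_real (gauss \<delta> \<xi>) * cis (2 * pi * (x \<bullet> \<xi>)))))"
  proof (intro Bochner_Integration.integral_cong refl)
    fix \<xi> :: "real^'d"
    have "(LINT x|lborel. cnj (u x) * (fourier_integral u \<xi> * of_real (gauss \<delta> \<xi>) * cis (2 * pi * (x \<bullet> \<xi>))))
        = (LINT x|lborel. cnj (u x * cis (- (2 * pi * (x \<bullet> \<xi>)))) * (fourier_integral u \<xi> * of_real (gauss \<delta> \<xi>)))"
      by (intro Bochner_Integration.integral_cong refl) (simp add: cis_cnj)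
    also have "\<dots> = cnj (fourier_integral u \<xi>) * (fourier_integral u \<xi> * of_real (gauss \<delta> \<xi>))"
      unfolding fourier_integral_cis integral_mult_left_zero Bochner_Integration.integral_cnj ..
    also have "\<dots> = of_real ((cmod (fourier_integral u \<xi>))\<^sup>2 * gauss \<delta> \<xi>)"
      unfolding of_real_mult complex_norm_square by (simp only: mult_ac)
    finally show "of_real ((cmod (fourier_integral u \<xi>))\<^sup>2 * gauss \<delta> \<xi>) =
      (LINT x|lborel. cnj (u x) * (fourier_integral u \<xi> * of_real (gauss \<delta> \<xi>) * cis (2 * pi * (x \<bullet> \<xi>))))" ..
  qed
  also have "\<dots> = (LINT x|lborel. (LINT \<xi>|lborel. cnj (u x) * (fourier_integral u \<xi> * of_real (gauss \<delta> \<xi>) * cis (2 * pi * (x \<bullet> \<xi>)))))"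
    by (rule integral_swap_bounded_kernel[OF _ int]) (use u in auto)
  also have "\<dots> = (LINT x|lborel. cnj (u x) * mollify \<delta> u x)"
    unfolding integral_mult_right_zero integral_fourier_gauss_cis[OF u \<delta>] ..
  finally show ?thesis .
qed

lemma gauss_tendsto_1:
  assumes "\<delta> \<longlonglongrightarrow> 0"
  shows "(\<lambda>n. gauss (\<delta> n) x) \<longlonglongrightarrow> 1"
proof -
  have "(\<lambda>n. exp (- pi * (\<delta> n)\<^sup>2 * (x \<bullet> x))) \<longlonglongrightarrow> exp (- pi * 0\<^sup>2 * (x \<bullet> x))"
    by (intro tendsto_intros assms)
  then show ?thesis by (simp add: gauss_def)
qed

lemma gauss_antimono: "0 \<le> \<delta> \<Longrightarrow> \<delta> \<le> \<epsilon> \<Longrightarrow> gauss \<epsilon> x \<le> gauss \<delta> x"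
  by (auto simp: gauss_def intro!: mult_right_mono power_mono)

text \<open>
  The regularised energy \<open>?I n\<close> of the Fourier transform equals the inner product of \<open>u\<close> with its
  mollification, which tends to \<open>\<parallel>u\<parallel>\<^sup>2\<close>. The Gaussian factors increase to 1, so monotone
  convergence yields both the square integrability of the transform and its norm.
\<close>

theorem plancherel:
  fixes u :: "'d::finite signal"
  assumes u: "integrable lborel u" "u \<in> L2"
  shows "fourier_integral u \<in> L2" "L2_norm (fourier_integral u) = L2_norm u"
proof -
  define \<delta> :: "nat \<Rightarrow> real" where "\<delta> n = inverse (real (Suc n))" for n
  have \<delta>: "\<delta> n > 0" "\<delta> n \<noteq> 0" for n by (auto simp: \<delta>_def)
  have \<delta>0: "\<delta> \<longlonglongrightarrow> 0" unfolding \<delta>_def[abs_def] by (rule LIMSEQ_inverse_real_of_nat)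
  have \<delta>_mono: "\<delta> n \<le> \<delta> m" if "m \<le> n" for m n
    unfolding \<delta>_def using that by (intro le_imp_inverse_le) auto
  note [measurable] = L2_measurable[OF u(2)] fourier_integral_measurable[of u]
  note mol = mollify_L2_tendsto[OF u \<delta>(2) \<delta>0]
  let ?I = "\<lambda>n. LINT \<xi>|lborel. (cmod (fourier_integral u \<xi>))\<^sup>2 * gauss (\<delta> n) \<xi>"
  have "?I n = Re (LINT x|lborel. cnj (u x) * mollify (\<delta> n) u x)" for n
    by (metis integral_fourier_gauss[OF u(1) \<delta>(1)] Re_complex_of_real)
  then have I: "?I n = ((L2_norm u)\<^sup>2 + (L2_norm (mollify (\<delta> n) u))\<^sup>2 - (L2_norm (\<lambda>x. mollify (\<delta> n) u x - u x))\<^sup>2) / 2" for n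
    by (simp add: L2_polarization[OF u(2) mol(1)])
  have "?I \<longlonglongrightarrow> ((L2_norm u)\<^sup>2 + (L2_norm u)\<^sup>2 - 0\<^sup>2) / 2"
    unfolding I by (intro tendsto_intros L2_norm_tendsto[OF mol(1) u(2) mol(2)] mol(2)) simp
  then have lim: "?I \<longlonglongrightarrow> (L2_norm u)\<^sup>2" by simp
  have int: "integrable lborel (\<lambda>\<xi>. (cmod (fourier_integral u \<xi>))\<^sup>2 * gauss (\<delta> n) \<xi>)" for n
  proof (rule Bochner_Integration.integrable_bound)
    show "integrable lborel (\<lambda>\<xi>::real^'d. (LINT x|lborel. cmod (u x))\<^sup>2 * gauss (\<delta> n) \<xi>)"
      by (intro integrable_mult_right integrable_gauss \<delta>)
    show "AE \<xi> in lborel. norm ((cmod (fourier_integral u \<xi>))\<^sup>2 * gauss (\<delta> n) \<xi>)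
        \<le> norm ((LINT x|lborel. cmod (u x))\<^sup>2 * gauss (\<delta> n) \<xi>)"
      by (auto simp: abs_mult intro!: mult_right_mono power_mono fourier_integral_bound)
  qed measurable
  have mono: "mono (\<lambda>n. (cmod (fourier_integral u \<xi>))\<^sup>2 * gauss (\<delta> n) \<xi>)" for \<xi>
    using \<delta>(1) by (intro monoI mult_left_mono gauss_antimono \<delta>_mono) (auto simp: less_imp_le)
  have ptw: "(\<lambda>n. (cmod (fourier_integral u \<xi>))\<^sup>2 * gauss (\<delta> n) \<xi>) \<longlonglongrightarrow> (cmod (fourier_integral u \<xi>))\<^sup>2" for \<xi>
    using tendsto_mult[OF tendsto_const gauss_tendsto_1[OF \<delta>0]] by simp
  have "has_bochner_integral lborel (\<lambda>\<xi>. (cmod (fourier_integral u \<xi>))\<^sup>2) ((L2_norm u)\<^sup>2)"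
    by (rule has_bochner_integral_monotone_convergence[OF int _ _ lim]) (auto simp: mono ptw)
  then show "fourier_integral u \<in> L2" "L2_norm (fourier_integral u) = L2_norm u"
    by (auto simp: L2_def L2_norm_def has_bochner_integral_iff)
qed

section \<open>The Fourier-Plancherel transform\<close>

lemma is_fourier_L2: "is_fourier f g \<Longrightarrow> f \<in> L2" "is_fourier f g \<Longrightarrow> g \<in> L2"
  by (auto simp: is_fourier_def)

text \<open>
  Any approximating sequence in the definition of \<^const>\<open>is_fourier\<close> consists of functions to which
  \<open>plancherel\<close> applies.
\<close>

lemma is_fourier_isometry:
  assumes "is_fourier f g"
  shows "L2_norm g = L2_norm f"
proof -
  obtain u where u: "\<And>n::nat. u n \<in> L2" "\<And>n. integrable lborel (u n)" "(\<lambda>n. L2_norm (\<lambda>x. u n x - f x)) \<longlonglongrightarrow> 0"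
    "\<And>n. fourier_integral (u n) \<in> L2" "(\<lambda>n. L2_norm (\<lambda>\<xi>. fourier_integral (u n) \<xi> - g \<xi>)) \<longlonglongrightarrow> 0"
    using assms unfolding is_fourier_def by blast
  have "(\<lambda>n. L2_norm (fourier_integral (u n))) \<longlonglongrightarrow> L2_norm g"
    by (rule L2_norm_tendsto[OF u(4) is_fourier_L2(2)[OF assms] u(5)])
  moreover have "(\<lambda>n. L2_norm (fourier_integral (u n))) \<longlonglongrightarrow> L2_norm f"
    unfolding plancherel(2)[OF u(2) u(1)] by (rule L2_norm_tendsto[OF u(1) is_fourier_L2(1)[OF assms] u(3)])
  ultimately show ?thesis by (rule LIMSEQ_unique)
qed

lemma is_fourier_approx:
  assumes "is_fourier f g" and e: "e > 0"
  shows "\<exists>u. u \<in> L2 \<and> integrable lborel u \<and> L2_norm (\<lambda>x. u x - f x) < e \<and>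
    L2_norm (\<lambda>\<xi>. fourier_integral u \<xi> - g \<xi>) < e"
proof -
  obtain u where u: "\<And>n::nat. u n \<in> L2" "\<And>n. integrable lborel (u n)" "(\<lambda>n. L2_norm (\<lambda>x. u n x - f x)) \<longlonglongrightarrow> 0"
    "(\<lambda>n. L2_norm (\<lambda>\<xi>. fourier_integral (u n) \<xi> - g \<xi>)) \<longlonglongrightarrow> 0"
    using assms unfolding is_fourier_def by blast
  have "eventually (\<lambda>n. L2_norm (\<lambda>x. u n x - f x) < e \<and> L2_norm (\<lambda>\<xi>. fourier_integral (u n) \<xi> - g \<xi>) < e) sequentially"
    by (intro eventually_conj order_tendstoD(2)[OF u(3) e] order_tendstoD(2)[OF u(4) e])
  then show ?thesis using u(1,2) by (auto simp: eventually_sequentially)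
qed

text \<open>
  A diagonal argument: each pair of the sequence is replaced by a sufficiently close integrable
  function and its Fourier integral.
\<close>

lemma is_fourier_closed:
  fixes f g :: "'d::finite signal"
  assumes F: "f \<in> L2" "g \<in> L2" and fg: "\<And>n. is_fourier (fn n) (gn n)"
    and f: "(\<lambda>n. L2_norm (\<lambda>x. fn n x - f x)) \<longlonglongrightarrow> 0"
    and g: "(\<lambda>n. L2_norm (\<lambda>x. gn n x - g x)) \<longlonglongrightarrow> 0"
  shows "is_fourier f g"
proof -
  have "\<exists>u. u \<in> L2 \<and> integrable lborel u \<and> L2_norm (\<lambda>x. u x - fn n x) < inverse (real (Suc n)) \<and>
    L2_norm (\<lambda>\<xi>. fourier_integral u \<xi> - gn n \<xi>) < inverse (real (Suc n))" for n
    by (rule is_fourier_approx[OF fg]) simp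
  then obtain u where u: "\<And>n. u n \<in> L2" "\<And>n. integrable lborel (u n)"
    "\<And>n. L2_norm (\<lambda>x. u n x - fn n x) < inverse (real (Suc n))"
    "\<And>n. L2_norm (\<lambda>\<xi>. fourier_integral (u n) \<xi> - gn n \<xi>) < inverse (real (Suc n))"
    by metis
  have fL: "fn n \<in> L2" "gn n \<in> L2" "fourier_integral (u n) \<in> L2" for n
    using is_fourier_L2[OF fg] plancherel(1)[OF u(2) u(1)] by auto
  have 1: "(\<lambda>n. L2_norm (\<lambda>x. u n x - f x)) \<longlonglongrightarrow> 0"
  proof (rule tendsto_sandwich[OF _ _ tendsto_const])
    show "\<forall>\<^sub>F n in sequentially. L2_norm (\<lambda>x. u n x - f x) \<le> inverse (real (Suc n)) + L2_norm (\<lambda>x. fn n x - f x)"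
      using L2_norm_diff_triangle[OF u(1) fL(1) F(1)] u(3)
      by (intro always_eventually allI) (meson add_le_cancel_right less_imp_le order_trans)
    show "(\<lambda>n. inverse (real (Suc n)) + L2_norm (\<lambda>x. fn n x - f x)) \<longlonglongrightarrow> 0"
      using tendsto_add[OF LIMSEQ_inverse_real_of_nat f] by simp
  qed (simp add: L2_norm_nonneg)
  have 2: "(\<lambda>n. L2_norm (\<lambda>x. fourier_integral (u n) x - g x)) \<longlonglongrightarrow> 0"
  proof (rule tendsto_sandwich[OF _ _ tendsto_const])
    show "\<forall>\<^sub>F n in sequentially. L2_norm (\<lambda>x. fourier_integral (u n) x - g x) \<le> inverse (real (Suc n)) + L2_norm (\<lambda>x. gn n x - g x)"
      using L2_norm_diff_triangle[OF fL(3) fL(2) F(2)] u(4)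
      by (intro always_eventually allI) (meson add_le_cancel_right less_imp_le order_trans)
    show "(\<lambda>n. inverse (real (Suc n)) + L2_norm (\<lambda>x. gn n x - g x)) \<longlonglongrightarrow> 0"
      using tendsto_add[OF LIMSEQ_inverse_real_of_nat g] by simp
  qed (simp add: L2_norm_nonneg)
  show ?thesis
    unfolding is_fourier_def using F u(1,2) fL(3) 1 2 by blast
qed

lemma fourier_integral_integrable:
  fixes u :: "'d::finite signal"
  assumes "integrable lborel u"
  shows "integrable lborel (\<lambda>x. u x * cis (- (2 * pi * (x \<bullet> \<xi>))))"
  by (rule Bochner_Integration.integrable_bound[OF assms]) (use assms in \<open>auto simp: norm_mult\<close>)

lemma is_fourier_add:
  assumes 1: "is_fourier f g" and 2: "is_fourier f' g'"
  shows "is_fourier (\<lambda>x. f x + f' x) (\<lambda>x. g x + g' x)"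
proof -
  note L = is_fourier_L2[OF 1] is_fourier_L2[OF 2]
  obtain u where u: "\<And>n::nat. u n \<in> L2" "\<And>n. integrable lborel (u n)" "(\<lambda>n. L2_norm (\<lambda>x. u n x - f x)) \<longlonglongrightarrow> 0"
    "\<And>n. fourier_integral (u n) \<in> L2" "(\<lambda>n. L2_norm (\<lambda>\<xi>. fourier_integral (u n) \<xi> - g \<xi>)) \<longlonglongrightarrow> 0"
    using 1 unfolding is_fourier_def by blast
  obtain u' where u': "\<And>n::nat. u' n \<in> L2" "\<And>n. integrable lborel (u' n)" "(\<lambda>n. L2_norm (\<lambda>x. u' n x - f' x)) \<longlonglongrightarrow> 0"
    "\<And>n. fourier_integral (u' n) \<in> L2" "(\<lambda>n. L2_norm (\<lambda>\<xi>. fourier_integral (u' n) \<xi> - g' \<xi>)) \<longlonglongrightarrow> 0"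
    using 2 unfolding is_fourier_def by blast
  have add: "(\<lambda>n. L2_norm (\<lambda>x. (a n x + b n x) - (c x + d x))) \<longlonglongrightarrow> 0"
    if "\<And>n::nat. a n \<in> L2" "\<And>n. b n \<in> L2" "c \<in> L2" "d \<in> L2" "(\<lambda>n. L2_norm (\<lambda>x. a n x - c x)) \<longlonglongrightarrow> 0"
      "(\<lambda>n. L2_norm (\<lambda>x. b n x - d x)) \<longlonglongrightarrow> 0" for a b and c d :: "'a signal"
  proof (rule tendsto_sandwich[OF _ _ tendsto_const])
    show "\<forall>\<^sub>F n in sequentially. L2_norm (\<lambda>x. (a n x + b n x) - (c x + d x))
        \<le> L2_norm (\<lambda>x. a n x - c x) + L2_norm (\<lambda>x. b n x - d x)"
      using L2_norm_triangle[OF L2_diff[OF that(1,3)] L2_diff[OF that(2,4)]]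
      by (intro always_eventually allI) (simp add: algebra_simps)
    show "(\<lambda>n. L2_norm (\<lambda>x. a n x - c x) + L2_norm (\<lambda>x. b n x - d x)) \<longlonglongrightarrow> 0"
      using tendsto_add[OF that(5,6)] by simp
  qed (simp add: L2_norm_nonneg)
  have F: "fourier_integral (\<lambda>x. u n x + u' n x) = (\<lambda>\<xi>. fourier_integral (u n) \<xi> + fourier_integral (u' n) \<xi>)" for n
    unfolding fourier_integral_cis distrib_right
    by (intro ext Bochner_Integration.integral_add fourier_integral_integrable u(2) u'(2))
  show ?thesis
    unfolding is_fourier_def
    by (intro conjI exI[of _ "\<lambda>n x. u n x + u' n x"] allI)
      (auto simp: F L2_add L u u' intro!: add)
qed

lemma is_fourier_cmult:
  assumes 1: "is_fourier f g"
  shows "is_fourier (\<lambda>x. c * f x) (\<lambda>x. c * g x)"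
proof -
  note L = is_fourier_L2[OF 1]
  obtain u where u: "\<And>n::nat. u n \<in> L2" "\<And>n. integrable lborel (u n)" "(\<lambda>n. L2_norm (\<lambda>x. u n x - f x)) \<longlonglongrightarrow> 0"
    "\<And>n. fourier_integral (u n) \<in> L2" "(\<lambda>n. L2_norm (\<lambda>\<xi>. fourier_integral (u n) \<xi> - g \<xi>)) \<longlonglongrightarrow> 0"
    using 1 unfolding is_fourier_def by blast
  have F: "fourier_integral (\<lambda>x. c * u n x) = (\<lambda>\<xi>. c * fourier_integral (u n) \<xi>)" for n
    unfolding fourier_integral_cis by (simp add: mult.assoc)
  have "(\<lambda>n. L2_norm (\<lambda>x. c * u n x - c * f x)) \<longlonglongrightarrow> 0"
    "(\<lambda>n. L2_norm (\<lambda>x. c * fourier_integral (u n) x - c * g x)) \<longlonglongrightarrow> 0"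
    using tendsto_mult[OF tendsto_const u(3), of "cmod c"] tendsto_mult[OF tendsto_const u(5), of "cmod c"]
    by (simp_all add: right_diff_distrib[symmetric] L2_norm_cmult)
  then show ?thesis
    unfolding is_fourier_def
    by (intro conjI exI[of _ "\<lambda>n x. c * u n x"] allI) (simp_all add: F L2_cmult L u)
qed

text \<open>
  By additivity the difference of two transforms is a transform of the difference, and an isometry
  sends what is negligible to what is negligible.
\<close>

lemma is_fourier_unique:
  assumes 1: "is_fourier f g" and 2: "is_fourier f' g'" and "ae_eq f f'"
  shows "ae_eq g g'"
proof -
  note L = is_fourier_L2[OF 1] is_fourier_L2[OF 2]
  have "is_fourier (\<lambda>x. f x + (-1) * f' x) (\<lambda>x. g x + (-1) * g' x)"
    by (intro is_fourier_add is_fourier_cmult 1 2)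
  from is_fourier_isometry[OF this] show ?thesis
    using assms(3) by (simp add: ae_eq_iff_L2_norm L)
qed

text \<open>
  The inverse Fourier integral of \<open>v\<close> need not be integrable, hence the Gaussian factor in the
  approximating sequence. Its Fourier integral is \<open>mollify (\<delta> n) v\<close> by the regularised inversion
  formula after a reflection.
\<close>

lemma is_fourier_inverse_integral:
  fixes v :: "'d::finite signal"
  assumes v: "integrable lborel v" "v \<in> L2"
  shows "is_fourier (\<lambda>x. fourier_integral v (- x)) v"
proof -
  define \<delta> :: "nat \<Rightarrow> real" where "\<delta> n = inverse (real (Suc n))" for n
  have \<delta>: "\<delta> n > 0" "\<delta> n \<noteq> 0" for n by (auto simp: \<delta>_def)
  have \<delta>0: "\<delta> \<longlonglongrightarrow> 0" unfolding \<delta>_def[abs_def] by (rule LIMSEQ_inverse_real_of_nat)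
  note mol = mollify_L2_tendsto[OF v \<delta>(2) \<delta>0]
  define w where "w x = fourier_integral v (- x)" for x
  have w: "w \<in> L2" unfolding w_def[abs_def] by (rule L2_reflect[OF plancherel(1)[OF v]])
  note [measurable] = L2_measurable[OF w] L2_measurable[OF v(2)] fourier_integral_measurable[of v]
  define u where "u n x = w x * of_real (gauss (\<delta> n) x)" for n x
  have m[measurable]: "u n \<in> borel_measurable borel" for n unfolding u_def[abs_def] by measurable
  have le: "cmod (u n x) \<le> cmod (w x)" for n x
    by (simp add: u_def norm_mult abs_of_pos[OF gauss_bounds(1)] gauss_bounds(2) mult_left_le)
  have u2: "u n \<in> L2" for n by (rule L2_dominated[OF m w le])
  have u1: "integrable lborel (u n)" for n
    unfolding u_def w_def by (rule integrable_bounded_times_gauss[OF _ fourier_integral_bound \<delta>(1)]) measurable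
  have lim: "(\<lambda>n. L2_norm (\<lambda>x. u n x - w x)) \<longlonglongrightarrow> 0"
  proof (rule L2_norm_dominated_tendsto_0[OF _ L2_integrable[OF w]])
    fix n x
    have "u n x - w x = w x * of_real (gauss (\<delta> n) x - 1)" by (simp add: u_def right_diff_distrib)
    moreover have "\<bar>gauss (\<delta> n) x - 1\<bar> \<le> 1" using gauss_bounds[of "\<delta> n" x] by simp
    ultimately show "cmod (u n x - w x) \<le> cmod (w x)"
      by (simp only: norm_mult norm_of_real mult_left_le norm_ge_zero)
  next
    have "(\<lambda>n. u n x - w x) \<longlonglongrightarrow> 0" for x
    proof -
      have "(\<lambda>n. u n x) \<longlonglongrightarrow> w x * of_real 1"
        unfolding u_def by (intro tendsto_intros gauss_tendsto_1 \<delta>0)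
      then show ?thesis by (intro LIM_zero) simp
    qed
    then show "AE x in lborel. (\<lambda>n. u n x - w x) \<longlonglongrightarrow> 0" by simp
  qed measurable
  have F: "fourier_integral (u n) = mollify (\<delta> n) v" for n
  proof
    fix \<xi>
    let ?h = "\<lambda>x. u n x * cis (- (2 * pi * (x \<bullet> \<xi>)))"
    have g: "gauss \<epsilon> (- x) = gauss \<epsilon> x" for \<epsilon> and x :: "real^'d" by (simp add: gauss_def)
    have "fourier_integral (u n) \<xi> = (LINT x|lborel. ?h (0 + (-1) *\<^sub>R x))"
      unfolding fourier_integral_cis using lborel_integral_affine[of "-1" ?h 0] by simp
    also have "\<dots> = (LINT x|lborel. fourier_integral v x * of_real (gauss (\<delta> n) x) * cis (2 * pi * (\<xi> \<bullet> x)))"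
      by (simp add: u_def w_def g inner_commute)
    also have "\<dots> = mollify (\<delta> n) v \<xi>"
      by (rule integral_fourier_gauss_cis[OF v(1) \<delta>(1)])
    finally show "fourier_integral (u n) \<xi> = mollify (\<delta> n) v \<xi>" .
  qed
  have "is_fourier w v"
    unfolding is_fourier_def
    by (intro conjI exI[of _ u] allI) (simp_all add: w v u1 u2 lim F mol)
  then show ?thesis by (simp add: w_def[abs_def])
qed

text \<open>
  The inverse Fourier integrals of the truncations of \<open>g\<close> form a Cauchy sequence, because the
  transform is isometric.
\<close>

theorem is_fourier_surj:
  fixes g :: "'d::finite signal"
  assumes g: "g \<in> L2"
  shows "\<exists>f. is_fourier f g"
proof -
  note t = L2_truncation[OF g]
  have t2: "truncation n g \<in> L2" for n by (rule L2_if_bounded_support[OF t(1,2)])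
  have t1: "integrable lborel (truncation n g)" for n
  proof (rule Bochner_Integration.integrable_bound)
    show "integrable lborel (\<lambda>x::real^'d. real n * indicator (cball 0 (real n)) x :: real)"
      by (intro integrable_mult_right integrable_real_indicator emeasure_lborel_cball_finite) simp
    show "AE x in lborel. norm (truncation n g x) \<le> norm (real n * indicator (cball 0 (real n)) x :: real)"
      using t(2)[of n] by (auto intro: order_trans[OF _ abs_ge_self])
  qed (use t(1) in simp)
  define f where "f n x = fourier_integral (truncation n g) (- x)" for n x
  have F: "is_fourier (f n) (truncation n g)" for n
    unfolding f_def[abs_def] by (rule is_fourier_inverse_integral[OF t1 t2])
  have diff: "L2_norm (\<lambda>x. f m x - f n x) = L2_norm (\<lambda>x. truncation m g x - truncation n g x)" for m n
    using is_fourier_isometry[OF is_fourier_add[OF F[of m] is_fourier_cmult[OF F[of n], of "-1"]]] by simp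
  have "\<exists>h\<in>L2. (\<lambda>n. L2_norm (\<lambda>x. f n x - h x)) \<longlonglongrightarrow> 0"
  proof (rule L2_complete)
    fix e :: real assume "e > 0"
    then have "\<forall>\<^sub>F n in sequentially. L2_norm (\<lambda>x. truncation n g x - g x) < e / 2"
      by (intro order_tendstoD(2)[OF t(3)]) simp
    then obtain N where N: "\<And>n. n \<ge> N \<Longrightarrow> L2_norm (\<lambda>x. truncation n g x - g x) < e / 2"
      by (auto simp: eventually_sequentially)
    show "\<exists>N. \<forall>m\<ge>N. \<forall>n\<ge>N. L2_norm (\<lambda>x. f m x - f n x) < e"
    proof (intro exI allI impI)
      fix m n assume "N \<le> m" "N \<le> n"
      then show "L2_norm (\<lambda>x. f m x - f n x) < e"
        using L2_norm_diff_triangle[OF t2 g t2, of m n] N[of m] N[of n]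
          L2_norm_diff_commute[of g "truncation n g"] by (simp add: diff)
    qed
  qed (rule is_fourier_L2(1)[OF F])
  then obtain h where "h \<in> L2" "(\<lambda>n. L2_norm (\<lambda>x. f n x - h x)) \<longlonglongrightarrow> 0" by blast
  then have "is_fourier h g" by (rule is_fourier_closed[OF _ g F _ t(3)])
  then show ?thesis by blast
qed

section \<open>The quasi-regular representation on the Fourier side\<close>

text \<open>
  The complex-valued counterpart of the linear substitution rule \<open>integral_matrix_inv\<close>.
\<close>

lemma
  fixes k :: "real^'d::{finite,wellorder}^'d::_" and f :: "(real, 'd) vec \<Rightarrow> complex"
  assumes k: "invertible k" and [measurable]: "f \<in> borel_measurable borel"
  shows integrable_complex_matrix_inv: "integrable lborel (\<lambda>x. f (matrix_inv k *v x)) \<longleftrightarrow> integrable lborel f"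
    and integral_complex_matrix_inv: "(LINT x|lborel. f (matrix_inv k *v x)) = of_real \<bar>det k\<bar> * (LINT x|lborel. f x)"
proof -
  have d: "det k \<noteq> 0" using k by (simp add: invertible_det_nz)
  note [measurable] = measurable_matrix_inv[OF k]
  have "integrable lborel f \<longleftrightarrow> integrable (density (distr lborel borel (\<lambda>x. matrix_inv k *v x)) (\<lambda>_. ennreal (1 / \<bar>det k\<bar>))) f"
    by (simp only: lborel_linear[OF k, symmetric])
  also have "\<dots> \<longleftrightarrow> integrable lborel (\<lambda>x. (1 / \<bar>det k\<bar>) *\<^sub>R f (matrix_inv k *v x))"
    by (simp add: integrable_density integrable_distr_eq)
  also have "\<dots> \<longleftrightarrow> integrable lborel (\<lambda>x. f (matrix_inv k *v x))"
    using d integrable_scaleR_right[of "\<bar>det k\<bar>" lborel "\<lambda>x. (1 / \<bar>det k\<bar>) *\<^sub>R f (matrix_inv k *v x)"]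
      integrable_scaleR_right[of "1 / \<bar>det k\<bar>" lborel "\<lambda>x. f (matrix_inv k *v x)"] by auto
  finally show "integrable lborel (\<lambda>x. f (matrix_inv k *v x)) \<longleftrightarrow> integrable lborel f" ..
  have "(LINT x|lborel. f x) = (LINT x|density (distr lborel borel (\<lambda>x. matrix_inv k *v x)) (\<lambda>_. ennreal (1 / \<bar>det k\<bar>)). f x)"
    by (simp only: lborel_linear[OF k, symmetric])
  also have "\<dots> = (1 / \<bar>det k\<bar>) *\<^sub>R (LINT x|lborel. f (matrix_inv k *v x))"
    by (simp add: integral_density integral_distr)
  finally show "(LINT x|lborel. f (matrix_inv k *v x)) = of_real \<bar>det k\<bar> * (LINT x|lborel. f x)"
    using d by (simp add: scaleR_conv_of_real)
qed

lemma matrix_inv_unique: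
  fixes A B :: "real^'n^'n"
  assumes "A ** B = mat 1"
  shows "matrix_inv A = B" "invertible A"
proof -
  have BA: "B ** A = mat 1" using assms by (simp add: matrix_left_right_inverse)
  then show inv: "invertible A" using assms by (auto simp: invertible_def)
  have "matrix_inv A = matrix_inv A ** (A ** B)" by (simp add: assms)
  also have "\<dots> = B" by (simp add: matrix_mul_assoc matrix_inv_mult[OF inv])
  finally show "matrix_inv A = B" .
qed

lemma
  fixes A :: "real^'n^'n"
  assumes A: "invertible A"
  shows invertible_matrix_inv: "invertible (matrix_inv A)"
    and matrix_inv_matrix_inv: "matrix_inv (matrix_inv A) = A"
  using matrix_inv_unique[OF matrix_inv_mult(2)[OF A]] by auto

lemma invertible_transpose_matrix:
  fixes A :: "real^'n^'n"
  shows "invertible A \<Longrightarrow> invertible (transpose A)"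
  by (simp add: invertible_det_nz)

text \<open>
  Writing the representation as a translate of an operator of the metaplectic kind (with zero
  phase) reduces its \<open>L\<^sup>2\<close> properties to those of \<^const>\<open>lower_symp_operator\<close>.
\<close>

lemma quasi_regular_eq_lower_symp_operator:
  "quasi_regular (x, h) f = (\<lambda>y. lower_symp_operator 0 h f (y + (- x)))"
  by (rule ext) (simp add: quasi_regular_def lower_symp_operator_def)

lemma
  fixes h :: "real^'d::{finite,wellorder}^'d::_"
  assumes "invertible h" "f \<in> L2"
  shows quasi_regular_L2: "quasi_regular (x, h) f \<in> L2"
    and L2_norm_quasi_regular: "L2_norm (quasi_regular (x, h) f) = L2_norm f"
  unfolding quasi_regular_eq_lower_symp_operator
  using lower_symp_operator_L2[OF assms, of 0]
  by (simp_all only: L2_translate L2_norm_translate)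

text \<open>
  The conjugate of \<^const>\<open>quasi_regular\<close> by the Fourier transform.
\<close>

definition dual_action ::
    "(real^'d) \<times> (real^'d^'d) \<Rightarrow> 'd::finite signal \<Rightarrow> 'd signal" where
  "dual_action = (\<lambda>(x, h) g \<xi>. of_real (\<bar>det h\<bar> powr (1/2)) * cis (- (2 * pi * (x \<bullet> \<xi>))) * g (transpose h *v \<xi>))"

lemma dual_action_eq_lower_symp_operator:
  fixes h :: "real^'d::finite^'d"
  assumes h: "invertible h"
  shows "dual_action (x, h) g = (\<lambda>\<xi>. cis (- (2 * pi * (x \<bullet> \<xi>))) * lower_symp_operator 0 (matrix_inv (transpose h)) g \<xi>)"
proof -
  have t: "invertible (transpose h)" using h by (rule invertible_transpose_matrix)
  have "det (transpose h) * det (matrix_inv (transpose h)) = 1"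
    by (metis det_I det_mul matrix_inv_mult(1)[OF t])
  then have "det (matrix_inv (transpose h)) = 1 / det h"
    by (metis det_transpose mult_eq_0_iff nonzero_eq_divide_eq mult.commute zero_neq_one)
  then have "\<bar>det (matrix_inv (transpose h))\<bar> powr (- 1/2) = \<bar>det h\<bar> powr (1/2)"
    by (simp add: powr_minus_divide powr_divide)
  then show ?thesis
    by (intro ext) (simp add: dual_action_def lower_symp_operator_def matrix_inv_matrix_inv[OF t])
qed

lemma
  fixes h :: "real^'d::{finite,wellorder}^'d::_"
  assumes h: "invertible h" and g: "g \<in> L2"
  shows dual_action_L2: "dual_action (x, h) g \<in> L2"
    and L2_norm_dual_action: "L2_norm (dual_action (x, h) g) = L2_norm g"
proof -
  note L = lower_symp_operator_L2[OF invertible_matrix_inv[OF invertible_transpose_matrix[OF h]] g, of 0]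
  note [measurable] = L2_measurable[OF L(1)]
  have "(\<lambda>\<xi>. cis (- (2 * pi * (x \<bullet> \<xi>))) * lower_symp_operator 0 (matrix_inv (transpose h)) g \<xi>) \<in> borel_measurable borel"
    by measurable
  then show "dual_action (x, h) g \<in> L2"
    unfolding dual_action_eq_lower_symp_operator[OF h] by (rule L2_dominated[OF _ L(1)]) (simp add: norm_mult)
  show "L2_norm (dual_action (x, h) g) = L2_norm g"
    unfolding dual_action_eq_lower_symp_operator[OF h] L(2)[symmetric] by (simp add: L2_norm_def norm_mult)
qed

lemma fourier_integral_quasi_regular:
  fixes h :: "real^'d::{finite,wellorder}^'d::_"
  assumes h: "invertible h" and u: "integrable lborel u"
  shows "integrable lborel (quasi_regular (x, h) u)"
    and "fourier_integral (quasi_regular (x, h) u) = dual_action (x, h) (fourier_integral u)"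
proof -
  have d: "det h \<noteq> 0" using h by (simp add: invertible_det_nz)
  have [measurable]: "u \<in> borel_measurable borel" using u by auto
  note [measurable] = measurable_matrix_inv[OF h]
  have int: "integrable lborel (\<lambda>y. u (matrix_inv h *v y))"
    by (simp add: integrable_complex_matrix_inv[OF h] u)
  have "integrable lborel (\<lambda>y. u (matrix_inv h *v (- x + 1 *\<^sub>R y)))"
    using lborel_integrable_affine_iff[of 1 "\<lambda>y. u (matrix_inv h *v y)" "- x"] int by simp
  then show "integrable lborel (quasi_regular (x, h) u)"
    unfolding quasi_regular_def by simp
  show "fourier_integral (quasi_regular (x, h) u) = dual_action (x, h) (fourier_integral u)"
  proof
    fix \<xi>
    define c where "c = complex_of_real (\<bar>det h\<bar> powr (- 1/2))"
    have hd: "c * of_real \<bar>det h\<bar> = of_real (\<bar>det h\<bar> powr (1/2))"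
    proof -
      have "\<bar>det h\<bar> powr (- 1/2) * \<bar>det h\<bar> powr 1 = \<bar>det h\<bar> powr (1/2)"
        unfolding powr_add[symmetric] by simp
      then show ?thesis using d by (simp add: c_def flip: of_real_mult)
    qed
    have inv: "h *v (matrix_inv h *v y) = y" for y
      by (simp add: matrix_vector_mul_assoc matrix_inv_mult[OF h])
    let ?F = "\<lambda>y. c * u (matrix_inv h *v (y - x)) * cis (- (2 * pi * (y \<bullet> \<xi>)))"
    let ?G = "\<lambda>z. u z * cis (- (2 * pi * (z \<bullet> (transpose h *v \<xi>))))"
    have "fourier_integral (quasi_regular (x, h) u) \<xi> = (LINT y|lborel. ?F y)"
      by (simp add: fourier_integral_cis quasi_regular_def c_def)
    also have "\<dots> = (LINT y|lborel. ?F (x + 1 *\<^sub>R y))"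
      using lborel_integral_affine[of 1 ?F x] by simp
    also have "\<dots> = (LINT y|lborel. (c * cis (- (2 * pi * (x \<bullet> \<xi>)))) * ?G (matrix_inv h *v y))"
    proof (intro Bochner_Integration.integral_cong refl)
      fix y
      have "(matrix_inv h *v y) \<bullet> (transpose h *v \<xi>) = y \<bullet> \<xi>"
        by (metis inv dot_lmul_matrix inner_commute transpose_matrix_vector)
      moreover have "cis (- (2 * pi * ((x + y) \<bullet> \<xi>))) = cis (- (2 * pi * (x \<bullet> \<xi>))) * cis (- (2 * pi * (y \<bullet> \<xi>)))"
        by (simp add: cis_mult inner_add_left algebra_simps)
      ultimately show "?F (x + 1 *\<^sub>R y) = (c * cis (- (2 * pi * (x \<bullet> \<xi>)))) * ?G (matrix_inv h *v y)"
        by simp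
    qed
    also have "\<dots> = (c * cis (- (2 * pi * (x \<bullet> \<xi>)))) * (of_real \<bar>det h\<bar> * fourier_integral u (transpose h *v \<xi>))"
      using integral_complex_matrix_inv[OF h, of ?G] by (simp add: fourier_integral_cis)
    also have "\<dots> = (c * of_real \<bar>det h\<bar>) * cis (- (2 * pi * (x \<bullet> \<xi>))) * fourier_integral u (transpose h *v \<xi>)"
      by (simp only: mult_ac)
    also have "\<dots> = dual_action (x, h) (fourier_integral u) \<xi>"
      unfolding hd dual_action_def by simp
    finally show "fourier_integral (quasi_regular (x, h) u) \<xi> = dual_action (x, h) (fourier_integral u) \<xi>" .
  qed
qed

text \<open>
  The identity for Fourier integrals of integrable functions passes to the limit because both
  actions are linear and isometric.
\<close>

theorem is_fourier_quasi_regular: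
  fixes h :: "real^'d::{finite,wellorder}^'d::_"
  assumes h: "invertible h" and fg: "is_fourier f g"
  shows "is_fourier (quasi_regular (x, h) f) (dual_action (x, h) g)"
proof -
  note L = is_fourier_L2[OF fg]
  obtain u where u: "\<And>n::nat. u n \<in> L2" "\<And>n. integrable lborel (u n)" "(\<lambda>n. L2_norm (\<lambda>x. u n x - f x)) \<longlonglongrightarrow> 0"
    "\<And>n. fourier_integral (u n) \<in> L2" "(\<lambda>n. L2_norm (\<lambda>\<xi>. fourier_integral (u n) \<xi> - g \<xi>)) \<longlonglongrightarrow> 0"
    using fg unfolding is_fourier_def by blast
  have 1: "(\<lambda>y. quasi_regular (x, h) (u n) y - quasi_regular (x, h) f y) = quasi_regular (x, h) (\<lambda>y. u n y - f y)" for n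
    by (simp add: quasi_regular_def right_diff_distrib)
  have 2: "(\<lambda>y. dual_action (x, h) (fourier_integral (u n)) y - dual_action (x, h) g y) = dual_action (x, h) (\<lambda>y. fourier_integral (u n) y - g y)" for n
    by (simp add: dual_action_def right_diff_distrib)
  have 3: "L2_norm (quasi_regular (x, h) (\<lambda>y. u n y - f y)) = L2_norm (\<lambda>y. u n y - f y)" for n
    by (rule L2_norm_quasi_regular[OF h L2_diff[OF u(1) L(1)]])
  have 4: "L2_norm (dual_action (x, h) (\<lambda>y. fourier_integral (u n) y - g y)) = L2_norm (\<lambda>y. fourier_integral (u n) y - g y)" for n
    by (rule L2_norm_dual_action[OF h L2_diff[OF u(4) L(2)]])
  show ?thesis
    unfolding is_fourier_def
    by (intro conjI exI[of _ "\<lambda>n. quasi_regular (x, h) (u n)"] allI)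
      (simp_all add: fourier_integral_quasi_regular[OF h u(2)] quasi_regular_L2[OF h] dual_action_L2[OF h] L u 1 2 3 4)
qed

section \<open>A quadratic change of variables on the half space\<close>

text \<open>
  The open half space is used instead of \<^const>\<open>Theta_L\<close>, from which it differs by a null set: on
  the boundary \<open>\<Psi>\<close> collapses to 0 and its Jacobian vanishes.
\<close>

definition half_space :: "(real^'d::{finite,wellorder}) set" where
  "half_space = {\<eta>. \<eta> $ first < 0}"

definition Psi :: "real^'d::{finite,wellorder} \<Rightarrow> real^'d::_" where
  "Psi \<eta> = (- (\<eta> $ first) / 2) *\<^sub>R \<eta>"

definition Psi_inv :: "real^'d::{finite,wellorder} \<Rightarrow> real^'d::_" where
  "Psi_inv \<xi> = (2 / sqrt (- 2 * (\<xi> $ first))) *\<^sub>R \<xi>"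

text \<open>
  The absolute value of the Jacobian determinant of \<open>Psi\<close> (see \<open>det_Psi_derivative\<close>).
\<close>

definition Psi_jacobian :: "real^'d::{finite,wellorder} \<Rightarrow> real" where
  "Psi_jacobian \<eta> = 2 * \<bar>\<eta> $ first / 2\<bar> ^ CARD('d)"

lemma first_le: "first \<le> (i::'d::{finite,wellorder})"
  unfolding first_def by (rule Least_le) simp

lemma component_measurable [measurable]: "(\<lambda>x::real^'d. x $ i) \<in> borel_measurable borel"
  by (intro borel_measurable_continuous_onI continuous_intros)

lemma half_space_borel [measurable]: "(half_space :: (real^'d::{finite,wellorder}) set) \<in> sets borel"
  unfolding half_space_def by measurable

lemma Psi_measurable [measurable]: "Psi \<in> borel_measurable (borel :: (real^'d::{finite,wellorder}) measure)"
  unfolding Psi_def[abs_def] by measurable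

lemma Psi_inv_measurable [measurable]: "Psi_inv \<in> borel_measurable (borel :: (real^'d::{finite,wellorder}) measure)"
  unfolding Psi_inv_def[abs_def] by measurable

lemma Psi_jacobian_measurable [measurable]: "Psi_jacobian \<in> borel_measurable (borel :: (real^'d::{finite,wellorder}) measure)"
  unfolding Psi_jacobian_def[abs_def] by measurable

lemma Psi_jacobian_nonneg: "Psi_jacobian \<eta> \<ge> 0"
  by (simp add: Psi_jacobian_def)

lemma Psi_jacobian_pos: "\<eta> \<in> half_space \<Longrightarrow> Psi_jacobian \<eta> > 0"
  by (simp add: Psi_jacobian_def half_space_def)

lemma
  shows Psi_in_half_space: "\<eta> \<in> half_space \<Longrightarrow> Psi \<eta> \<in> half_space"
    and Psi_inv_Psi: "\<eta> \<in> half_space \<Longrightarrow> Psi_inv (Psi \<eta>) = \<eta>"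
    and Psi_inv_in_half_space: "\<xi> \<in> half_space \<Longrightarrow> Psi_inv \<xi> \<in> half_space"
    and Psi_Psi_inv: "\<xi> \<in> half_space \<Longrightarrow> Psi (Psi_inv \<xi>) = \<xi>"
proof -
  show "Psi \<eta> \<in> half_space" if "\<eta> \<in> half_space"
    using that by (simp add: half_space_def Psi_def mult_neg_neg)
  show "Psi_inv (Psi \<eta>) = \<eta>" if "\<eta> \<in> half_space"
  proof -
    have n: "\<eta> $ first < 0" using that by (simp add: half_space_def)
    have "sqrt (- 2 * (Psi \<eta> $ first)) = - (\<eta> $ first)"
      using n by (intro real_sqrt_unique) (auto simp: Psi_def power2_eq_square)
    then show ?thesis using n by (simp add: Psi_inv_def) (simp add: Psi_def)
  qed
  show "Psi_inv \<xi> \<in> half_space" if "\<xi> \<in> half_space"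
    using that by (simp add: half_space_def Psi_inv_def divide_neg_pos)
  show "Psi (Psi_inv \<xi>) = \<xi>" if "\<xi> \<in> half_space"
  proof -
    have n: "\<xi> $ first < 0" using that by (simp add: half_space_def)
    define s where "s = sqrt (- 2 * (\<xi> $ first))"
    have s: "s > 0" "\<xi> $ first = - s\<^sup>2 / 2" using n by (auto simp: s_def)
    have PI: "Psi_inv \<xi> = (2 / s) *\<^sub>R \<xi>" by (simp only: Psi_inv_def s_def)
    have "Psi (Psi_inv \<xi>) = (- ((2 / s) * (\<xi> $ first)) / 2 * (2 / s)) *\<^sub>R \<xi>"
      unfolding PI by (simp add: Psi_def)
    also have "- ((2 / s) * (\<xi> $ first)) / 2 * (2 / s) = 1"
      unfolding s(2) using s(1) by (simp add: power2_eq_square field_simps)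
    finally show ?thesis by simp
  qed
qed

lemma Psi_image: "Psi ` half_space = half_space"
proof (intro subset_antisym subsetI)
  fix \<xi> :: "(real, 'a) vec" assume "\<xi> \<in> half_space"
  then show "\<xi> \<in> Psi ` half_space"
    by (intro image_eqI[of _ _ "Psi_inv \<xi>"]) (simp_all add: Psi_Psi_inv Psi_inv_in_half_space)
qed (auto simp: Psi_in_half_space)

lemma Psi_has_derivative:
  "(Psi has_derivative (\<lambda>v. - (1/2) *\<^sub>R ((v $ first) *\<^sub>R \<eta> + (\<eta> $ first) *\<^sub>R v))) (at \<eta> within S)"
proof -
  have [derivative_intros]: "((\<lambda>\<eta>. \<eta> $ first) has_derivative (\<lambda>v. v $ first)) (at \<eta> within S)"
    by (rule bounded_linear_imp_has_derivative[OF bounded_linear_vec_nth])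
  show ?thesis
    unfolding Psi_def[abs_def]
    by (rule has_derivative_eq_rhs, (rule derivative_intros)+) (auto simp: scaleR_add_right)
qed

text \<open>
  Since \<open>Psi\<close> is the identity times a function of the first coordinate, only the first column of
  the derivative leaves the diagonal, and the matrix is lower triangular. Differentiating
  \<open>- \<eta>\<^sub>1\<^sup>2 / 2\<close> gives the first diagonal entry twice the size of the others.
\<close>

lemma det_Psi_derivative:
  fixes \<eta> :: "real^'d::{finite,wellorder}"
  shows "\<bar>det (matrix (\<lambda>v. - (1/2) *\<^sub>R ((v $ first) *\<^sub>R \<eta> + (\<eta> $ first) *\<^sub>R v)))\<bar> = Psi_jacobian \<eta>"
proof -
  let ?M = "matrix (\<lambda>v. - (1/2) *\<^sub>R ((v $ first) *\<^sub>R \<eta> + (\<eta> $ first) *\<^sub>R v))"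
  have M: "?M $ i $ j = - (1/2) * ((if j = first then \<eta> $ i else 0) + (if i = j then \<eta> $ first else 0))" for i j
    by (auto simp: matrix_def axis_def)
  have "det ?M = (\<Prod>i\<in>UNIV. ?M $ i $ i)"
  proof (rule det_lowerdiagonal)
    fix i j :: 'd assume "i < j"
    then have "j \<noteq> first" "i \<noteq> j" using first_le[of i] by auto
    then show "?M $ i $ j = 0" by (simp only: M) simp
  qed
  also have "\<dots> = (\<Prod>i\<in>(UNIV :: 'd set). (- (\<eta> $ first) / 2) * (if i = first then 2 else 1))"
    by (rule prod.cong[OF refl]) (simp only: M, simp)
  also have "\<dots> = (- (\<eta> $ first) / 2) ^ CARD('d) * 2"
    by (simp only: prod.distrib prod_constant) simp
  finally show ?thesis
    by (simp add: Psi_jacobian_def abs_mult power_abs)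
qed

text \<open>
  Stated with \<^const>\<open>has_bochner_integral\<close> so that integrability can be transferred in both
  directions; the passage back is what makes the pullback below surjective.
\<close>

lemma Psi_change_of_variables:
  fixes f :: "real^'d::{finite,wellorder} \<Rightarrow> real"
  assumes [measurable]: "f \<in> borel_measurable borel"
  shows "has_bochner_integral lborel (\<lambda>\<eta>. indicator half_space \<eta> * (Psi_jacobian \<eta> * f (Psi \<eta>))) b
    \<longleftrightarrow> has_bochner_integral lborel (\<lambda>\<xi>. indicator half_space \<xi> * f \<xi>) b"
proof -
  \<comment> \<open>the substitution formula is phrased for gauge integrals of functions with values in \<open>real ^ 1\<close>\<close>
  have conv: "has_bochner_integral lborel (\<lambda>x. indicator half_space x * g x) b
      \<longleftrightarrow> (\<lambda>x. vec (g x) :: real^1) absolutely_integrable_on half_space \<and> integral half_space (\<lambda>x. vec (g x) :: real^1) = vec b"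
    if [measurable]: "g \<in> borel_measurable borel" for g :: "(real, 'd) vec \<Rightarrow> real"
  proof -
    have "has_bochner_integral lborel (\<lambda>x. indicator half_space x * g x) b \<longleftrightarrow>
        has_bochner_integral lebesgue (\<lambda>x. indicator half_space x * g x) b"
      by (simp add: has_bochner_integral_iff integrable_completion integral_completion)
    also have "\<dots> \<longleftrightarrow> g absolutely_integrable_on half_space \<and> integral half_space g = b"
      using set_lebesgue_integral_eq_integral(2)[of half_space g]
      by (auto simp: has_bochner_integral_iff set_integrable_def set_lebesgue_integral_def)
    also have "\<dots> \<longleftrightarrow> (\<lambda>x. vec (g x) :: real^1) absolutely_integrable_on half_space \<and> integral half_space (\<lambda>x. vec (g x) :: real^1) = vec b"
      by (auto simp: absolutely_integrable_on_1_iff integral_on_1_eq vec_eq_iff)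
    finally show ?thesis .
  qed
  have inj: "inj_on Psi (half_space :: (real, 'd) vec set)"
    by (rule inj_on_inverseI) (rule Psi_inv_Psi)
  have vec_scaleR: "vec (a * c) = a *\<^sub>R (vec c :: real^1)" for a c
    by (simp add: vec_eq_iff)
  have "half_space \<in> sets (lebesgue :: (real, 'd) vec measure)"
    by simp
  from has_absolute_integral_change_of_variables[OF this Psi_has_derivative inj, of "\<lambda>x. vec (f x) :: real^1" "vec b"]
  have "(\<lambda>x. vec (Psi_jacobian x * f (Psi x)) :: real^1) absolutely_integrable_on half_space \<and>
      integral half_space (\<lambda>x. vec (Psi_jacobian x * f (Psi x)) :: real^1) = vec b \<longleftrightarrow>
      (\<lambda>x. vec (f x) :: real^1) absolutely_integrable_on half_space \<and> integral half_space (\<lambda>x. vec (f x) :: real^1) = vec b"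
    unfolding det_Psi_derivative Psi_image vec_scaleR .
  moreover have "(\<lambda>x. Psi_jacobian x * f (Psi x)) \<in> borel_measurable borel" by measurable
  ultimately show ?thesis by (simp only: conv[OF assms] conv)
qed

text \<open>
  The unitary change of variables of \<open>L\<^sup>2\<close> of the half space that is induced by \<open>Psi\<close>.
\<close>

definition pullback :: "'d::{finite,wellorder} signal \<Rightarrow> 'd::_ signal" where
  "pullback g \<eta> = (if \<eta> \<in> half_space then of_real (sqrt (Psi_jacobian \<eta>)) * g (Psi \<eta>) else 0)"

lemma pullback_measurable:
  assumes [measurable]: "g \<in> borel_measurable borel"
  shows "pullback g \<in> borel_measurable borel"
  unfolding pullback_def[abs_def] by measurable

lemma pullback_integral_iff:
  fixes g :: "'d::{finite,wellorder} signal"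
  assumes [measurable]: "g \<in> borel_measurable borel"
  shows "has_bochner_integral lborel (\<lambda>\<eta>. (cmod (pullback g \<eta>))\<^sup>2) b \<longleftrightarrow>
    has_bochner_integral lborel (\<lambda>\<xi>. indicator half_space \<xi> * (cmod (g \<xi>))\<^sup>2) b"
proof -
  have "(\<lambda>\<eta>. (cmod (pullback g \<eta>))\<^sup>2) = (\<lambda>\<eta>. indicator half_space \<eta> * (Psi_jacobian \<eta> * (cmod (g (Psi \<eta>)))\<^sup>2))"
    by (auto simp: pullback_def norm_mult power_mult_distrib Psi_jacobian_nonneg)
  then show ?thesis
    using Psi_change_of_variables[of "\<lambda>\<xi>. (cmod (g \<xi>))\<^sup>2" b] by simp
qed

lemma
  fixes g :: "'d::{finite,wellorder} signal"
  assumes g: "g \<in> L2"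
  shows pullback_L2: "pullback g \<in> L2"
    and L2_norm_pullback: "(L2_norm (pullback g))\<^sup>2 = (LINT \<xi>|lborel. indicator half_space \<xi> * (cmod (g \<xi>))\<^sup>2)"
proof -
  note m = L2_measurable[OF g]
  have "integrable lborel (\<lambda>\<xi>. indicator half_space \<xi> * (cmod (g \<xi>))\<^sup>2)"
    using integrable_mult_indicator[OF _ L2_integrable[OF g], of half_space] by simp
  then have "has_bochner_integral lborel (\<lambda>\<eta>. (cmod (pullback g \<eta>))\<^sup>2) (LINT \<xi>|lborel. indicator half_space \<xi> * (cmod (g \<xi>))\<^sup>2)"
    by (simp add: pullback_integral_iff[OF m] has_bochner_integral_integrable)
  then show "pullback g \<in> L2"
    "(L2_norm (pullback g))\<^sup>2 = (LINT \<xi>|lborel. indicator half_space \<xi> * (cmod (g \<xi>))\<^sup>2)"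
    by (auto simp: L2_def L2_norm_squared pullback_measurable[OF m] has_bochner_integral_iff)
qed

lemma AE_boundary: "AE \<xi> in lborel. (\<xi>::real^'d::{finite,wellorder}) $ first \<noteq> 0"
proof -
  have "negligible {\<xi>::(real, 'd) vec. \<xi> $ first = 0}"
    by (rule negligible_standard_hyperplane_cart)
  then have "AE \<xi> in lebesgue. (\<xi>::(real, 'd) vec) \<notin> {\<xi>. \<xi> $ first = 0}"
    by (metis AE_not_in negligible_iff_null_sets)
  then show ?thesis by (simp add: AE_completion_iff)
qed

lemma L2_norm_pullback_on:
  fixes g :: "'d::{finite,wellorder} signal"
  assumes g: "g \<in> L2_on Theta_L"
  shows "L2_norm (pullback g) = L2_norm g"
proof -
  have g2: "g \<in> L2" and z: "AE x in lborel. x \<notin> Theta_L \<longrightarrow> g x = 0"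
    using g by (auto simp: L2_on_def)
  note [measurable] = L2_measurable[OF g2]
  have "(LINT \<xi>|lborel. indicator half_space \<xi> * (cmod (g \<xi>))\<^sup>2) = (LINT \<xi>|lborel. (cmod (g \<xi>))\<^sup>2)"
  proof (rule integral_cong_AE)
    show "AE \<xi> in lborel. indicator half_space \<xi> * (cmod (g \<xi>))\<^sup>2 = (cmod (g \<xi>))\<^sup>2"
      using z AE_boundary by eventually_elim (auto simp: half_space_def Theta_L_def indicator_def)
  qed measurable
  then have "(L2_norm (pullback g))\<^sup>2 = (L2_norm g)\<^sup>2"
    by (simp only: L2_norm_pullback[OF g2] L2_norm_squared[of g])
  then show ?thesis by (simp add: L2_norm_nonneg)
qed

lemma pullback_on:
  fixes g :: "'d::{finite,wellorder} signal"
  assumes "g \<in> L2"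
  shows "pullback g \<in> L2_on Theta_L"
  using pullback_L2[OF assms] by (auto simp: L2_on_def pullback_def half_space_def Theta_L_def)

text \<open>
  Composition with \<open>Psi\<close> respects equality almost everywhere because the norm of the pulled back
  difference is an integral of the difference.
\<close>

lemma pullback_cong:
  fixes f g :: "'d::{finite,wellorder} signal"
  assumes "f \<in> L2" "g \<in> L2" "ae_eq f g"
  shows "ae_eq (pullback f) (pullback g)"
proof -
  have "(\<lambda>x. pullback f x - pullback g x) = pullback (\<lambda>x. f x - g x)"
    by (auto simp: pullback_def right_diff_distrib)
  moreover have "(LINT \<xi>|lborel. indicator half_space \<xi> * (cmod (f \<xi> - g \<xi>))\<^sup>2) = 0"
    by (rule integral_eq_zero_AE) (use assms(3) in \<open>auto simp: ae_eq_def\<close>)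
  ultimately have "L2_norm (\<lambda>x. pullback f x - pullback g x) = 0"
    using L2_norm_pullback[OF L2_diff[OF assms(1,2)]] by simp
  then show ?thesis
    by (simp add: ae_eq_iff_L2_norm pullback_L2 assms)
qed

lemma pullback_surj:
  fixes f :: "'d::{finite,wellorder} signal"
  assumes f: "f \<in> L2_on Theta_L"
  shows "\<exists>g\<in>L2_on Theta_L. ae_eq (pullback g) f"
proof -
  have f2: "f \<in> L2" and z: "AE x in lborel. x \<notin> Theta_L \<longrightarrow> f x = 0"
    using f by (auto simp: L2_on_def)
  note [measurable] = L2_measurable[OF f2]
  define g where "g \<xi> = (if \<xi> \<in> half_space then f (Psi_inv \<xi>) / of_real (sqrt (Psi_jacobian (Psi_inv \<xi>))) else 0)" for \<xi>
  have m [measurable]: "g \<in> borel_measurable borel" unfolding g_def[abs_def] by measurable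
  have pg: "pullback g \<eta> = (if \<eta> \<in> half_space then f \<eta> else 0)" for \<eta>
    using Psi_jacobian_pos[of \<eta>] by (auto simp: pullback_def g_def Psi_in_half_space Psi_inv_Psi)
  have "integrable lborel (\<lambda>\<eta>. indicator half_space \<eta> * (cmod (f \<eta>))\<^sup>2)"
    using integrable_mult_indicator[OF _ L2_integrable[OF f2], of half_space] by simp
  moreover have "(\<lambda>\<eta>. indicator half_space \<eta> * (cmod (f \<eta>))\<^sup>2) = (\<lambda>\<eta>. (cmod (pullback g \<eta>))\<^sup>2)"
    by (auto simp: pg)
  ultimately have "has_bochner_integral lborel (\<lambda>\<eta>. (cmod (pullback g \<eta>))\<^sup>2) (LINT \<eta>|lborel. (cmod (pullback g \<eta>))\<^sup>2)"
    by (simp add: has_bochner_integral_integrable)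
  then have "integrable lborel (\<lambda>\<xi>. indicator half_space \<xi> * (cmod (g \<xi>))\<^sup>2)"
    unfolding pullback_integral_iff[OF m] by (rule integrable.intros)
  moreover have "(\<lambda>\<xi>. indicator half_space \<xi> * (cmod (g \<xi>))\<^sup>2) = (\<lambda>\<xi>. (cmod (g \<xi>))\<^sup>2)"
    by (auto simp: g_def)
  ultimately have "g \<in> L2" by (simp add: L2_def)
  then have "g \<in> L2_on Theta_L"
    by (auto simp: L2_on_def g_def half_space_def Theta_L_def)
  moreover have "ae_eq (pullback g) f"
    unfolding ae_eq_def using z AE_boundary
    by eventually_elim (auto simp: pg half_space_def Theta_L_def)
  ultimately show ?thesis by blast
qed

section \<open>Supports in the half space\<close>

text \<open>
  By the Lindeloef property a union of open null sets is already a countable union.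
\<close>

lemma ess_supp_subset_closed_iff:
  fixes g :: "'d::finite signal"
  assumes "closed C"
  shows "ess_supp g \<subseteq> C \<longleftrightarrow> (AE x in lborel. x \<notin> C \<longrightarrow> g x = 0)"
proof
  assume sub: "ess_supp g \<subseteq> C"
  let ?F = "{S. open S \<and> (AE x in lborel. x \<in> S \<longrightarrow> g x = 0)}"
  obtain F' where F': "F' \<subseteq> ?F" "countable F'" "\<Union>F' = \<Union>?F"
    using Lindelof[of ?F] by blast
  have "AE x in lborel. \<forall>S\<in>F'. x \<in> S \<longrightarrow> g x = 0"
    using F'(1) by (subst AE_ball_countable[OF F'(2)]) blast
  then show "AE x in lborel. x \<notin> C \<longrightarrow> g x = 0"
  proof eventually_elim
    case (elim x)
    have "x \<in> \<Union>F'" if "x \<notin> C"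
      using sub that unfolding F'(3) ess_supp_def by blast
    with elim show ?case by blast
  qed
next
  assume "AE x in lborel. x \<notin> C \<longrightarrow> g x = 0"
  then have "- C \<in> {S. open S \<and> (AE x in lborel. x \<in> S \<longrightarrow> g x = 0)}"
    using assms by (simp add: open_Compl)
  then show "ess_supp g \<subseteq> C"
    unfolding ess_supp_def by blast
qed

lemma closed_Theta_L: "closed (Theta_L :: (real^'d::{finite,wellorder}) set)"
  unfolding Theta_L_def by (intro closed_Collect_le continuous_intros)

text \<open>
  The condition on the essential support becomes a condition almost everywhere, the form in which
  \<^const>\<open>L2_on\<close> expresses supports.
\<close>

lemma H_space_iff: "f \<in> H_space \<longleftrightarrow> (\<exists>g\<in>L2_on Theta_L. is_fourier f g)"
  by (auto simp: H_space_def L2_on_def ess_supp_subset_closed_iff[OF closed_Theta_L] dest: is_fourier_L2)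

text \<open>
  The part \<open>N\<close> of \<open>F\<close> that lives outside \<open>S\<close> has norm zero, hence so has its image, and outside
  \<open>S\<close> the image of \<open>F\<close> is the image of \<open>N\<close>.
\<close>

lemma lower_symp_operator_L2_on:
  fixes k :: "real^'d::{finite,wellorder}^'d::_"
  assumes k: "invertible k" and S [measurable]: "S \<in> sets borel"
    and pres: "\<And>\<xi>. \<xi> \<notin> S \<Longrightarrow> matrix_inv k *v \<xi> \<notin> S"
    and F: "F \<in> L2_on S"
  shows "lower_symp_operator \<sigma> k F \<in> L2_on S"
proof -
  have F2: "F \<in> L2" and z: "AE x in lborel. x \<notin> S \<longrightarrow> F x = 0"
    using F by (auto simp: L2_on_def)
  note [measurable] = L2_measurable[OF F2]
  define N where "N \<xi> = (if \<xi> \<in> S then 0 else F \<xi>)" for \<xi>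
  have "N \<in> borel_measurable borel" unfolding N_def[abs_def] by measurable
  then have N: "N \<in> L2" by (rule L2_dominated[OF _ F2]) (simp add: N_def)
  have "L2_norm N = 0"
    by (rule L2_norm_eq_0_if_AE) (use z in eventually_elim, auto simp: N_def)
  then have "AE \<xi> in lborel. lower_symp_operator \<sigma> k N \<xi> = 0"
    using lower_symp_operator_L2[OF k N, of \<sigma>] by (intro L2_norm_eq_0_imp_AE) auto
  then have "AE \<xi> in lborel. \<xi> \<notin> S \<longrightarrow> lower_symp_operator \<sigma> k F \<xi> = 0"
    by eventually_elim (auto simp: lower_symp_operator_def N_def pres)
  then show ?thesis
    by (simp add: L2_on_def lower_symp_operator_L2[OF k F2])
qed

lemma sum_eq_single:
  fixes f :: "'i::finite \<Rightarrow> 'b::comm_monoid_add"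
  assumes "\<And>j. j \<noteq> a \<Longrightarrow> f j = 0"
  shows "sum f UNIV = f a"
proof -
  have "sum f UNIV = sum f {a}"
    by (rule sum.mono_neutral_right) (use assms in auto)
  then show ?thesis by simp
qed

section \<open>The embedding into the symplectic group\<close>

text \<open>
  Triangularity enters through the first column of \<open>h\<close>, which is \<open>h\<^sub>1\<^sub>1\<close> times the first unit
  vector: \<open>h\<^sup>T\<close> then scales the first coordinate, and \<open>h \<mapsto> h\<^sub>1\<^sub>1\<close> is multiplicative.
\<close>

context
  fixes h :: "real^'d::{finite,wellorder}^'d::_"
  assumes h: "h \<in> T_plus"
begin

lemma T_plus_invertible: "invertible h"
  and T_plus_first_pos: "h $ first $ first > 0"
  using h unfolding T_plus_def mem_Collect_eq by blast+

lemma T_plus_first_column: "i \<noteq> first \<Longrightarrow> h $ i $ first = 0"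
proof -
  assume "i \<noteq> first"
  then have "first < i" using first_le[of i] by (metis le_neq_trans)
  then show ?thesis using h unfolding T_plus_def mem_Collect_eq by blast
qed

lemma transpose_T_plus_first: "(transpose h *v \<xi>) $ first = h $ first $ first * \<xi> $ first"
  unfolding matrix_vector_mult_def transpose_def vec_lambda_beta
  by (rule sum_eq_single) (simp add: T_plus_first_column)

lemma T_plus_axis: "h *v axis first 1 = (h $ first $ first) *\<^sub>R axis first 1"
proof -
  have "(h *v axis first 1) $ i = ((h $ first $ first) *\<^sub>R axis first 1) $ i" for i
  proof -
    have "(h *v axis first 1) $ i = h $ i $ first"
      by (simp add: matrix_vector_mult_basis column_def)
    also have "\<dots> = ((h $ first $ first) *\<^sub>R axis first 1) $ i"
      using T_plus_first_column[of i] by (cases "i = first") (auto simp: axis_def)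
    finally show ?thesis .
  qed
  then show ?thesis unfolding vec_eq_iff by blast
qed

lemma mult_T_plus_first: "(g ** h) $ first $ first = g $ first $ first * h $ first $ first"
  unfolding matrix_matrix_mult_def vec_lambda_beta
  by (rule sum_eq_single) (simp add: T_plus_first_column)

end

text \<open>
  The linear map that corresponds to \<open>h\<^sup>T\<close> under \<open>Psi\<close> (see \<open>Psi_dilation_inv\<close>). As \<open>Psi\<close> is
  homogeneous of degree 2, the factor \<open>h\<^sub>1\<^sub>1\<close> by which \<open>h\<^sup>T\<close> acts on the first coordinate has to be
  split evenly.
\<close>

definition dilation_inv :: "real^'d::{finite,wellorder}^'d::_ \<Rightarrow> real^'d::_^'d::_" where
  "dilation_inv h = (1 / sqrt (h $ first $ first)) *\<^sub>R transpose h"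

definition dilation :: "real^'d::{finite,wellorder}^'d::_ \<Rightarrow> real^'d::_^'d::_" where
  "dilation h = matrix_inv (dilation_inv h)"

text \<open>
  The matrix \<open>(e\<^sub>1 x\<^sup>T + x e\<^sub>1\<^sup>T) / 2\<close>, whose quadratic form is \<open>\<eta>\<^sub>1 \<langle>x, \<eta>\<rangle>\<close>.
\<close>

definition phase_matrix :: "real^'d::{finite,wellorder} \<Rightarrow> real^'d::_^'d::_" where
  "phase_matrix x = (\<chi> i j. ((if i = first then x $ j else 0) + (if j = first then x $ i else 0)) / 2)"

definition embedding ::
    "(real^'d::{finite,wellorder}) \<times> (real^'d::_^'d::_) \<Rightarrow> real^('d::_ + 'd::_)^('d::_ + 'd::_)" where
  "embedding = (\<lambda>(x, h). lower_symp (phase_matrix x) (dilation h))"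

lemma det_scaleR_matrix: "det (c *\<^sub>R (A :: real^'n^'n)) = c ^ CARD('n) * det A"
proof -
  have "c *\<^sub>R A = (\<chi> i. c *s A $ i)" by (simp add: vec_eq_iff)
  then show ?thesis by (simp add: det_rows_mul)
qed

lemma det_dilation_inv:
  fixes h :: "real^'d::{finite,wellorder}^'d::_"
  shows "det (dilation_inv h) = (1 / sqrt (h $ first $ first)) ^ CARD('d) * det h"
  unfolding dilation_inv_def det_scaleR_matrix det_transpose ..

lemma
  fixes h :: "real^'d::{finite,wellorder}^'d::_"
  assumes h: "h \<in> T_plus"
  shows invertible_dilation_inv: "invertible (dilation_inv h)"
    and invertible_dilation: "invertible (dilation h)"
    and matrix_inv_dilation: "matrix_inv (dilation h) = dilation_inv h"
proof -
  show 1: "invertible (dilation_inv h)"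
    using T_plus_invertible[OF h] T_plus_first_pos[OF h] by (simp add: invertible_det_nz det_dilation_inv)
  show "invertible (dilation h)" "matrix_inv (dilation h) = dilation_inv h"
    by (simp_all add: dilation_def invertible_matrix_inv[OF 1] matrix_inv_matrix_inv[OF 1])
qed

lemma dilation_inv_vec: "dilation_inv h *v \<xi> = (1 / sqrt (h $ first $ first)) *\<^sub>R (transpose h *v \<xi>)"
  by (simp only: dilation_inv_def scaleR_matrix_vector_assoc)

lemma dilation_inv_first:
  assumes h: "h \<in> T_plus"
  shows "(dilation_inv h *v \<xi>) $ first = sqrt (h $ first $ first) * \<xi> $ first"
proof -
  have "(dilation_inv h *v \<xi>) $ first = (h $ first $ first / sqrt (h $ first $ first)) * \<xi> $ first"
    unfolding dilation_inv_vec vector_scaleR_component transpose_T_plus_first[OF h] by simp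
  also have "h $ first $ first / sqrt (h $ first $ first) = sqrt (h $ first $ first)"
    using T_plus_first_pos[OF h] by (intro real_div_sqrt) simp
  finally show ?thesis .
qed

lemma Psi_dilation_inv:
  assumes h: "h \<in> T_plus"
  shows "Psi (dilation_inv h *v \<eta>) = transpose h *v Psi \<eta>"
proof -
  have "Psi (dilation_inv h *v \<eta>) =
      (- (sqrt (h $ first $ first) * \<eta> $ first) / 2 * (1 / sqrt (h $ first $ first))) *\<^sub>R (transpose h *v \<eta>)"
    unfolding Psi_def dilation_inv_first[OF h] unfolding dilation_inv_vec by simp
  also have "- (sqrt (h $ first $ first) * \<eta> $ first) / 2 * (1 / sqrt (h $ first $ first)) = - (\<eta> $ first) / 2"
    using T_plus_first_pos[OF h] by simp
  also have "\<dots> *\<^sub>R (transpose h *v \<eta>) = transpose h *v Psi \<eta>"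
    unfolding Psi_def by (simp only: matrix_vector_mult_scaleR)
  finally show ?thesis .
qed

lemma dilation_inv_half_space:
  assumes h: "h \<in> T_plus"
  shows "dilation_inv h *v \<eta> \<in> half_space \<longleftrightarrow> \<eta> \<in> half_space"
  using T_plus_first_pos[OF h] by (simp add: half_space_def dilation_inv_first[OF h] mult_less_0_iff)

lemma dilation_inv_Theta_L:
  assumes h: "h \<in> T_plus"
  shows "dilation_inv h *v \<eta> \<in> Theta_L \<longleftrightarrow> \<eta> \<in> Theta_L"
  using T_plus_first_pos[OF h] by (simp add: Theta_L_def dilation_inv_first[OF h] mult_le_0_iff)

lemma phase_matrix_vec:
  "phase_matrix x *v \<eta> = (1/2) *\<^sub>R ((x \<bullet> \<eta>) *\<^sub>R axis first 1 + (\<eta> $ first) *\<^sub>R x)"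
proof -
  have "(phase_matrix x *v \<eta>) $ i = ((if i = first then x \<bullet> \<eta> else 0) + \<eta> $ first * x $ i) / 2" for i
  proof -
    have "(phase_matrix x *v \<eta>) $ i
        = (\<Sum>j\<in>UNIV. (if i = first then x $ j * \<eta> $ j else 0) / 2 + (if j = first then \<eta> $ j * x $ i / 2 else 0))"
      unfolding matrix_vector_mult_def phase_matrix_def
      by (simp, intro sum.cong refl) (auto simp: field_simps)
    also have "\<dots> = ((if i = first then x \<bullet> \<eta> else 0) + \<eta> $ first * x $ i) / 2"
      by (simp add: sum.distrib inner_vec_def sum_divide_distrib[symmetric] add_divide_distrib)
    finally show ?thesis .
  qed
  then show ?thesis by (auto simp: vec_eq_iff axis_def)
qed

lemma transpose_phase_matrix: "transpose (phase_matrix x) = phase_matrix x"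
  by (simp add: vec_eq_iff transpose_def phase_matrix_def add.commute)

lemma phase_matrix_quadratic:
  "(phase_matrix x *v \<eta>) \<bullet> \<eta> = - 2 * (x \<bullet> Psi \<eta>)"
  by (simp add: phase_matrix_vec Psi_def inner_add_left inner_axis' algebra_simps)

text \<open>
  The phases agree by \<open>phase_matrix_quadratic\<close> and the arguments by \<open>Psi_dilation_inv\<close>. The
  scalar factors agree because the Jacobian of \<open>Psi\<close> is homogeneous of degree \<open>d\<close> in the first
  coordinate: it contributes \<open>h\<^sub>1\<^sub>1\<^sup>d\<^sup>/\<^sup>2\<close>, which is exactly what the rescaling takes away from
  the determinant.
\<close>

lemma pullback_dual_action:
  fixes h :: "real^'d::{finite,wellorder}^'d::_"
  assumes h: "h \<in> T_plus"
  shows "pullback (dual_action (x, h) g) = lower_symp_operator (phase_matrix x) (dilation h) (pullback g)"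
proof
  fix \<eta> :: "(real, 'd) vec"
  define a where "a = h $ first $ first"
  have a: "a > 0" using T_plus_first_pos[OF h] by (simp add: a_def)
  show "pullback (dual_action (x, h) g) \<eta> = lower_symp_operator (phase_matrix x) (dilation h) (pullback g) \<eta>"
  proof (cases "\<eta> \<in> half_space")
    case False
    then show ?thesis
      by (simp add: pullback_def lower_symp_operator_def matrix_inv_dilation[OF h] dilation_inv_half_space[OF h])
  next
    case True
    have "det (dilation h) * det (dilation_inv h) = 1"
      by (metis det_I det_mul matrix_inv_mult(1)[OF invertible_dilation[OF h]] matrix_inv_dilation[OF h])
    then have "det (dilation h) = 1 / det (dilation_inv h)"
      by (metis mult_eq_0_iff nonzero_eq_divide_eq zero_neq_one)
    then have "\<bar>det (dilation h)\<bar> powr (- 1/2) = \<bar>det (dilation_inv h)\<bar> powr (1/2)"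
      by (simp add: powr_minus_divide powr_divide)
    then have d: "\<bar>det (dilation h)\<bar> powr (- 1/2) = sqrt \<bar>det (dilation_inv h)\<bar>"
      by (simp add: powr_half_sqrt)
    have "Psi_jacobian (dilation_inv h *v \<eta>) = sqrt a ^ CARD('d) * Psi_jacobian \<eta>"
      using a by (simp add: Psi_jacobian_def dilation_inv_first[OF h] a_def[symmetric] abs_mult power_mult_distrib power_divide)
    then have "\<bar>det (dilation_inv h)\<bar> * Psi_jacobian (dilation_inv h *v \<eta>) = \<bar>det h\<bar> * Psi_jacobian \<eta>"
      using a by (simp add: det_dilation_inv a_def[symmetric] abs_mult power_divide)
    then have J: "\<bar>det (dilation h)\<bar> powr (- 1/2) * sqrt (Psi_jacobian (dilation_inv h *v \<eta>))
        = \<bar>det h\<bar> powr (1/2) * sqrt (Psi_jacobian \<eta>)"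
      unfolding d by (simp add: powr_half_sqrt flip: real_sqrt_mult)
    have e: "exp (pi * \<i> * ((phase_matrix x *v \<eta>) \<bullet> \<eta>)) = cis (- (2 * pi * (x \<bullet> Psi \<eta>)))"
      unfolding phase_matrix_quadratic by (simp add: cis_conv_exp mult_ac)
    have "lower_symp_operator (phase_matrix x) (dilation h) (pullback g) \<eta>
        = of_real (\<bar>det (dilation h)\<bar> powr (- 1/2) * sqrt (Psi_jacobian (dilation_inv h *v \<eta>))) *
          cis (- (2 * pi * (x \<bullet> Psi \<eta>))) * g (transpose h *v Psi \<eta>)"
      unfolding lower_symp_operator_def e matrix_inv_dilation[OF h] pullback_def dilation_inv_half_space[OF h] Psi_dilation_inv[OF h]
      using True by simp
    also have "\<dots> = pullback (dual_action (x, h) g) \<eta>"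
      unfolding J using True by (simp add: pullback_def dual_action_def mult_ac)
    finally show ?thesis ..
  qed
qed

lemma matrix_mult_add_right_distrib: "((A::real^'n^'m) + B) ** (C::real^'k^'n) = A ** C + B ** C"
  by (simp add: vec_eq_iff matrix_matrix_mult_def sum.distrib distrib_right)

lemma scaleR_matrix_mult_scaleR: "(a *\<^sub>R (A::real^'n^'m)) ** (b *\<^sub>R (B::real^'k^'n)) = (a * b) *\<^sub>R (A ** B)"
  by (simp add: vec_eq_iff matrix_matrix_mult_def sum_distrib_left mult_ac)

text \<open>
  The matrices \<^term>\<open>lower_symp \<sigma> k\<close> multiply as in a semidirect product in which \<open>k\<close> acts on
  symmetric matrices by congruence.
\<close>

lemma lower_symp_mult:
  fixes k k' :: "real^'d::finite^'d"
  assumes k: "invertible k" and k': "invertible k'"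
  shows "lower_symp \<sigma> k ** lower_symp \<sigma>' k' =
    lower_symp (\<sigma> + transpose (matrix_inv k) ** \<sigma>' ** matrix_inv k) (k ** k')"
proof -
  have "(k ** k') ** (matrix_inv k' ** matrix_inv k) = k ** (k' ** matrix_inv k') ** matrix_inv k"
    by (simp only: matrix_mul_assoc)
  also have "\<dots> = mat 1"
    by (simp add: matrix_inv_mult[OF k] matrix_inv_mult[OF k'])
  finally have inv: "matrix_inv (k ** k') = matrix_inv k' ** matrix_inv k"
    by (rule matrix_inv_unique)
  have "transpose (matrix_inv k) ** \<sigma>' ** matrix_inv k ** (k ** k')
      = transpose (matrix_inv k) ** \<sigma>' ** (matrix_inv k ** k) ** k'"
    by (simp only: matrix_mul_assoc)
  also have "\<dots> = transpose (matrix_inv k) ** (\<sigma>' ** k')"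
    by (simp add: matrix_inv_mult[OF k] matrix_mul_assoc)
  finally have C: "transpose (matrix_inv k) ** \<sigma>' ** matrix_inv k ** (k ** k') = transpose (matrix_inv k) ** (\<sigma>' ** k')" .
  show ?thesis
    unfolding lower_symp_def block_matrix_mult inv matrix_transpose_mul matrix_mult_add_right_distrib C
    by (simp add: matrix_mul_assoc)
qed

text \<open>
  The congruence action on phase matrices is the given action of \<open>h\<close> on translations, since
  \<open>h (e\<^sub>1 y\<^sup>T + y e\<^sub>1\<^sup>T) h\<^sup>T = h\<^sub>1\<^sub>1 (e\<^sub>1 (h y)\<^sup>T + (h y) e\<^sub>1\<^sup>T)\<close> and the two scalings contribute
  \<open>1 / h\<^sub>1\<^sub>1\<close>.
\<close>

lemma phase_matrix_conjugate:
  fixes h :: "real^'d::{finite,wellorder}^'d::_"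
  assumes h: "h \<in> T_plus"
  shows "transpose (dilation_inv h) ** phase_matrix y ** dilation_inv h = phase_matrix (h *v y)"
proof -
  define c where "c = 1 / sqrt (h $ first $ first)"
  have c: "c * c * h $ first $ first = 1"
    using T_plus_first_pos[OF h] by (simp add: c_def)
  have t: "transpose (dilation_inv h) *v v = c *\<^sub>R (h *v v)" for v
    by (simp add: dilation_inv_def c_def[symmetric] transpose_scalar scaleR_matrix_vector_assoc)
  have t': "dilation_inv h *v v = c *\<^sub>R (transpose h *v v)" for v
    by (simp only: dilation_inv_def c_def scaleR_matrix_vector_assoc)
  have adj: "y \<bullet> (transpose h *v v) = (h *v y) \<bullet> v" for v
    by (metis dot_lmul_matrix inner_commute transpose_matrix_vector)
  have "(transpose (dilation_inv h) ** phase_matrix y ** dilation_inv h) *v v = phase_matrix (h *v y) *v v" for v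
  proof -
    have "(transpose (dilation_inv h) ** phase_matrix y ** dilation_inv h) *v v
        = c *\<^sub>R (h *v (phase_matrix y *v (c *\<^sub>R (transpose h *v v))))"
      by (simp only: matrix_vector_mul_assoc[symmetric] t t')
    also have "\<dots> = (c * c) *\<^sub>R (h *v (phase_matrix y *v (transpose h *v v)))"
      by (simp only: matrix_vector_mult_scaleR scaleR_scaleR)
    also have "h *v (phase_matrix y *v (transpose h *v v))
        = (1/2) *\<^sub>R (((h *v y) \<bullet> v) *\<^sub>R (h $ first $ first *\<^sub>R axis first 1) + (h $ first $ first * v $ first) *\<^sub>R (h *v y))"
      by (simp only: phase_matrix_vec adj transpose_T_plus_first[OF h] matrix_vector_mult_scaleR
          matrix_vector_right_distrib T_plus_axis[OF h])
    also have "(c * c) *\<^sub>R \<dots> = (c * c * h $ first $ first) *\<^sub>R (phase_matrix (h *v y) *v v)"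
      unfolding phase_matrix_vec by (simp add: scaleR_add_right mult_ac)
    finally show ?thesis by (simp add: c)
  qed
  then show ?thesis by (simp add: matrix_eq)
qed

lemma dilation_mult:
  fixes h g :: "real^'d::{finite,wellorder}^'d::_"
  assumes h: "h \<in> T_plus" and g: "g \<in> T_plus"
  shows "dilation (h ** g) = dilation h ** dilation g"
proof -
  have c: "1 / sqrt (a * b) = (1 / sqrt b) * (1 / sqrt a)" for a b :: real
    by (simp add: real_sqrt_mult)
  have "dilation_inv (h ** g) = dilation_inv g ** dilation_inv h"
    by (simp only: dilation_inv_def mult_T_plus_first[OF g] scaleR_matrix_mult_scaleR matrix_transpose_mul c)
  then have "dilation_inv (h ** g) ** (dilation h ** dilation g) = dilation_inv g ** (dilation_inv h ** dilation h) ** dilation g"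
    by (simp only: matrix_mul_assoc)
  also have "\<dots> = mat 1"
    using matrix_inv_mult(2)[OF invertible_dilation[OF h]] matrix_inv_mult(2)[OF invertible_dilation[OF g]]
    by (simp add: matrix_inv_dilation h g)
  finally show ?thesis
    unfolding dilation_def[of "h ** g"] by (rule matrix_inv_unique)
qed

lemma phase_matrix_add: "phase_matrix (x + y) = phase_matrix x + phase_matrix y"
proof -
  have "phase_matrix (x + y) $ i $ j = (phase_matrix x + phase_matrix y) $ i $ j" for i j
    by (cases "i = first"; cases "j = first") (simp_all add: phase_matrix_def add_divide_distrib)
  then show ?thesis unfolding vec_eq_iff by blast
qed

lemma embedding_mult:
  fixes h g :: "real^'d::{finite,wellorder}^'d::_"
  assumes h: "h \<in> T_plus" and g: "g \<in> T_plus"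
  shows "embedding (x + h *v y, h ** g) = embedding (x, h) ** embedding (y, g)"
  unfolding embedding_def prod.case lower_symp_mult[OF invertible_dilation[OF h] invertible_dilation[OF g]]
    matrix_inv_dilation[OF h] phase_matrix_conjugate[OF h] dilation_mult[OF h g] phase_matrix_add ..

lemma phase_matrix_inject: "phase_matrix x = phase_matrix y \<Longrightarrow> x = y"
proof -
  assume e: "phase_matrix x = phase_matrix y"
  have "x $ i = y $ i" for i
    using arg_cong[OF e, of "\<lambda>M. M $ i $ first"] arg_cong[OF e, of "\<lambda>M. M $ first $ first"]
    by (auto simp: phase_matrix_def split: if_splits)
  then show "x = y" by (simp add: vec_eq_iff)
qed

lemma dilation_inject:
  fixes h g :: "real^'d::{finite,wellorder}^'d::_"
  assumes h: "h \<in> T_plus" and g: "g \<in> T_plus" and e: "dilation h = dilation g"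
  shows "h = g"
proof -
  have i: "dilation_inv h = dilation_inv g"
    using matrix_inv_dilation[OF h] matrix_inv_dilation[OF g] e by simp
  have "sqrt (h $ first $ first) = sqrt (g $ first $ first)"
    using dilation_inv_first[OF h, of "axis first 1"] dilation_inv_first[OF g, of "axis first 1"] i
    by (simp add: axis_def)
  then have "transpose h = transpose g"
    using i T_plus_first_pos[OF g] by (simp add: dilation_inv_def)
  then show ?thesis by (metis transpose_transpose)
qed

lemma embedding_mon:
  fixes H :: "(real^'d::{finite,wellorder}^'d::_) set"
  assumes "H \<subseteq> T_plus"
  shows "embedding \<in> mon (semidirect H) Sp"
proof -
  have "inj_on embedding (UNIV \<times> H)"
  proof (rule inj_onI, clarify)
    fix x y h g assume hg: "h \<in> H" "g \<in> H" and e: "embedding (x, h) = embedding (y, g)"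
    then have "h \<in> T_plus" "g \<in> T_plus" using assms by auto
    moreover have "dilation g = dilation h" "phase_matrix y = phase_matrix x"
      using lower_symp_inject[OF invertible_dilation[OF \<open>h \<in> T_plus\<close>]] e by (simp_all add: embedding_def)
    ultimately show "x = y \<and> h = g"
      using phase_matrix_inject dilation_inject by metis
  qed
  moreover have "embedding (x, h) \<in> symplectic" if "h \<in> H" for x h
    using that assms lower_symp_in_symplectic[OF transpose_phase_matrix invertible_dilation]
    by (auto simp: embedding_def)
  moreover have "embedding (x + h *v y, h ** g) = embedding (x, h) ** embedding (y, g)"
    if "h \<in> H" "g \<in> H" for x y h g
    using that assms embedding_mult by blast
  ultimately show ?thesis
    by (auto simp: mon_def hom_def semidirect_def Sp_def)
qed

section \<open>The unitary equivalence\<close>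

text \<open>
  The choice operator picks a representative of the Fourier-Plancherel transform, which is unique
  almost everywhere.
\<close>

definition intertwiner :: "'d::{finite,wellorder} signal \<Rightarrow> 'd::_ signal" where
  "intertwiner f = pullback (SOME g. is_fourier f g)"

lemma intertwiner_eq:
  fixes f g :: "'d::{finite,wellorder} signal"
  assumes "is_fourier f g"
  shows "intertwiner f \<in> L2_on Theta_L" "ae_eq (intertwiner f) (pullback g)"
proof -
  have s: "is_fourier f (SOME g. is_fourier f g)" using assms by (rule someI[where P="is_fourier f"])
  show "intertwiner f \<in> L2_on Theta_L"
    unfolding intertwiner_def by (rule pullback_on[OF is_fourier_L2(2)[OF s]])
  have "ae_eq (SOME g. is_fourier f g) g"
    by (rule is_fourier_unique[OF s assms]) (simp add: ae_eq_def)
  then show "ae_eq (intertwiner f) (pullback g)"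
    unfolding intertwiner_def by (intro pullback_cong is_fourier_L2(2)[OF s] is_fourier_L2(2)[OF assms])
qed

lemma L2_norm_ae_eq:
  fixes f g :: "'d::finite signal"
  assumes "f \<in> L2" "g \<in> L2" "ae_eq f g"
  shows "L2_norm f = L2_norm g"
  using L2_norm_diff_ge[OF assms(1,2)] assms(3) unfolding ae_eq_iff_L2_norm[OF assms(1,2)] by simp

lemma intertwiner_unitary:
  "unitary_map (H_space :: 'd::{finite,wellorder} signal set) (L2_on Theta_L) intertwiner"
  unfolding unitary_map_def
proof (intro conjI ballI allI)
  fix f :: "'d signal" assume "f \<in> H_space"
  then obtain g where g: "g \<in> L2_on Theta_L" "is_fourier f g" by (auto simp: H_space_iff)
  note e = intertwiner_eq[OF g(2)]
  show "intertwiner f \<in> L2_on Theta_L" by (rule e)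
  have "L2_norm (intertwiner f) = L2_norm (pullback g)"
    using e pullback_L2[OF is_fourier_L2(2)[OF g(2)]] by (intro L2_norm_ae_eq) (auto simp: L2_on_def)
  then show "L2_norm (intertwiner f) = L2_norm f"
    by (simp add: L2_norm_pullback_on[OF g(1)] is_fourier_isometry[OF g(2)])
  show "ae_eq (intertwiner (\<lambda>x. c * f x)) (\<lambda>x. c * intertwiner f x)" for c
  proof -
    have "pullback (\<lambda>x. c * g x) = (\<lambda>x. c * pullback g x)"
      by (auto simp: pullback_def)
    then show ?thesis
      using intertwiner_eq(2)[OF is_fourier_cmult[OF g(2), of c]] e(2) by (auto simp: ae_eq_def)
  qed
  fix f' :: "'d signal" assume "f' \<in> H_space"
  then obtain g' where g': "g' \<in> L2_on Theta_L" "is_fourier f' g'" by (auto simp: H_space_iff)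
  have "pullback (\<lambda>x. g x + g' x) = (\<lambda>x. pullback g x + pullback g' x)"
    by (auto simp: pullback_def distrib_left)
  with intertwiner_eq(2)[OF is_fourier_add[OF g(2) g'(2)]]
  have "AE x in lborel. intertwiner (\<lambda>x. f x + f' x) x = pullback g x + pullback g' x"
    by (simp add: ae_eq_def)
  moreover have "AE x in lborel. intertwiner f x = pullback g x" "AE x in lborel. intertwiner f' x = pullback g' x"
    using e(2) intertwiner_eq(2)[OF g'(2)] by (auto simp: ae_eq_def)
  ultimately show "ae_eq (intertwiner (\<lambda>x. f x + f' x)) (\<lambda>x. intertwiner f x + intertwiner f' x)"
    unfolding ae_eq_def by eventually_elim simp
next
  fix F :: "'d signal" assume "F \<in> L2_on Theta_L"
  then obtain g where g: "g \<in> L2_on Theta_L" "ae_eq (pullback g) F" using pullback_surj by blast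
  then obtain f where f: "is_fourier f g" using is_fourier_surj[of g] by (auto simp: L2_on_def)
  show "\<exists>f\<in>H_space. ae_eq (intertwiner f) F"
  proof
    show "f \<in> H_space" using f g by (auto simp: H_space_iff)
    have "AE x in lborel. intertwiner f x = pullback g x" "AE x in lborel. pullback g x = F x"
      using intertwiner_eq(2)[OF f] g(2) by (auto simp: ae_eq_def)
    then show "ae_eq (intertwiner f) F"
      unfolding ae_eq_def by eventually_elim simp
  qed
qed

theorem theorem33:
  fixes H :: "(real^'d::{finite,wellorder}^'d::_) set"
  assumes "subgroup H GL" and "H \<subseteq> T_plus"
  shows "\<exists>\<phi> \<in> mon (semidirect H) Sp.
           unitarily_equivalent (carrier (semidirect H))
             quasi_regular H_space (metaplectic \<circ> \<phi>) (L2_on Theta_L)"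
proof (rule bexI[OF _ embedding_mon[OF assms(2)]])
  have meta: "(metaplectic \<circ> embedding) (x, h) = lower_symp_operator (phase_matrix x) (dilation h)"
    if "h \<in> T_plus" for x and h :: "((real, 'd) vec, 'd) vec"
    by (simp add: embedding_def metaplectic_lower_symp[OF transpose_phase_matrix invertible_dilation[OF that]])
  have Theta: "(Theta_L :: (real, 'd) vec set) \<in> sets borel"
    using closed_Theta_L by (rule borel_closed)
  have dual_on: "dual_action (x, h) g \<in> L2_on Theta_L"
    if h: "h \<in> T_plus" and g: "g \<in> L2_on Theta_L" for x g and h :: "((real, 'd) vec, 'd) vec"
  proof -
    note inv = T_plus_invertible[OF h]
    note tinv = invertible_transpose_matrix[OF inv]
    have "lower_symp_operator 0 (matrix_inv (transpose h)) g \<in> L2_on Theta_L"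
    proof (rule lower_symp_operator_L2_on[OF invertible_matrix_inv[OF tinv] Theta _ g])
      fix \<xi> :: "(real, 'd) vec" assume "\<xi> \<notin> Theta_L"
      then show "matrix_inv (matrix_inv (transpose h)) *v \<xi> \<notin> Theta_L"
        unfolding matrix_inv_matrix_inv[OF tinv] Theta_L_def mem_Collect_eq transpose_T_plus_first[OF h]
        using T_plus_first_pos[OF h] by (simp add: mult_le_0_iff)
    qed
    then have "AE \<xi> in lborel. \<xi> \<notin> Theta_L \<longrightarrow> dual_action (x, h) g \<xi> = 0"
      unfolding dual_action_eq_lower_symp_operator[OF inv] L2_on_def by auto
    then show ?thesis
      using dual_action_L2[OF inv, of g x] g by (simp add: L2_on_def)
  qed
  show "unitarily_equivalent (carrier (semidirect H)) quasi_regular H_space (metaplectic \<circ> embedding) (L2_on Theta_L)"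
    unfolding unitarily_equivalent_def
  proof (intro conjI ballI exI[of _ intertwiner] intertwiner_unitary)
    fix a f assume "a \<in> carrier (semidirect H)" and "f \<in> L2_on (Theta_L :: (real, 'd) vec set)"
    then obtain x h where a: "a = (x, h)" "h \<in> T_plus" using assms(2) by (auto simp: semidirect_def)
    show "(metaplectic \<circ> embedding) a f \<in> L2_on Theta_L"
      unfolding a(1) meta[OF a(2)]
      by (rule lower_symp_operator_L2_on[OF invertible_dilation[OF a(2)] Theta _ \<open>f \<in> _\<close>])
        (simp add: matrix_inv_dilation[OF a(2)] dilation_inv_Theta_L[OF a(2)])
  next
    fix a f assume "a \<in> carrier (semidirect H)" and "f \<in> (H_space :: ((real, 'd) vec \<Rightarrow> complex) set)"
    then obtain x h where a: "a = (x, h)" "h \<in> T_plus" using assms(2) by (auto simp: semidirect_def)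
    obtain g where g: "g \<in> L2_on Theta_L" "is_fourier f g" using \<open>f \<in> H_space\<close> by (auto simp: H_space_iff)
    have F: "is_fourier (quasi_regular a f) (dual_action (x, h) g)"
      unfolding a(1) by (rule is_fourier_quasi_regular[OF T_plus_invertible[OF a(2)] g(2)])
    then show "quasi_regular a f \<in> H_space"
      using dual_on[OF a(2) g(1)] by (auto simp: H_space_iff)
    have I2: "intertwiner f \<in> L2" "pullback g \<in> L2"
      using intertwiner_eq(1)[OF g(2)] pullback_L2[OF is_fourier_L2(2)[OF g(2)]] by (auto simp: L2_on_def)
    let ?\<mu> = "lower_symp_operator (phase_matrix x) (dilation h)"
    have "(\<lambda>\<eta>. ?\<mu> (pullback g) \<eta> - ?\<mu> (intertwiner f) \<eta>) = ?\<mu> (\<lambda>\<eta>. pullback g \<eta> - intertwiner f \<eta>)"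
      by (rule ext) (simp add: lower_symp_operator_def right_diff_distrib)
    moreover have "L2_norm (\<lambda>\<eta>. pullback g \<eta> - intertwiner f \<eta>) = 0"
      unfolding L2_norm_diff_commute[of "pullback g" "intertwiner f"]
      using intertwiner_eq(2)[OF g(2)] I2 by (simp add: ae_eq_iff_L2_norm)
    ultimately have "ae_eq (?\<mu> (pullback g)) (?\<mu> (intertwiner f))"
      using lower_symp_operator_L2[OF invertible_dilation[OF a(2)]] I2 L2_diff[OF I2(2,1)]
      by (simp add: ae_eq_iff_L2_norm)
    moreover have "ae_eq (intertwiner (quasi_regular a f)) (?\<mu> (pullback g))"
      using intertwiner_eq(2)[OF F] by (simp add: pullback_dual_action[OF a(2)])
    ultimately have "AE \<eta> in lborel. intertwiner (quasi_regular a f) \<eta> = ?\<mu> (intertwiner f) \<eta>"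
      unfolding ae_eq_def by eventually_elim simp
    then show "ae_eq (intertwiner (quasi_regular a f)) ((metaplectic \<circ> embedding) a (intertwiner f))"
      unfolding a(1) meta[OF a(2)] ae_eq_def .
  qed
qed

end
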